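(* Let $d\ge1$, $\sigma\in(-d,0)$, and let $g\in C^0(\mathbb{R}^d)$ satisfy $g(x)\ge0$ for $|x|$ large enough. Then the following hold. (1) ($\Gamma$-liminf inequality) For every $\rho\in L^1(\mathbb{R}^d,[0,1])$ and every family $\{\mu_\varepsilon\}_{\varepsilon\in(0,1)}\subset\mathcal{M}_b(\mathbb{R}^d)$ with $\frac{\varepsilon^d\omega_d}{C^d}\mu_\varepsilon\to\rho\,\mathcal{L}^d$ tightly in $\mathcal{M}_b(\mathbb{R}^d)$, $$\mathcal{T}^\sigma(\rho\,\mathcal{L}^d)\le\liminf_{\varepsilon\to0^+}\mathcal{T}^\sigma_\varepsilon(\mu_\varepsilon).$$ (2) ($\Gamma$-limsup inequality) For every $\rho\in L^1(\mathbb{R}^d,[0,1])$ there exists a family $\{\mu_\varepsilon\}_{\varepsilon\in(0,1)}\subset\mathcal{M}_b(\mathbb{R}^d)$ such that $\frac{\varepsilon^d\omega_d}{C^d}\mu_\varepsilon\to\rho\,\mathcal{L}^d$ tightly in $\mathcal{M}_b(\mathbb{R}^d)$ and $$\mathcal{T}^\sigma(\rho\,\mathcal{L}^d)\ge\limsup_{\varepsilon\to0^+}\mathcal{T}^\sigma_\varepsilon(\mu_\varepsilon).$$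
   Context: $\mathcal{L}^d$ (also $|\cdot|$ on sets) is Lebesgue measure on $\mathbb{R}^d$, $\omega_d$ is the Lebesgue measure of the unit ball, $\mathcal{M}_b(\mathbb{R}^d)$ is the set of nonnegative finite Radon measures on $\mathbb{R}^d$, and $L^1(\mathbb{R}^d,[0,1])$ is the set of integrable functions with values in $[0,1]$. Optimal packing density: let $\mathrm{Ad}^d$ be the class of sets $X\subset\mathbb{R}^d$ with $|x-y|\ge2$ for all distinct $x,y\in X$, and let $Q=[0,1)^d$. Then $$C^d:=\sup_{X\in\mathrm{Ad}^d}\limsup_{r\to+\infty}\frac{\#(X\cap rQ)\,\omega_d}{|rQ|}.$$ Tight convergence $\nu_\varepsilon\to\nu$ in $\mathcal{M}_b(\mathbb{R}^d)$ means $\nu_\varepsilon\stackrel{*}{\rightharpoonup}\nu$ weakly-star and $\nu_\varepsilon(\mathbb{R}^d)\to\nu(\mathbb{R}^d)$ as $\varepsilon\to0^+$. For $\varepsilon>0$, $\mathcal{EM}_\varepsilon$ is the set of measures $\sum_{i=1}^N\delta_{x_i}$ ($N\in\mathbb{N}$, possibly $N=0$) with $|x_i-x_j|\ge2\varepsilon$ for all $i\ne j$. Discrete energies on $\mathcal{M}_b(\mathbb{R}^d)$: $$\mathcal{F}^\sigma_\varepsilon(\mu)=\sum_{i\ne j}-\frac{1}{|x_i-x_j|^{d+\sigma}}\Big(\frac{\omega_d\varepsilon^d}{C^d}\Big)^2\quad\text{if }\mu=\sum_{i=1}^N\delta_{x_i}\in\mathcal{EM}_\varepsilon,\qquad \mathcal{F}^\sigma_\varepsilon(\mu)=+\infty\text{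 otherwise},$$ $$\mathcal{T}^\sigma_\varepsilon(\mu)=\mathcal{F}^\sigma_\varepsilon(\mu)+\int_{\mathbb{R}^d}g(x)\,\frac{\varepsilon^d\omega_d}{C^d}\,d\mu(x).$$ Limit energy on $\mathcal{M}_b(\mathbb{R}^d)$: $$\mathcal{T}^\sigma(\mu)=\int_{\mathbb{R}^d}\int_{\mathbb{R}^d}-\frac{1}{|x-y|^{d+\sigma}}\,d\mu\otimes\mu+\int_{\mathbb{R}^d}g(x)\,d\mu(x)\quad\text{if }\mu\le\mathcal{L}^d,$$ and $\mathcal{T}^\sigma(\mu)=+\infty$ otherwise. *)

theory Defs
  imports "HOL-Probability.Probability"
begin

text \<open>
  The space \<open>\<real>\<^sup>d\<close> is an arbitrary Euclidean space \<^typ>\<open>'a::euclidean_space\<close>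
  with \<open>d = DIM('a) \<ge> 1\<close>; constants that depend on \<open>d\<close> only take an argument \<open>TYPE('a)\<close>.
\<close>

definition omega :: "'a::euclidean_space itself \<Rightarrow> real" where
  "omega _ = measure lborel (ball (0::'a) 1)"

definition Ad :: "'a::euclidean_space set set" where
  "Ad = {X. \<forall>x\<in>X. \<forall>y\<in>X. x \<noteq> y \<longrightarrow> norm (x - y) \<ge> 2}"

definition unit_cube :: "'a::euclidean_space set" where
  "unit_cube = {x. \<forall>b\<in>Basis. 0 \<le> x \<bullet> b \<and> x \<bullet> b < 1}"

text \<open>
  The supremum is taken in the extended reals; it is positive and finite (the unit balls around the
  points of \<open>X\<close> are disjoint), so the conversion to a real number loses nothing. The sets whose
  cardinality is taken are finite, because \<open>X\<close> is separated and the cube is bounded.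
\<close>

definition packing_density :: "'a::euclidean_space itself \<Rightarrow> real" where
  "packing_density _ = real_of_ereal
     (SUP X\<in>(Ad :: 'a set set). Limsup at_top (\<lambda>r::real.
        ereal (real (card (X \<inter> (\<lambda>x. r *\<^sub>R x) ` unit_cube)) * omega TYPE('a)
               / measure lborel ((\<lambda>x. r *\<^sub>R x) ` (unit_cube :: 'a set)))))"

text \<open>On \<open>\<real>\<^sup>d\<close> every finite Borel measure is Radon.\<close>

definition Mb :: "'a::euclidean_space measure set" where
  "Mb = {\<mu>. sets \<mu> = sets borel \<and> finite_measure \<mu>}"

definition L1_01 :: "('a::euclidean_space \<Rightarrow> real) set" where
  "L1_01 = {\<rho>. integrable lborel \<rho> \<and> (AE x in lborel. 0 \<le> \<rho> x \<and> \<rho> x \<le> 1)}"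

text \<open>The absolutely continuous measure \<open>\<rho> \<L>\<^sup>d\<close>.\<close>

definition density_measure :: "('a::euclidean_space \<Rightarrow> real) \<Rightarrow> 'a measure" where
  "density_measure \<rho> = density lborel (\<lambda>x. ennreal (\<rho> x))"

text \<open>
  Weak-star convergence is that of \<open>\<M>\<^sub>b\<close> inside the dual of \<open>C\<^sub>0\<close>, the continuous
  functions vanishing at infinity. (Together with convergence of the total masses, testing with
  compactly supported functions gives the same notion.)
\<close>

definition weak_star_conv ::
  "(real \<Rightarrow> 'a::euclidean_space measure) \<Rightarrow> 'a measure \<Rightarrow> bool" where
  "weak_star_conv \<nu> \<nu>0 \<longleftrightarrow>
     (\<forall>\<phi>::'a \<Rightarrow> real. continuous_on UNIV \<phi> \<longrightarrow> (\<phi> \<longlongrightarrow> 0) at_infinity \<longrightarrow>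
        ((\<lambda>\<epsilon>. \<integral>x. \<phi> x \<partial>\<nu> \<epsilon>) \<longlongrightarrow> (\<integral>x. \<phi> x \<partial>\<nu>0)) (at_right 0))"

definition tight_conv ::
  "(real \<Rightarrow> 'a::euclidean_space measure) \<Rightarrow> 'a measure \<Rightarrow> bool" where
  "tight_conv \<nu> \<nu>0 \<longleftrightarrow>
     weak_star_conv \<nu> \<nu>0 \<and>
     ((\<lambda>\<epsilon>. measure (\<nu> \<epsilon>) UNIV) \<longlongrightarrow> measure \<nu>0 UNIV) (at_right 0)"

text \<open>The sum of Dirac measures \<open>\<delta>\<^bsub>x 1\<^esub> + \<dots> + \<delta>\<^bsub>x N\<^esub>\<close>; see the next lemma.\<close>

definition dirac_sum :: "nat \<Rightarrow> (nat \<Rightarrow> 'a::euclidean_space) \<Rightarrow> 'a measure" where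
  "dirac_sum N x = distr (count_space {1..N}) borel x"

lemma emeasure_dirac_sum:
  assumes "A \<in> sets borel"
  shows "emeasure (dirac_sum N x) A = (\<Sum>i=1..N. emeasure (return borel (x i)) A)"
proof -
  have "emeasure (dirac_sum N x) A = of_nat (card (x -` A \<inter> {1..N}))"
    using assms by (simp add: dirac_sum_def emeasure_distr emeasure_count_space)
  also have "x -` A \<inter> {1..N} = {1..N} \<inter> {i. x i \<in> A}"
    by auto
  also have "of_nat (card \<dots>) = (\<Sum>i=1..N. indicator A (x i) :: ennreal)"
    by (simp add: indicator_def of_bool_def sum.If_cases)
  finally show ?thesis
    using assms by simp
qed

definition separated :: "real \<Rightarrow> nat \<Rightarrow> (nat \<Rightarrow> 'a::euclidean_space) \<Rightarrow> bool" where
  "separated \<epsilon> N x \<longleftrightarrow>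
     (\<forall>i\<in>{1..N}. \<forall>j\<in>{1..N}. i \<noteq> j \<longrightarrow> norm (x i - x j) \<ge> 2 * \<epsilon>)"

definition EM :: "real \<Rightarrow> 'a::euclidean_space measure set" where
  "EM \<epsilon> = {dirac_sum N x | N x. separated \<epsilon> N x}"

text \<open>The scaling factor \<open>\<epsilon>\<^sup>d \<omega>\<^sub>d / C\<^sup>d\<close>.\<close>

definition scale_factor :: "'a::euclidean_space itself \<Rightarrow> real \<Rightarrow> real" where
  "scale_factor _ \<epsilon> = \<epsilon> ^ DIM('a) * omega TYPE('a) / packing_density TYPE('a)"

definition riesz_kernel :: "real \<Rightarrow> 'a::euclidean_space \<Rightarrow> 'a \<Rightarrow> real" where
  "riesz_kernel \<sigma> x y = - (1 / norm (x - y) powr (real DIM('a) + \<sigma>))"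

definition pair_energy ::
  "real \<Rightarrow> real \<Rightarrow> nat \<Rightarrow> (nat \<Rightarrow> 'a::euclidean_space) \<Rightarrow> real" where
  "pair_energy \<sigma> \<epsilon> N x =
     (\<Sum>(i, j)\<in>{(i, j). i \<in> {1..N} \<and> j \<in> {1..N} \<and> i \<noteq> j}.
        riesz_kernel \<sigma> (x i) (x j) * (scale_factor TYPE('a) \<epsilon>)\<^sup>2)"

text \<open>
  The points \<open>x\<^sub>i\<close> are determined by the measure up to their numbering, so for \<open>\<epsilon> > 0\<close>
  the description below is unique; this is lemma \<open>F_eps_dirac_sum\<close>.
\<close>

definition F_eps :: "real \<Rightarrow> real \<Rightarrow> 'a::euclidean_space measure \<Rightarrow> ereal" where
  "F_eps \<sigma> \<epsilon> \<mu> =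
     (if \<mu> \<in> EM \<epsilon>
      then ereal (THE e. \<exists>N x. separated \<epsilon> N x \<and> \<mu> = dirac_sum N x \<and> e = pair_energy \<sigma> \<epsilon> N x)
      else \<infinity>)"

lemma separated_inj_on:
  assumes "\<epsilon> > 0" "separated \<epsilon> N x"
  shows "inj_on x {1..N}"
proof (rule inj_onI)
  fix i j assume ij: "i \<in> {1..N}" "j \<in> {1..N}" and eq: "x i = x j"
  show "i = j"
  proof (rule ccontr)
    assume "i \<noteq> j"
    from assms(2)[unfolded separated_def, rule_format, OF ij this]
    have "2 * \<epsilon> \<le> norm (x i - x j)" .
    with eq assms(1) show False by simp
  qed
qed

lemma dirac_sum_atoms: "{y. emeasure (dirac_sum N x) {y} \<noteq> 0} = x ` {1..N}"
  by (auto simp: emeasure_dirac_sum sum_nonneg_eq_0_iff indicator_def split: if_splits)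

lemma pair_energy_reindex:
  fixes x :: "nat \<Rightarrow> 'a::euclidean_space"
  assumes "inj_on x {1..N}"
  shows "pair_energy \<sigma> \<epsilon> N x =
    (\<Sum>(y, z)\<in>{(y, z). y \<in> x ` {1..N} \<and> z \<in> x ` {1..N} \<and> y \<noteq> z}.
        riesz_kernel \<sigma> y z * (scale_factor TYPE('a) \<epsilon>)\<^sup>2)"
proof -
  let ?S = "{(i, j). i \<in> {1..N} \<and> j \<in> {1..N} \<and> i \<noteq> j}"
  have inj: "inj_on (map_prod x x) ?S"
  proof (rule inj_on_subset)
    show "inj_on (map_prod x x) ({1..N} \<times> {1..N})"
      using assms assms by (rule map_prod_inj_on)
  qed blast
  have img: "{(y, z). y \<in> x ` {1..N} \<and> z \<in> x ` {1..N} \<and> y \<noteq> z} = map_prod x x ` ?S" (is "?L = ?R")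
  proof (rule set_eqI, rule iffI)
    fix p assume "p \<in> ?L"
    then obtain i j where "p = (x i, x j)" "i \<in> {1..N}" "j \<in> {1..N}" "x i \<noteq> x j"
      by blast
    then show "p \<in> ?R"
      by (intro image_eqI[where x = "(i, j)"]) auto
  next
    fix p assume "p \<in> ?R"
    then obtain i j where "p = (x i, x j)" "i \<in> {1..N}" "j \<in> {1..N}" "i \<noteq> j"
      by auto
    then show "p \<in> ?L"
      using inj_onD[OF assms, of i j] by blast
  qed
  show ?thesis
    unfolding img sum.reindex[OF inj] pair_energy_def by (rule sum.cong) auto
qed

lemma F_eps_dirac_sum:
  assumes "\<epsilon> > 0" "separated \<epsilon> N x"
  shows "F_eps \<sigma> \<epsilon> (dirac_sum N x) = ereal (pair_energy \<sigma> \<epsilon> N x)"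
proof -
  have "pair_energy \<sigma> \<epsilon> M y = pair_energy \<sigma> \<epsilon> N x"
    if "separated \<epsilon> M y" "dirac_sum N x = dirac_sum M y" for M y
  proof -
    have "x ` {1..N} = y ` {1..M}"
      unfolding dirac_sum_atoms[symmetric] that(2) ..
    moreover have "inj_on x {1..N}" "inj_on y {1..M}"
      using assms that(1) by (blast intro: separated_inj_on)+
    ultimately show ?thesis
      by (simp only: pair_energy_reindex)
  qed
  then have "(THE e. \<exists>M y. separated \<epsilon> M y \<and> dirac_sum N x = dirac_sum M y
      \<and> e = pair_energy \<sigma> \<epsilon> M y) = pair_energy \<sigma> \<epsilon> N x"
    using assms(2) by (intro the_equality) blast+
  then show ?thesis
    using assms(2) by (auto simp: F_eps_def EM_def)
qed

text \<open>
  The integral of a real function with values in the extended reals: integral of the positive part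
  minus integral of the negative part (\<^const>\<open>ennreal\<close> maps negative numbers to 0).
\<close>

definition eintegral :: "'b measure \<Rightarrow> ('b \<Rightarrow> real) \<Rightarrow> ereal" where
  "eintegral M f =
     enn2ereal (\<integral>\<^sup>+x. ennreal (f x) \<partial>M) - enn2ereal (\<integral>\<^sup>+x. ennreal (- f x) \<partial>M)"

lemma eintegral_eq_integral:
  assumes "integrable M f"
  shows "eintegral M f = ereal (\<integral>x. f x \<partial>M)"
proof -
  have "(\<integral>\<^sup>+x. ennreal (f x) \<partial>M) < \<infinity>" "(\<integral>\<^sup>+x. ennreal (- f x) \<partial>M) < \<infinity>"
    using assms by (auto simp: real_integrable_def less_top)
  moreover have "enn2ereal c = ereal (enn2real c)" if "c < \<infinity>" for c
    using that by (cases c rule: ennreal_cases) (simp_all add: enn2ereal_ennreal)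
  ultimately show ?thesis
    unfolding eintegral_def real_lebesgue_integral_def[OF assms] by simp
qed

definition T_eps ::
  "real \<Rightarrow> ('a::euclidean_space \<Rightarrow> real) \<Rightarrow> real \<Rightarrow> 'a measure \<Rightarrow> ereal" where
  "T_eps \<sigma> g \<epsilon> \<mu> = F_eps \<sigma> \<epsilon> \<mu> + eintegral \<mu> (\<lambda>x. g x * scale_factor TYPE('a) \<epsilon>)"

text \<open>
  On the diagonal \<^const>\<open>riesz_kernel\<close> has the value \<open>0\<close> instead of \<open>-\<infinity>\<close>; the diagonal is a
  null set for \<open>\<mu> \<otimes> \<mu>\<close> whenever \<open>\<mu> \<le> \<L>\<^sup>d\<close>.
\<close>

definition T_lim ::
  "real \<Rightarrow> ('a::euclidean_space \<Rightarrow> real) \<Rightarrow> 'a measure \<Rightarrow> ereal" where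
  "T_lim \<sigma> g \<mu> =
     (if \<forall>A\<in>sets borel. emeasure \<mu> A \<le> emeasure lborel A
      then eintegral (\<mu> \<Otimes>\<^sub>M \<mu>) (\<lambda>(x, y). riesz_kernel \<sigma> x y) + eintegral \<mu> g
      else \<infinity>)"

end

theory Submission imports Defs "HOL-Real_Asymp.Real_Asymp" begin

text \<open>
  Write \<open>p = d + \<sigma>\<close>, so \<open>0 < p < d\<close>, and let \<open>\<nu>\<^bsub>\<epsilon>\<^esub>\<close> be the rescaled measure
  \<open>(\<epsilon>\<^sup>d \<omega>\<^sub>d / C\<^sup>d) \<mu>\<^bsub>\<epsilon>\<^esub>\<close> and \<open>\<nu>\<^sub>0 = \<rho> \<L>\<^sup>d\<close>. The kernel \<open>|z|\<^sup>-\<^sup>p\<close> is locally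
  integrable and vanishes at infinity. The difficulties are its singularity, the growth of \<open>g\<close> at
  infinity, and the realisation of densities up to 1 by centres of disjoint balls.

  \<^item> \<^emph>\<open>Truncation.\<close> Replacing \<open>|z|\<close> by \<open>max r |z|\<close> gives a bounded uniformly continuous kernel \<open>h\<^sub>r\<close>.
  For such a kernel the double integral of \<open>h\<^sub>r (x - y)\<close> against \<open>\<nu>\<^bsub>\<epsilon>\<^esub> \<otimes> \<nu>\<^bsub>\<epsilon>\<^esub>\<close> passes to the
  limit under tight convergence (\<open>interaction_conv\<close>): the convolutions \<open>h\<^sub>r * \<nu>\<^bsub>\<epsilon>\<^esub>\<close> are equicontinuous,
  hence converge uniformly on balls, and tightness controls the rest.

  \<^item> \<^emph>\<open>Lower bound.\<close> What truncation discards is the sum over pairs at distance less than \<open>r\<close>. Around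
  each point of a \<open>2\<epsilon>\<close>-separated set there is a private ball of radius \<open>\<epsilon>\<close>, so each term of
  that sum is comparable with an integral over such a ball, and \<open>\<epsilon>\<^sup>d\<close> times the sum is bounded by a
  constant times the integral of \<open>|z|\<^sup>-\<^sup>p\<close> over a ball of radius \<open>3r/2\<close> (\<open>short_range_sum\<close>). This tends to 0 with \<open>r\<close>,
  uniformly in \<open>\<epsilon>\<close>. Since \<open>g\<close> is nonnegative far out, cutting it off only lowers its integral, and
  \<open>r \<rightarrow> 0\<close> together with monotone convergence in the cutoff yields the inequality
  (\<open>liminf_inequality\<close>).

  \<^item> \<^emph>\<open>Upper bound.\<close> By definition of \<open>C\<^sup>d\<close> there are finite packings in arbitrarily large cubes whose
  density is as close to \<open>C\<^sup>d\<close> as desired; a margin of width 2 makes translates of the cube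
  compatible. Cut space into cubes of side \<open>L \<epsilon>\<close> and place in each of them as many points of the
  shrunken packing as the integral of \<open>\<rho>\<close> prescribes. This is possible up to a relative error that is
  small for \<open>L\<close> large, because \<open>\<rho> \<le> 1\<close> (\<open>recovery_at_scale\<close>). Which points of the packing are kept
  does not matter: at distances much larger than \<open>L \<epsilon>\<close> only their number is visible. A diagonal
  argument over truncations of \<open>\<rho>\<close> to balls of growing radius, with errors chosen small compared
  with the size of \<open>g\<close> on these balls, gives a sequence along which \<open>\<nu>\<^bsub>\<epsilon>\<^esub> \<rightarrow> \<nu>\<^sub>0\<close> tightly
  and the integrals of \<open>g\<close> converge (\<open>recovery_sequence\<close>). For the interaction energy the inequality
  needed here is the easy one: off the diagonal the kernel dominates \<open>h\<^sub>r\<close>, and the diagonal carries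
  only \<open>r\<^sup>-\<^sup>p\<close> times the mass of \<open>\<nu>\<^bsub>\<epsilon>\<^esub>\<close> times \<open>\<epsilon>\<^sup>d \<omega>\<^sub>d / C\<^sup>d \<rightarrow> 0\<close>. Fatou's lemma removes the truncation
  (\<open>limsup_inequality\<close>).
\<close>

section \<open>Lattice cells and the optimal packing density\<close>

text \<open>
  For \<open>z\<close> with integer coordinates this is the cube with corner \<open>l z\<close> and side \<open>l\<close>. Half-open cubes make
  the cells a partition of space, and \<open>cell r 0\<close> is the cube \<open>rQ\<close> in the definition of \<open>C\<^sup>d\<close>.
\<close>

definition cell :: "real \<Rightarrow> 'a::euclidean_space \<Rightarrow> 'a set" where
  "cell l z = {x. \<forall>b\<in>Basis. l * (z \<bullet> b) \<le> x \<bullet> b \<and> x \<bullet> b < l * (z \<bullet> b + 1)}"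

definition int_lattice :: "'a::euclidean_space set" where
  "int_lattice = {z. \<forall>b\<in>Basis. z \<bullet> b \<in> \<int>}"

lemma scaled_unit_cube:
  assumes "r > 0"
  shows "(\<lambda>x. r *\<^sub>R x) ` (unit_cube :: 'a::euclidean_space set) = cell r 0"
proof (intro set_eqI iffI)
  fix x :: 'a assume "x \<in> cell r 0"
  then have "(1/r) *\<^sub>R x \<in> unit_cube" "x = r *\<^sub>R ((1/r) *\<^sub>R x)"
    using assms by (auto simp: cell_def unit_cube_def field_simps)
  then show "x \<in> (\<lambda>x. r *\<^sub>R x) ` unit_cube" by blast
qed (use assms in \<open>auto simp: cell_def unit_cube_def\<close>)

lemma cell_bounds:
  fixes z :: "'a::euclidean_space"
  assumes "l > 0"
  shows "box (l *\<^sub>R z) (l *\<^sub>R (z + One)) \<subseteq> cell l z" "cell l z \<subseteq> cbox (l *\<^sub>R z) (l *\<^sub>R (z + One))"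
  using assms by (auto simp: cell_def box_def cbox_def inner_add_left intro: less_imp_le)

lemma cell_borel [measurable]: "cell l z \<in> sets borel"
proof -
  have "{x. l * (z \<bullet> b) \<le> x \<bullet> b \<and> x \<bullet> b < l * (z \<bullet> b + 1)} \<in> sets borel" for b
    by measurable
  then have "(\<Inter>b\<in>Basis. {x. l * (z \<bullet> b) \<le> x \<bullet> b \<and> x \<bullet> b < l * (z \<bullet> b + 1)}) \<in> sets borel"
    by (intro sets.finite_INT) auto
  moreover have "(\<Inter>b\<in>Basis. {x. l * (z \<bullet> b) \<le> x \<bullet> b \<and> x \<bullet> b < l * (z \<bullet> b + 1)}) = cell l z"
    by (auto simp: cell_def)
  ultimately show ?thesis by simp
qed

lemma emeasure_cell:
  fixes z :: "'a::euclidean_space"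
  assumes "l > 0"
  shows "emeasure lborel (cell l z) = ennreal (l ^ DIM('a))"
proof (rule antisym)
  have le: "\<And>b. b \<in> Basis \<Longrightarrow> (l *\<^sub>R z) \<bullet> b \<le> (l *\<^sub>R (z + One)) \<bullet> b"
    using assms by (auto simp: inner_add_left inner_sum_left inner_Basis)
  have pr: "(\<Prod>b\<in>Basis. (l *\<^sub>R (z + One) - l *\<^sub>R z) \<bullet> b) = l ^ DIM('a)"
    by (simp add: inner_add_left inner_diff_left inner_sum_left inner_Basis algebra_simps)
  have "emeasure lborel (cell l z) \<le> emeasure lborel (cbox (l *\<^sub>R z) (l *\<^sub>R (z + One)))"
    using cell_bounds(2)[OF assms] by (intro emeasure_mono) auto
  also have "\<dots> = ennreal (l ^ DIM('a))"
    using emeasure_lborel_cbox[OF le] pr by simp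
  finally show "emeasure lborel (cell l z) \<le> ennreal (l ^ DIM('a))" .
  have "ennreal (l ^ DIM('a)) = emeasure lborel (box (l *\<^sub>R z) (l *\<^sub>R (z + One)))"
    using emeasure_lborel_box[OF le] pr by simp
  also have "\<dots> \<le> emeasure lborel (cell l z)"
    using cell_bounds(1)[OF assms] by (intro emeasure_mono) auto
  finally show "ennreal (l ^ DIM('a)) \<le> emeasure lborel (cell l z)" .
qed

lemma measure_cell:
  fixes z :: "'a::euclidean_space"
  assumes "l > 0"
  shows "measure lborel (cell l z) = l ^ DIM('a)"
  using emeasure_cell[OF assms, of z] assms by (simp add: measure_def)

lemma cell_cover:
  fixes x :: "'a::euclidean_space"
  assumes "l > 0"
  obtains z where "z \<in> int_lattice" "x \<in> cell l z"
proof
  let ?z = "(\<Sum>b\<in>Basis. of_int \<lfloor>x \<bullet> b / l\<rfloor> *\<^sub>R b) :: 'a"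
  have z: "?z \<bullet> b = of_int \<lfloor>x \<bullet> b / l\<rfloor>" if "b \<in> Basis" for b
    using that by simp
  show "?z \<in> int_lattice" by (simp add: int_lattice_def z)
  show "x \<in> cell l ?z"
    unfolding cell_def
  proof (intro CollectI ballI)
    fix b :: 'a assume b: "b \<in> Basis"
    have "of_int \<lfloor>x \<bullet> b / l\<rfloor> \<le> x \<bullet> b / l" "x \<bullet> b / l < of_int \<lfloor>x \<bullet> b / l\<rfloor> + 1" by linarith+
    then show "l * (?z \<bullet> b) \<le> x \<bullet> b \<and> x \<bullet> b < l * (?z \<bullet> b + 1)"
      unfolding z[OF b] using assms pos_le_divide_eq[OF assms] pos_divide_less_eq[OF assms] by (metis mult.commute)
  qed
qed

lemma cell_unique:
  fixes x :: "'a::euclidean_space"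
  assumes "l > 0" "z \<in> int_lattice" "w \<in> int_lattice" "x \<in> cell l z" "x \<in> cell l w"
  shows "z = w"
proof (rule euclidean_eqI)
  fix b :: 'a assume b: "b \<in> Basis"
  obtain i j where ij: "z \<bullet> b = of_int i" "w \<bullet> b = of_int j"
    using assms(2,3) b unfolding int_lattice_def by (blast elim: Ints_cases)
  have "l * of_int i < l * (of_int j + 1)" "l * of_int j < l * (of_int i + 1)"
    using assms(4,5) b ij unfolding cell_def by force+
  then have "real_of_int i < of_int j + 1" "real_of_int j < of_int i + 1"
    using assms(1) mult_less_cancel_left_pos by blast+
  then have "i = j" by linarith
  then show "z \<bullet> b = w \<bullet> b" using ij by simp
qed

lemma dist_cell:
  fixes x :: "'a::euclidean_space"
  assumes "x \<in> cell l z" "y \<in> cell l z"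
  shows "norm (x - y) \<le> l * DIM('a)"
proof -
  have "norm (x - y) \<le> (\<Sum>b\<in>Basis. \<bar>(x - y) \<bullet> b\<bar>)" by (rule norm_le_l1)
  also have "\<dots> \<le> (\<Sum>b\<in>(Basis::'a set). l)"
  proof (rule sum_mono)
    fix b :: 'a assume "b \<in> Basis"
    then have "l * (z \<bullet> b) \<le> x \<bullet> b" "x \<bullet> b < l * (z \<bullet> b) + l" "l * (z \<bullet> b) \<le> y \<bullet> b" "y \<bullet> b < l * (z \<bullet> b) + l"
      using assms by (auto simp: cell_def algebra_simps)
    then show "\<bar>(x - y) \<bullet> b\<bar> \<le> l" by (simp add: inner_diff_left)
  qed
  finally show ?thesis by (simp add: mult.commute)
qed

lemma omega_pos: "omega TYPE('a::euclidean_space) > 0"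
  by (simp add: omega_def content_ball)

lemma measure_ball_omega:
  fixes x :: "'a::euclidean_space"
  assumes "r \<ge> 0"
  shows "measure lborel (ball x r) = omega TYPE('a) * r ^ DIM('a)"
  using assms by (simp add: omega_def content_ball)

lemma emeasure_ball_omega:
  fixes x :: "'a::euclidean_space"
  assumes "r \<ge> 0"
  shows "emeasure lborel (ball x r) = ennreal (omega TYPE('a) * r ^ DIM('a))"
  using emeasure_eq_ennreal_measure[of lborel "ball x r"] emeasure_lborel_ball_finite[of x r]
    measure_ball_omega[OF assms, of x] by (simp add: less_top)

lemma disjoint_balls:
  fixes x y :: "'a::euclidean_space"
  assumes "norm (x - y) \<ge> 2 * r"
  shows "ball x r \<inter> ball y r = {}"
proof -
  have False if "dist x w < r" "dist y w < r" for w
    using that assms dist_triangle2[of x y w] by (simp add: dist_norm)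
  then show ?thesis by auto
qed

text \<open>
  Volume comparison: the balls of radius \<open>r\<close> around the points are disjoint and lie in the box.
\<close>

lemma packing_card_bound:
  fixes S :: "'a::euclidean_space set"
  assumes "finite S" and sep: "\<And>x y. x \<in> S \<Longrightarrow> y \<in> S \<Longrightarrow> x \<noteq> y \<Longrightarrow> norm (x - y) \<ge> 2 * r"
    and "r \<ge> 0" and sub: "\<And>x. x \<in> S \<Longrightarrow> ball x r \<subseteq> cbox a b"
  shows "real (card S) * (omega TYPE('a) * r ^ DIM('a)) \<le> measure lborel (cbox a b)"
proof -
  have "real (card S) * (omega TYPE('a) * r ^ DIM('a)) = (\<Sum>x\<in>S. measure lborel (ball x r))"
    using assms(3) by (simp add: measure_ball_omega)
  also have "\<dots> = measure lborel (\<Union>x\<in>S. ball x r)"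
  proof (rule measure_finite_Union[symmetric])
    show "disjoint_family_on (\<lambda>x. ball x r) S"
      unfolding disjoint_family_on_def using disjoint_balls[OF sep] by blast
    show "emeasure lborel (ball x r) \<noteq> \<infinity>" for x :: 'a
      using emeasure_lborel_ball_finite[of x r] by (simp add: less_top)
  qed (use assms in auto)
  also have "\<dots> \<le> measure lborel (cbox a b)"
    using sub by (intro measure_mono_fmeasurable) (auto intro: fmeasurableI sets.finite_UN assms)
  finally show ?thesis .
qed

text \<open>
  The unit balls around the points stay inside the cube enlarged by 1 on every side.
\<close>

lemma packing_in_cell:
  fixes X :: "'a::euclidean_space set"
  assumes X: "X \<in> Ad" and r: "r > 0" and S: "S \<subseteq> X \<inter> cell r 0" "finite S"
  shows "real (card S) * omega TYPE('a) \<le> (r + 2) ^ DIM('a)"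
proof -
  have "real (card S) * (omega TYPE('a) * 1 ^ DIM('a)) \<le> measure lborel (cbox (- One) ((r + 1) *\<^sub>R One) :: 'a set)"
  proof (rule packing_card_bound)
    show "norm (x - y) \<ge> 2 * 1" if "x \<in> S" "y \<in> S" "x \<noteq> y" for x y
      using X that S by (auto simp: Ad_def)
    fix x assume "x \<in> S"
    then have x: "x \<in> cell r 0" using S by auto
    show "ball x 1 \<subseteq> cbox (- One) ((r + 1) *\<^sub>R One)"
    proof
      fix y assume "y \<in> ball x 1"
      then have "norm (x - y) < 1" by (simp add: dist_norm)
      then have "\<bar>(x - y) \<bullet> b\<bar> < 1" if "b \<in> Basis" for b
        using Basis_le_norm[OF that, of "x - y"] by linarith
      then show "y \<in> cbox (- One) ((r + 1) *\<^sub>R One)"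
        using x by (fastforce simp: mem_box cell_def inner_diff_left abs_less_iff)
    qed
  qed (use S in auto)
  also have "measure lborel (cbox (- One) ((r + 1) *\<^sub>R One) :: 'a set) = (r + 2) ^ DIM('a)"
    using r by (subst measure_lborel_cbox_eq) (auto simp: inner_diff_left algebra_simps)
  finally show ?thesis by simp
qed

text \<open>
  Otherwise the cube would contain finite subsets of the packing that violate the volume bound. It makes
  cardinalities meaningful, since the cardinality of an infinite set is 0.
\<close>

lemma packing_finite:
  fixes X :: "'a::euclidean_space set"
  assumes "X \<in> Ad" "r > 0"
  shows "finite (X \<inter> cell r 0)"
proof (rule ccontr)
  assume inf: "infinite (X \<inter> cell r 0)"
  obtain n :: nat where n: "(r + 2) ^ DIM('a) / omega TYPE('a) < n"
    using reals_Archimedean2 by blast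
  obtain S where S: "finite S" "card S = n" "S \<subseteq> X \<inter> cell r 0"
    using infinite_arbitrarily_large[OF inf] by blast
  show False
    using packing_in_cell[OF assms S(3,1)] n S(2) omega_pos[where ?'a='a] by (simp add: field_simps)
qed

abbreviation packing_ratio :: "'a::euclidean_space set \<Rightarrow> real \<Rightarrow> real" where
  "packing_ratio X r \<equiv> real (card (X \<inter> (\<lambda>x. r *\<^sub>R x) ` unit_cube)) * omega TYPE('a)
               / measure lborel ((\<lambda>x. r *\<^sub>R x) ` (unit_cube :: 'a set))"

lemma packing_ratio_cell:
  fixes X :: "'a::euclidean_space set"
  assumes "r > 0"
  shows "packing_ratio X r = real (card (X \<inter> cell r 0)) * omega TYPE('a) / r ^ DIM('a)"
  using assms by (simp add: scaled_unit_cube measure_cell)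

lemma packing_ratio_bounded:
  fixes X :: "'a::euclidean_space set"
  assumes "X \<in> Ad" "r \<ge> 1"
  shows "packing_ratio X r \<le> 3 ^ DIM('a)"
proof -
  have "real (card (X \<inter> cell r 0)) * omega TYPE('a) \<le> (r + 2) ^ DIM('a)"
    using packing_in_cell[OF assms(1), of r "X \<inter> cell r 0"] packing_finite[OF assms(1), of r] assms(2) by simp
  also have "\<dots> \<le> (3 * r) ^ DIM('a)" using assms(2) by (intro power_mono) auto
  finally show ?thesis using assms(2) 
    by (subst packing_ratio_cell) (simp_all add: power_mult_distrib field_simps)
qed

lemma even_lattice_Ad: "{z. \<forall>b\<in>Basis. z \<bullet> b / 2 \<in> \<int>} \<in> (Ad :: 'a::euclidean_space set set)"
  unfolding Ad_def
proof (intro CollectI ballI impI)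
  fix x y :: 'a assume x: "x \<in> {z. \<forall>b\<in>Basis. z \<bullet> b / 2 \<in> \<int>}" and y: "y \<in> {z. \<forall>b\<in>Basis. z \<bullet> b / 2 \<in> \<int>}"
    and "x \<noteq> y"
  then obtain b where b: "b \<in> Basis" "x \<bullet> b \<noteq> y \<bullet> b"
    using euclidean_eqI by blast
  have "x \<bullet> b / 2 \<in> \<int>" "y \<bullet> b / 2 \<in> \<int>" using x y b by auto
  then have "(x - y) \<bullet> b / 2 \<in> \<int>" "(x - y) \<bullet> b / 2 \<noteq> 0"
    using b by (auto simp: inner_diff_left diff_divide_distrib)
  then have "\<bar>(x - y) \<bullet> b / 2\<bar> \<ge> 1" by (rule Ints_nonzero_abs_ge1)
  then show "2 \<le> norm (x - y)" using Basis_le_norm[OF b(1), of "x - y"] by simp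
qed

text \<open>
  The cubes of side 2 attached to the points of \<open>2\<int>\<^sup>d\<close> in \<open>rQ\<close> cover \<open>rQ\<close>. This
  packing is far from optimal, but it shows \<open>C\<^sup>d > 0\<close>.
\<close>

lemma even_lattice_ratio:
  fixes r :: real
  defines "X \<equiv> {z::'a::euclidean_space. \<forall>b\<in>Basis. z \<bullet> b / 2 \<in> \<int>}"
  assumes "r > 0"
  shows "omega TYPE('a) / 2 ^ DIM('a) \<le> packing_ratio X r"
proof -
  have fin: "finite (X \<inter> cell r 0)"
    unfolding X_def by (rule packing_finite[OF even_lattice_Ad assms(2)])
  have cov: "cell r 0 \<subseteq> (\<Union>x\<in>X \<inter> cell r 0. cell 2 ((1/2) *\<^sub>R x))"
  proof
    fix y :: 'a assume y: "y \<in> cell r 0"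
    obtain z where z: "z \<in> int_lattice" "y \<in> cell 2 z" using cell_cover[of 2 y] by auto
    have "2 *\<^sub>R z \<in> X" using z(1) by (auto simp: X_def int_lattice_def)
    moreover have "2 *\<^sub>R z \<in> cell r 0"
      unfolding cell_def
    proof (intro CollectI ballI)
      fix b :: 'a assume b: "b \<in> Basis"
      obtain k where k: "z \<bullet> b = of_int k" using z(1) b by (auto simp: int_lattice_def elim: Ints_cases)
      have a: "2 * of_int k \<le> y \<bullet> b" "y \<bullet> b < 2 * (of_int k + 1)" "0 \<le> y \<bullet> b" "y \<bullet> b < r"
        using z(2) y b k by (force simp: cell_def)+
      from a(3,2) have "0 < 2 * (real_of_int k + 1)" by (rule le_less_trans)
      then have "0 \<le> k" by simp
      then show "r * (0 \<bullet> b) \<le> 2 *\<^sub>R z \<bullet> b \<and> 2 *\<^sub>R z \<bullet> b < r * (0 \<bullet> b + 1)"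
        using a k by simp
    qed
    ultimately show "y \<in> (\<Union>x\<in>X \<inter> cell r 0. cell 2 ((1/2) *\<^sub>R x))"
      using z(2) by (intro UN_I[of "2 *\<^sub>R z"]) auto
  qed
  have "emeasure lborel (cell r (0::'a)) \<le> (\<Sum>x\<in>X \<inter> cell r 0. emeasure lborel (cell 2 ((1/2) *\<^sub>R x)))"
    by (intro order_trans[OF emeasure_mono[OF cov] emeasure_subadditive_finite] fin) (auto intro!: sets.finite_UN fin)
  then have "ennreal (r ^ DIM('a)) \<le> ennreal (real (card (X \<inter> cell r 0)) * 2 ^ DIM('a))"
    using assms(2) by (simp add: emeasure_cell ennreal_mult' ennreal_of_nat_eq_real_of_nat)
  then have "r ^ DIM('a) \<le> real (card (X \<inter> cell r 0)) * 2 ^ DIM('a)"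
    by (simp add: ennreal_le_iff)
  then show ?thesis using assms(2) omega_pos[where ?'a='a]
    by (subst packing_ratio_cell) (simp_all add: field_simps)
qed

text \<open>
  The supremum defining \<open>C\<^sup>d\<close>, before its conversion to a real number.
\<close>

definition packing_sup :: "'a::euclidean_space itself \<Rightarrow> ereal" where
  "packing_sup _ = (SUP X\<in>(Ad :: 'a set set). Limsup at_top (\<lambda>r. ereal (packing_ratio X r)))"

lemma packing_sup_bounds:
  "0 < packing_sup TYPE('a::euclidean_space)" "packing_sup TYPE('a) \<le> 3 ^ DIM('a)"
proof -
  show "packing_sup TYPE('a) \<le> 3 ^ DIM('a)"
    unfolding packing_sup_def
  proof (intro SUP_least Limsup_bounded)
    fix X :: "'a set" assume "X \<in> Ad"
    then have "\<forall>\<^sub>F r in at_top. packing_ratio X r \<le> 3 ^ DIM('a)"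
      by (intro eventually_at_top_linorderI[of 1] packing_ratio_bounded)
    then show "\<forall>\<^sub>F r in at_top. ereal (packing_ratio X r) \<le> 3 ^ DIM('a)"
      by eventually_elim (metis ereal_less_eq(3) ereal_power numeral_eq_ereal)
  qed
  let ?X = "{z::'a. \<forall>b\<in>Basis. z \<bullet> b / 2 \<in> \<int>}"
  have "0 < ereal (omega TYPE('a) / 2 ^ DIM('a))" using omega_pos[where ?'a='a] by simp
  also have "\<dots> \<le> Limsup at_top (\<lambda>r. ereal (packing_ratio ?X r))"
  proof (rule le_Limsup)
    show "\<forall>\<^sub>F r in at_top. ereal (omega TYPE('a) / 2 ^ DIM('a)) \<le> ereal (packing_ratio ?X r)"
      by (rule eventually_mono[OF eventually_gt_at_top[of 0]]) (simp only: ereal_less_eq(3), rule even_lattice_ratio)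
  qed simp
  also have "\<dots> \<le> packing_sup TYPE('a)"
    unfolding packing_sup_def by (rule SUP_upper[OF even_lattice_Ad])
  finally show "0 < packing_sup TYPE('a)" .
qed

lemma packing_density_sup: "ereal (packing_density TYPE('a::euclidean_space)) = packing_sup TYPE('a)"
proof -
  have "packing_density TYPE('a) = real_of_ereal (packing_sup TYPE('a))"
    by (simp add: packing_density_def packing_sup_def)
  moreover have "packing_sup TYPE('a) \<noteq> \<infinity>" "packing_sup TYPE('a) \<noteq> -\<infinity>"
    using packing_sup_bounds[where ?'a='a] by auto
  ultimately show ?thesis by (cases "packing_sup TYPE('a)") auto
qed

lemma packing_density_pos: "packing_density TYPE('a::euclidean_space) > 0"
  using packing_sup_bounds(1)[where ?'a='a] by (simp add: packing_density_sup[symmetric])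

lemma scale_factor_pos: "\<epsilon> > 0 \<Longrightarrow> scale_factor TYPE('a::euclidean_space) \<epsilon> > 0"
  by (simp add: scale_factor_def packing_density_pos omega_pos)

text \<open>
  The supremum provides a packing whose density in arbitrarily large cubes \<open>rQ\<close> exceeds \<open>(1 - \<delta>/2) C\<^sup>d\<close>.
  Taking \<open>L = r + 2\<close> leaves an empty margin of width 2, so that translates by \<open>L\<int>\<^sup>d\<close> remain a
  packing; the density lost is the factor \<open>(r / (r + 2))\<^sup>d\<close>, which tends to 1.
\<close>

lemma dense_packing:
  assumes "\<delta> > 0"
  obtains L and Y :: "'a::euclidean_space set" where
    "L > L0" "L > 2" "finite Y" "Y \<in> Ad" "Y \<subseteq> cell (L - 2) 0"
    "real (card Y) * omega TYPE('a) \<ge> (1 - \<delta>) * packing_density TYPE('a) * L ^ DIM('a)"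
proof -
  define C where "C = packing_density TYPE('a)"
  have C: "C > 0" unfolding C_def by (rule packing_density_pos)
  have "ereal ((1 - \<delta>/2) * C) < packing_sup TYPE('a)"
    using C assms by (simp add: packing_density_sup[symmetric] C_def[symmetric])
  then obtain X :: "'a set" where X: "X \<in> Ad"
    and XL: "ereal ((1 - \<delta>/2) * C) < Limsup at_top (\<lambda>r. ereal (packing_ratio X r))"
    unfolding packing_sup_def less_SUP_iff by blast
  have freq: "\<exists>\<^sub>F r in at_top. (1 - \<delta>/2) * C < packing_ratio X r"
  proof (rule ccontr)
    assume "\<not> (\<exists>\<^sub>F r in at_top. (1 - \<delta>/2) * C < packing_ratio X r)"
    then have "\<forall>\<^sub>F r in at_top. ereal (packing_ratio X r) \<le> ereal ((1 - \<delta>/2) * C)"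
      by (simp add: frequently_def not_less)
    from Limsup_bounded[OF this] XL show False by simp
  qed
  have "((\<lambda>r::real. ((r + 2) / r) ^ DIM('a)) \<longlongrightarrow> 1 ^ DIM('a)) at_top"
    by (intro tendsto_power) real_asymp
  then have "((\<lambda>r::real. (1 - \<delta>) * C * ((r + 2) / r) ^ DIM('a)) \<longlongrightarrow> (1 - \<delta>) * C * 1) at_top"
    by (intro tendsto_mult tendsto_const) simp_all
  moreover have "(1 - \<delta>) * C * 1 < (1 - \<delta>/2) * C" using C assms by simp
  ultimately have "\<forall>\<^sub>F r in at_top. (1 - \<delta>) * C * ((r + 2) / r) ^ DIM('a) < (1 - \<delta>/2) * C"
    by (rule order_tendstoD)
  then have "\<forall>\<^sub>F r in at_top. r > max 0 L0 \<and> (1 - \<delta>) * C * ((r + 2) / r) ^ DIM('a) < (1 - \<delta>/2) * C"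
    using eventually_gt_at_top[of "max 0 L0"] by eventually_elim auto
  from frequently_eventually_conj[OF freq this]
  obtain r where r: "r > 0" "r > L0" and 1: "(1 - \<delta>) * C * ((r + 2) / r) ^ DIM('a) < (1 - \<delta>/2) * C"
    and 2: "(1 - \<delta>/2) * C < packing_ratio X r"
    by (auto dest!: frequently_ex)
  have "(1 - \<delta>) * C * ((r + 2) / r) ^ DIM('a) < real (card (X \<inter> cell r 0)) * omega TYPE('a) / r ^ DIM('a)"
    using 1 2 packing_ratio_cell[OF r(1), of X] by simp
  then have "(1 - \<delta>) * C * (r + 2) ^ DIM('a) < real (card (X \<inter> cell r 0)) * omega TYPE('a)"
    using r(1) by (simp add: power_divide divide_simps)
  then show thesis
    using that[of "r + 2" "X \<inter> cell r 0"] r packing_finite[OF X r(1)] X by (auto simp: Ad_def C_def)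
qed

section \<open>Local integrability of the Riesz kernel\<close>

text \<open>
  The integral of the Riesz kernel over a small ball; its smallness measures how little truncating the
  kernel changes.
\<close>

definition near_mass :: "'a::euclidean_space itself \<Rightarrow> real \<Rightarrow> real \<Rightarrow> ennreal" where
  "near_mass _ p r = (\<integral>\<^sup>+z. ennreal (norm (z::'a) powr (-p)) * indicator (ball 0 r) z \<partial>lborel)"

lemma half_power_powr: "((1/2::real) ^ k) ^ n = 2 powr (- (real n * real k))"
proof -
  have "2 powr (- (real n * real k)) = inverse ((2::real) powr real (k * n))"
    by (simp add: powr_minus mult.commute)
  also have "\<dots> = inverse (2 ^ (k * n))" by (subst powr_realpow) auto
  also have "\<dots> = ((1/2) ^ k) ^ n"
    by (simp only: power_mult power_one_over inverse_eq_divide)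
  finally show ?thesis ..
qed

lemma ennreal_le_suminf: "f k \<le> suminf f" for f :: "nat \<Rightarrow> ennreal"
  using sum_le_suminf[of f "{k}"] by simp

text \<open>
  On the shell \<open>2\<^sup>-\<^sup>k\<^sup>-\<^sup>1 \<le> |z| < 2\<^sup>-\<^sup>k\<close> the kernel is at most the \<open>k\<close>-th term of the sum.
\<close>

lemma powr_dyadic_bound:
  fixes z :: "'a::euclidean_space"
  assumes p: "p > 0"
  shows "ennreal (norm z powr (-p)) * indicator (ball 0 1) z
    \<le> (\<Sum>k. ennreal (2 powr (p * (real k + 1))) * indicator (ball 0 ((1/2) ^ k)) z)" (is "_ \<le> suminf ?f")
proof (cases "z \<noteq> 0 \<and> norm z < 1")
  case True
  have "\<exists>n. (1/2::real) ^ n \<le> norm z"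
    using real_arch_pow_inv[of "norm z" "1/2"] True by (auto intro: less_imp_le)
  define N where "N = (LEAST n. (1/2::real) ^ n \<le> norm z)"
  have N: "(1/2::real) ^ N \<le> norm z"
    unfolding N_def using \<open>\<exists>n. (1/2::real) ^ n \<le> norm z\<close> by (rule LeastI_ex)
  have "N \<noteq> 0" using N True by (cases N) auto
  then obtain k where k: "N = Suc k" by (cases N) auto
  have less: "norm z < (1/2) ^ k"
    using not_less_Least[of k "\<lambda>n. (1/2::real) ^ n \<le> norm z"] k by (auto simp: N_def)
  have "norm z powr (-p) \<le> ((1/2) ^ N) powr (-p)"
    using p N by (intro powr_mono2') auto
  also have "\<dots> = 2 powr (p * (real k + 1))"
  proof -
    have "(1/2::real) ^ N = 2 powr (- real N)"
      using half_power_powr[of N 1] by simp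
    then show ?thesis by (simp add: powr_powr k algebra_simps)
  qed
  finally have "ennreal (norm z powr (-p)) * indicator (ball 0 1) z \<le> ?f k"
    using less by (auto simp: indicator_def intro: ennreal_leI)
  also have "?f k \<le> suminf ?f"
    by (rule ennreal_le_suminf)
  finally show ?thesis .
next
  case False
  then have "ennreal (norm z powr (-p)) * indicator (ball 0 1) z = 0"
    by (auto simp: indicator_def)
  then show ?thesis by (simp only: zero_le)
qed

lemma borel_ball [measurable]: "ball x r \<in> sets borel"
  by simp

lemma borel_ball_lborel: "ball x r \<in> sets lborel"
  by simp

text \<open>
  Integrating the dyadic bound gives a geometric series with ratio \<open>2\<^sup>p\<^sup>-\<^sup>d < 1\<close>.
\<close>

lemma near_mass_finite:
  fixes p :: real
  assumes p: "0 < p" "p < DIM('a::euclidean_space)"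
  shows "near_mass TYPE('a) p 1 < \<infinity>"
proof -
  let ?d = "DIM('a)"
  have eq: "2 powr (p * (real k + 1)) * (omega TYPE('a) * ((1/2) ^ k) ^ ?d)
      = omega TYPE('a) * 2 powr p * (2 powr (p - ?d)) ^ k" for k
  proof -
    have "(2 powr (p - ?d)) ^ k = 2 powr (p * real k + - (real ?d * real k))"
      by (simp add: powr_power algebra_simps)
    also have "\<dots> = 2 powr (p * real k) * ((1/2) ^ k) ^ ?d"
      by (simp only: powr_add half_power_powr)
    finally have 1: "(2 powr (p - ?d)) ^ k = 2 powr (p * real k) * ((1/2) ^ k) ^ ?d" .
    have "2 powr (p * (real k + 1)) = 2 powr (p * real k) * 2 powr p"
      by (simp only: distrib_left powr_add mult_1_right)
    then show ?thesis unfolding 1 by (simp only: mult_ac)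
  qed
  have "near_mass TYPE('a) p 1
      \<le> (\<integral>\<^sup>+z. (\<Sum>k. ennreal (2 powr (p * (real k + 1))) * indicator (ball 0 ((1/2) ^ k)) (z::'a)) \<partial>lborel)"
    unfolding near_mass_def by (intro nn_integral_mono powr_dyadic_bound p)
  also have "\<dots> = (\<Sum>k. ennreal (2 powr (p * (real k + 1))) * emeasure lborel (ball (0::'a) ((1/2) ^ k)))"
    unfolding nn_integral_cmult_indicator[OF borel_ball_lborel, symmetric]
    by (rule nn_integral_suminf) measurable
  also have "\<dots> = (\<Sum>k. ennreal (omega TYPE('a) * 2 powr p * (2 powr (p - ?d)) ^ k))"
    by (intro arg_cong[where f = suminf] ext)
      (simp add: emeasure_ball_omega ennreal_mult'[symmetric] eq)
  also have "\<dots> < \<infinity>"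
  proof -
    have "2 powr (p - ?d) < (2::real) powr 0" by (rule powr_less_mono) (use p in auto)
    also have "(2::real) powr 0 = 1" by simp
    finally have "2 powr (p - ?d) < (1::real)" .
    then have "summable (\<lambda>k. omega TYPE('a) * 2 powr p * (2 powr (p - ?d)) ^ k)"
      by (intro summable_mult summable_geometric) simp
    then show ?thesis
      using omega_pos[where ?'a='a] by (subst suminf_ennreal2) auto
  qed
  finally show ?thesis .
qed

lemma near_mass_tendsto_0:
  fixes p :: real
  assumes p: "0 < p" "p < DIM('a::euclidean_space)"
  shows "(\<lambda>n. near_mass TYPE('a) p (1 / real (Suc n))) \<longlonglongrightarrow> 0"
proof -
  have "(\<lambda>n. near_mass TYPE('a) p (1 / real (Suc n))) \<longlonglongrightarrow> (\<integral>\<^sup>+z. 0 \<partial>(lborel :: 'a measure))"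
    unfolding near_mass_def
  proof (rule nn_integral_dominated_convergence[where w = "\<lambda>z. ennreal (norm z powr (-p)) * indicator (ball 0 1) z"])
    show "(\<integral>\<^sup>+z. ennreal (norm (z::'a) powr (-p)) * indicator (ball 0 1) z \<partial>lborel) < \<infinity>"
      using near_mass_finite[OF p] by (simp add: near_mass_def)
    show "AE z in lborel. ennreal (norm (z::'a) powr (-p)) * indicator (ball 0 (1 / real (Suc n))) z
        \<le> ennreal (norm z powr (-p)) * indicator (ball 0 1) z" for n
    proof (rule AE_I2)
      fix z :: 'a
      have "1 / real (Suc n) \<le> 1" by simp
      then have "indicator (ball 0 (1 / real (Suc n))) z \<le> (indicator (ball 0 1) z :: ennreal)"
        using subset_ball[of "1 / real (Suc n)" 1 "0::'a"] by (simp add: indicator_def subset_iff)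
      then show "ennreal (norm z powr (-p)) * indicator (ball 0 (1 / real (Suc n))) z
        \<le> ennreal (norm z powr (-p)) * indicator (ball 0 1) z" by (rule mult_left_mono) simp
    qed
    show "AE z in lborel. (\<lambda>n. ennreal (norm (z::'a) powr (-p)) * indicator (ball 0 (1 / real (Suc n))) z) \<longlonglongrightarrow> 0"
    proof (rule AE_I2)
      fix z :: 'a
      have "\<forall>\<^sub>F n in sequentially. ennreal (norm z powr (-p)) * indicator (ball 0 (1 / real (Suc n))) z = 0"
      proof (cases "z = 0")
        case False
        have "(\<lambda>n. 1 / real (Suc n)) \<longlonglongrightarrow> 0" by real_asymp
        then have "\<forall>\<^sub>F n in sequentially. 1 / real (Suc n) < norm z"
          by (rule order_tendstoD) (use False in simp)
        then show ?thesis by eventually_elim (simp add: indicator_def)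
      qed simp
      then show "(\<lambda>n. ennreal (norm z powr (-p)) * indicator (ball 0 (1 / real (Suc n))) z) \<longlonglongrightarrow> 0"
        by (rule tendsto_eventually)
    qed
  qed measurable
  then show ?thesis by simp
qed

lemma nn_integral_lborel_shift:
  fixes a :: "'a::euclidean_space"
  assumes [measurable]: "f \<in> borel_measurable borel"
  shows "(\<integral>\<^sup>+z. f (z - a) \<partial>lborel) = (\<integral>\<^sup>+z. f z \<partial>lborel)"
proof -
  have "(\<integral>\<^sup>+z. f z \<partial>lborel) = (\<integral>\<^sup>+z. f z \<partial>distr lborel borel ((+) (- a)))"
    by (simp add: lborel_distr_plus)
  also have "\<dots> = (\<integral>\<^sup>+z. f (z - a) \<partial>lborel)"
    by (subst nn_integral_distr) auto
  finally show ?thesis ..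
qed

lemma near_mass_shift:
  "(\<integral>\<^sup>+z. ennreal (norm (z - a) powr (-p)) * indicator (ball a r) z \<partial>lborel) = near_mass TYPE('a) p r"
  for a :: "'a::euclidean_space"
proof -
  have ind: "indicator (ball a r) z = (indicator (ball 0 r) (z - a) :: ennreal)" for z
    by (auto simp: indicator_def dist_norm norm_minus_commute)
  have "(\<lambda>z::'a. ennreal (norm z powr (-p)) * indicator (ball 0 r) z) \<in> borel_measurable borel"
    by measurable
  from nn_integral_lborel_shift[OF this, of a] show ?thesis
    by (simp only: near_mass_def ind)
qed

text \<open>
  The balls of radius \<open>\<epsilon>\<close> around the points of \<open>S\<close> are disjoint, and on the ball around \<open>y\<close> the distance
  to \<open>a\<close> is at most \<open>3/2\<close> times \<open>|y - a|\<close>, because \<open>\<epsilon> \<le> |y - a| / 2\<close>. So each term times the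
  volume of a ball is at most \<open>(3/2)\<^sup>p\<close> times the integral of the kernel over that ball, whatever \<open>\<epsilon>\<close> is.
\<close>

lemma short_range_sum:
  fixes a :: "'a::euclidean_space"
  assumes e: "\<epsilon> > 0" and p: "p > 0" and fin: "finite S"
    and sep: "\<And>x y. x \<in> S \<Longrightarrow> y \<in> S \<Longrightarrow> x \<noteq> y \<Longrightarrow> norm (x - y) \<ge> 2 * \<epsilon>"
    and far: "\<And>y. y \<in> S \<Longrightarrow> norm (y - a) \<ge> 2 * \<epsilon>" and near: "\<And>y. y \<in> S \<Longrightarrow> norm (y - a) < r"
  shows "ennreal ((\<Sum>y\<in>S. norm (y - a) powr (-p)) * (omega TYPE('a) * \<epsilon> ^ DIM('a)))
    \<le> ennreal ((3/2) powr p) * near_mass TYPE('a) p (3/2 * r)"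
proof -
  have "ennreal ((\<Sum>y\<in>S. norm (y - a) powr (-p)) * (omega TYPE('a) * \<epsilon> ^ DIM('a)))
      = (\<Sum>y\<in>S. ennreal (norm (y - a) powr (-p)) * emeasure lborel (ball y \<epsilon>))"
    using e omega_pos[where ?'a='a]
    by (simp add: emeasure_ball_omega sum_distrib_right ennreal_mult[symmetric] sum_ennreal)
  also have "\<dots> = (\<integral>\<^sup>+z. (\<Sum>y\<in>S. ennreal (norm (y - a) powr (-p)) * indicator (ball y \<epsilon>) z) \<partial>lborel)"
    unfolding nn_integral_cmult_indicator[OF borel_ball_lborel, symmetric]
    by (rule nn_integral_sum[symmetric]) measurable
  also have "\<dots> \<le> (\<integral>\<^sup>+z. ennreal ((3/2) powr p) *
      (ennreal (norm (z - a) powr (-p)) * indicator (ball a (3/2 * r)) z) \<partial>lborel)"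
  proof (rule nn_integral_mono)
    fix z
    show "(\<Sum>y\<in>S. ennreal (norm (y - a) powr (-p)) * indicator (ball y \<epsilon>) z)
      \<le> ennreal ((3/2) powr p) * (ennreal (norm (z - a) powr (-p)) * indicator (ball a (3/2 * r)) z)"
    proof (cases "\<exists>y\<in>S. z \<in> ball y \<epsilon>")
      case True
      then obtain y where y: "y \<in> S" "z \<in> ball y \<epsilon>" by blast
      have "(\<Sum>w\<in>S - {y}. ennreal (norm (w - a) powr (-p)) * indicator (ball w \<epsilon>) z) = 0"
      proof (intro sum.neutral ballI)
        fix w assume "w \<in> S - {y}"
        then have "z \<notin> ball w \<epsilon>" using disjoint_balls[OF sep[of w y]] y by blast
        then show "ennreal (norm (w - a) powr (-p)) * indicator (ball w \<epsilon>) z = 0" by simp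
      qed
      then have "(\<Sum>w\<in>S. ennreal (norm (w - a) powr (-p)) * indicator (ball w \<epsilon>) z)
          = ennreal (norm (y - a) powr (-p))"
        using y fin by (subst sum.remove[of S y]) auto
      also have "norm (y - a) powr (-p) \<le> (3/2) powr p * norm (z - a) powr (-p)"
      proof -
        have zy: "norm (z - y) < \<epsilon>" using y(2) by (simp add: dist_norm norm_minus_commute)
        have "norm (z - a) \<le> norm (z - y) + norm (y - a)"
          using norm_triangle_ineq[of "z - y" "y - a"] by simp
        then have le: "norm (z - a) \<le> 3/2 * norm (y - a)" using zy far[OF y(1)] by simp
        have "norm (y - a) \<le> norm (z - y) + norm (z - a)"
          using norm_triangle_ineq[of "y - z" "z - a"] by (simp add: norm_minus_commute)
        then have "norm (z - a) > 0" using zy far[OF y(1)] e by linarith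
        have c: "(3/2::real) powr p * (3/2) powr (-p) = 1" by (simp add: powr_minus)
        have "(3/2 * norm (y - a)) powr (-p) = (3/2) powr (-p) * norm (y - a) powr (-p)"
          by (rule powr_mult)
        then have eq: "norm (y - a) powr (-p) = (3/2) powr p * (3/2 * norm (y - a)) powr (-p)"
          by (simp only: mult.assoc[symmetric] c mult_1)
        have "(3/2 * norm (y - a)) powr (-p) \<le> norm (z - a) powr (-p)"
          using p le \<open>norm (z - a) > 0\<close> by (intro powr_mono2') auto
        then have "(3/2) powr p * (3/2 * norm (y - a)) powr (-p) \<le> (3/2) powr p * norm (z - a) powr (-p)"
          by (rule mult_left_mono) (rule powr_ge_zero)
        then show ?thesis by (simp only: eq)
      qed
      finally have 1: "(\<Sum>w\<in>S. ennreal (norm (w - a) powr (-p)) * indicator (ball w \<epsilon>) z)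
          \<le> ennreal ((3/2) powr p * norm (z - a) powr (-p))"
        by (simp add: ennreal_leI)
      have "norm (z - y) < \<epsilon>" using y(2) by (simp add: dist_norm norm_minus_commute)
      moreover have "norm (z - a) \<le> norm (z - y) + norm (y - a)"
        using norm_triangle_ineq[of "z - y" "y - a"] by simp
      ultimately have "z \<in> ball a (3/2 * r)"
        using far[OF y(1)] near[OF y(1)] by (simp add: dist_norm norm_minus_commute)
      then show ?thesis using 1 by (simp add: ennreal_mult)
    next
      case False
      then have "(\<Sum>y\<in>S. ennreal (norm (y - a) powr (-p)) * indicator (ball y \<epsilon>) z) = 0"
        by (intro sum.neutral) (auto simp: indicator_def)
      then show ?thesis by simp
    qed
  qed
  also have "\<dots> = ennreal ((3/2) powr p) * near_mass TYPE('a) p (3/2 * r)"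
    by (subst nn_integral_cmult) (auto simp: near_mass_shift)
  finally show ?thesis .
qed

text \<open>
  The interaction energy without its sign, as a nonnegative extended number. The diagonal contributes
  nothing because \<open>0 powr (-p) = 0\<close>.
\<close>

definition riesz_energy :: "real \<Rightarrow> 'a::euclidean_space measure \<Rightarrow> ennreal" where
  "riesz_energy p \<mu> = (\<integral>\<^sup>+x. \<integral>\<^sup>+y. ennreal (norm (x - y) powr (-p)) \<partial>\<mu> \<partial>\<mu>)"

lemma sets_density_measure [simp, measurable_cong]: "sets (density_measure \<rho>) = sets borel"
  by (simp add: density_measure_def)

lemma space_density_measure [simp]: "space (density_measure \<rho>) = UNIV"
  by (simp add: density_measure_def)

lemma finite_density_measure:
  fixes \<rho> :: "'a::euclidean_space \<Rightarrow> real"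
  assumes "integrable lborel \<rho>"
  shows "finite_measure (density_measure \<rho>)"
proof
  have "emeasure (density_measure \<rho>) UNIV = (\<integral>\<^sup>+x. ennreal (\<rho> x) \<partial>lborel)"
    unfolding density_measure_def using assms
    by (subst emeasure_density) auto
  then show "emeasure (density_measure \<rho>) (space (density_measure \<rho>)) \<noteq> \<infinity>"
    using assms by (simp add: real_integrable_def)
qed

text \<open>
  For fixed \<open>x\<close>, the density is at most 1 on the unit ball around \<open>x\<close>, where the kernel is integrable, and
  the kernel is at most 1 outside that ball, where the density is integrable.
\<close>

lemma riesz_energy_finite:
  fixes p :: real and \<rho> :: "'a::euclidean_space \<Rightarrow> real"
  assumes p: "0 < p" "p < DIM('a)" and int: "integrable lborel \<rho>" and le: "\<And>x. \<rho> x \<le> 1"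
  shows "riesz_energy p (density_measure \<rho>) < \<infinity>"
proof -
  interpret finite_measure "density_measure \<rho>" by (rule finite_density_measure[OF int])
  have [measurable]: "\<rho> \<in> borel_measurable borel" using int by simp
  let ?m = "emeasure (density_measure \<rho>) UNIV"
  have inner: "(\<integral>\<^sup>+y. ennreal (norm (x - y) powr (-p)) \<partial>density_measure \<rho>) \<le> near_mass TYPE('a) p 1 + ?m" for x
  proof -
    have "(\<integral>\<^sup>+y. ennreal (norm (x - y) powr (-p)) \<partial>density_measure \<rho>)
       \<le> (\<integral>\<^sup>+y. ennreal (norm (x - y) powr (-p)) * indicator (ball x 1) y + 1 \<partial>density_measure \<rho>)"
    proof (rule nn_integral_mono)
      fix y
      have "norm (x - y) powr (-p) \<le> 1" if "\<not> norm (x - y) < 1"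
        using that p powr_mono2'[of "-p" 1 "norm (x - y)"] by simp
      then show "ennreal (norm (x - y) powr (-p)) \<le> ennreal (norm (x - y) powr (-p)) * indicator (ball x 1) y + 1"
        by (cases "norm (x - y) < 1") (auto simp: indicator_def dist_norm)
    qed
    also have "\<dots> = (\<integral>\<^sup>+y. ennreal (norm (x - y) powr (-p)) * indicator (ball x 1) y \<partial>density_measure \<rho>) + ?m"
      by (subst nn_integral_add) auto
    also have "(\<integral>\<^sup>+y. ennreal (norm (x - y) powr (-p)) * indicator (ball x 1) y \<partial>density_measure \<rho>)
        = (\<integral>\<^sup>+y. ennreal (\<rho> y) * (ennreal (norm (x - y) powr (-p)) * indicator (ball x 1) y) \<partial>lborel)"
      unfolding density_measure_def by (subst nn_integral_density) auto
    also have "\<dots> \<le> (\<integral>\<^sup>+y. 1 * (ennreal (norm (y - x) powr (-p)) * indicator (ball x 1) y) \<partial>lborel)"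
      using le by (intro nn_integral_mono mult_mono) (auto simp: norm_minus_commute)
    also have "\<dots> = near_mass TYPE('a) p 1"
      by (simp add: near_mass_shift)
    finally show ?thesis by (simp add: add_mono)
  qed
  have "riesz_energy p (density_measure \<rho>) \<le> (\<integral>\<^sup>+x. near_mass TYPE('a) p 1 + ?m \<partial>density_measure \<rho>)"
    unfolding riesz_energy_def by (intro nn_integral_mono inner)
  also have "\<dots> = (near_mass TYPE('a) p 1 + ?m) * ?m" by simp
  also have "\<dots> < \<infinity>"
  proof -
    have "?m < top" by (rule less_top[THEN iffD1]) (use emeasure_finite[of UNIV] in simp)
    then show ?thesis using near_mass_finite[OF p] by (simp add: ennreal_mult_less_top)
  qed
  finally show ?thesis .
qed

lemma riesz_kernel_powr:
  "riesz_kernel \<sigma> x y = - (norm (x - y) powr (- (DIM('a) + \<sigma>)))" for \<sigma> :: real and x :: "'a::euclidean_space"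
  by (simp only: riesz_kernel_def powr_minus_divide)

lemma eintegral_riesz:
  fixes \<sigma> :: real and \<mu> :: "'a::euclidean_space measure"
  assumes "finite_measure \<mu>" and [measurable_cong]: "sets \<mu> = sets borel"
  shows "eintegral (\<mu> \<Otimes>\<^sub>M \<mu>) (\<lambda>(x, y). riesz_kernel \<sigma> x y) = - enn2ereal (riesz_energy (DIM('a) + \<sigma>) \<mu>)"
proof -
  interpret finite_measure \<mu> by fact
  have "(\<integral>\<^sup>+z. ennreal (- (case z of (x, y) \<Rightarrow> riesz_kernel \<sigma> x y)) \<partial>(\<mu> \<Otimes>\<^sub>M \<mu>))
      = (\<integral>\<^sup>+z. (case z of (x, y) \<Rightarrow> ennreal (norm (x - y) powr (- (DIM('a) + \<sigma>)))) \<partial>(\<mu> \<Otimes>\<^sub>M \<mu>))"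
    by (intro nn_integral_cong) (simp add: riesz_kernel_powr split: prod.split)
  also have "\<dots> = riesz_energy (DIM('a) + \<sigma>) \<mu>"
    unfolding riesz_energy_def by (subst nn_integral_fst[symmetric]) auto
  finally have 1: "(\<integral>\<^sup>+z. ennreal (- (case z of (x, y) \<Rightarrow> riesz_kernel \<sigma> x y)) \<partial>(\<mu> \<Otimes>\<^sub>M \<mu>)) = riesz_energy (DIM('a) + \<sigma>) \<mu>" .
  have "(\<integral>\<^sup>+z. ennreal (case z of (x, y) \<Rightarrow> riesz_kernel \<sigma> x y) \<partial>(\<mu> \<Otimes>\<^sub>M \<mu>)) = (\<integral>\<^sup>+z. 0 \<partial>(\<mu> \<Otimes>\<^sub>M \<mu>))"
    by (intro nn_integral_cong) (simp add: riesz_kernel_powr ennreal_neg split: prod.split)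
  then show ?thesis unfolding eintegral_def 1 by (simp add: zero_ennreal.rep_eq)
qed

section \<open>Tight convergence and double integrals\<close>

definition fin_borel :: "'a::euclidean_space measure \<Rightarrow> bool" where
  "fin_borel M \<longleftrightarrow> finite_measure M \<and> sets M = sets borel"

lemma integrable_bounded:
  fixes f :: "'a::euclidean_space \<Rightarrow> real"
  assumes "fin_borel M" "f \<in> borel_measurable borel" "\<And>x. \<bar>f x\<bar> \<le> B"
  shows "integrable M f"
proof -
  interpret finite_measure M using assms by (simp add: fin_borel_def)
  show ?thesis
    by (rule integrable_const_bound[where B = B])
      (use assms in \<open>auto simp: fin_borel_def cong: measurable_cong_sets\<close>)
qed

lemma space_fin_borel: "fin_borel M \<Longrightarrow> space M = UNIV"
  unfolding fin_borel_def by (metis sets_eq_imp_space_eq space_borel)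

lemma integral_bounded:
  fixes f :: "'a::euclidean_space \<Rightarrow> real"
  assumes M: "fin_borel M" and f: "f \<in> borel_measurable borel" "\<And>x. \<bar>f x\<bar> \<le> B"
  shows "\<bar>\<integral>x. f x \<partial>M\<bar> \<le> B * measure M UNIV"
proof -
  interpret finite_measure M using M by (simp add: fin_borel_def)
  have "\<bar>\<integral>x. f x \<partial>M\<bar> \<le> (\<integral>x. \<bar>f x\<bar> \<partial>M)" by (rule integral_abs_bound)
  also have "\<dots> \<le> (\<integral>x. B \<partial>M)"
    using integrable_bounded[OF M f] f(2) by (intro integral_mono) auto
  finally show ?thesis by (simp add: space_fin_borel[OF M] mult.commute)
qed

definition cutoff :: "real \<Rightarrow> 'a::euclidean_space \<Rightarrow> real" where
  "cutoff R x = max 0 (min 1 (R + 1 - norm x))"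

lemma cutoff_bounds: "0 \<le> cutoff R x" "cutoff R x \<le> 1" "\<bar>cutoff R x\<bar> \<le> 1"
  "\<bar>1 - cutoff R x\<bar> \<le> 1"
  by (auto simp: cutoff_def)

lemma cutoff_continuous: "continuous_on A (cutoff R)"
  unfolding cutoff_def[abs_def] by (intro continuous_intros)

lemma cutoff_measurable [measurable]: "cutoff R \<in> borel_measurable borel"
  by (intro borel_measurable_continuous_onI cutoff_continuous)

lemma cutoff_outside: "norm x \<ge> R + 1 \<Longrightarrow> cutoff R x = 0"
  by (auto simp: cutoff_def)

lemma cutoff_inside: "norm x \<le> R \<Longrightarrow> cutoff R x = 1"
  by (auto simp: cutoff_def)

lemma cutoff_mult_vanishes: "((\<lambda>x. f x * cutoff R x) \<longlongrightarrow> 0) at_infinity"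
  by (rule tendsto_eventually)
    (auto simp: eventually_at_infinity intro!: exI[of _ "R + 1"] cutoff_outside)

lemma cutoff_tendsto_1: "(\<lambda>n. cutoff (real n) x) \<longlonglongrightarrow> 1"
proof (rule tendsto_eventually)
  obtain N where "norm x \<le> real N" using real_arch_simple by blast
  then show "\<forall>\<^sub>F n in sequentially. cutoff (real n) x = 1"
    by (intro eventually_sequentiallyI[of N] cutoff_inside) auto
qed

text \<open>
  Uniform continuity on a ball slightly larger than the one outside which \<open>f\<close> is small: two points
  closer than 1 either both lie in it, or both lie where \<open>f\<close> is small.
\<close>

lemma vanishing_uniformly_continuous:
  fixes f :: "'a::euclidean_space \<Rightarrow> real"
  assumes cont: "continuous_on UNIV f" and lim: "(f \<longlongrightarrow> 0) at_infinity"
  shows "uniformly_continuous_on UNIV f"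
  unfolding uniformly_continuous_on_def
proof (intro allI impI)
  fix e :: real assume e: "e > 0"
  have "\<forall>\<^sub>F x in at_infinity. dist (f x) 0 < e / 2"
    using lim e by (intro tendstoD) auto
  then obtain R where R: "\<And>x. norm x \<ge> R \<Longrightarrow> \<bar>f x\<bar> < e / 2"
    by (auto simp: eventually_at_infinity)
  have "uniformly_continuous_on (cball 0 (R + 1)) f"
    by (intro compact_uniformly_continuous continuous_on_subset[OF cont]) auto
  then obtain d where d: "d > 0"
    and D: "\<And>x y. x \<in> cball 0 (R+1) \<Longrightarrow> y \<in> cball 0 (R+1) \<Longrightarrow> dist y x < d \<Longrightarrow> dist (f y) (f x) < e"
    using e unfolding uniformly_continuous_on_def by metis
  show "\<exists>d>0. \<forall>x\<in>UNIV. \<forall>x'\<in>UNIV. dist x' x < d \<longrightarrow> dist (f x') (f x) < e"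
  proof (intro exI[of _ "min d 1"] conjI ballI impI)
    fix x y :: 'a assume xy: "dist y x < min d 1"
    show "dist (f y) (f x) < e"
    proof (cases "norm x \<le> R + 1 \<and> norm y \<le> R + 1")
      case True then show ?thesis using D xy by auto
    next
      case False
      have "\<bar>norm y - norm x\<bar> < 1"
        using xy norm_triangle_ineq3[of y x] by (simp add: dist_norm)
      then have "norm x \<ge> R" "norm y \<ge> R" using False by linarith+
      then show ?thesis using R[of x] R[of y] unfolding dist_real_def by linarith
    qed
  qed (use d in auto)
qed

lemma vanishing_bounded:
  fixes f :: "'a::euclidean_space \<Rightarrow> real"
  assumes cont: "continuous_on UNIV f" and lim: "(f \<longlongrightarrow> 0) at_infinity"
  obtains B where "\<And>x. \<bar>f x\<bar> \<le> B"
proof -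
  have "\<forall>\<^sub>F x in at_infinity. dist (f x) 0 < 1"
    using lim by (intro tendstoD) auto
  then obtain R where R: "\<And>x. norm x \<ge> R \<Longrightarrow> \<bar>f x\<bar> < 1"
    by (auto simp: eventually_at_infinity)
  have "bounded (f ` cball 0 R)"
    by (intro compact_imp_bounded compact_continuous_image continuous_on_subset[OF cont]) auto
  then obtain B where "\<forall>x\<in>cball 0 R. \<bar>f x\<bar> \<le> B"
    by (auto simp: bounded_iff)
  then have B: "\<And>x. norm x \<le> R \<Longrightarrow> \<bar>f x\<bar> \<le> B"
    by simp
  show thesis
  proof (rule that[of "max 1 B"])
    show "\<bar>f x\<bar> \<le> max 1 B" for x
      using R[of x] B[of x] by (cases "norm x \<le> R") auto
  qed
qed

text \<open>
  The limit sees only small \<open>\<epsilon>\<close>, so finiteness is an eventual property.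
\<close>

locale tight_family =
  fixes \<nu> :: "real \<Rightarrow> 'a::euclidean_space measure" and \<nu>0 :: "'a measure"
  assumes conv: "tight_conv \<nu> \<nu>0"
    and fin: "\<forall>\<^sub>F \<epsilon> in at_right 0. fin_borel (\<nu> \<epsilon>)"
    and fin0: "fin_borel \<nu>0"
begin

lemma mass_conv: "((\<lambda>\<epsilon>. measure (\<nu> \<epsilon>) UNIV) \<longlongrightarrow> measure \<nu>0 UNIV) (at_right 0)"
  using conv by (simp add: tight_conv_def)

lemma mass_bound: "\<forall>\<^sub>F \<epsilon> in at_right 0. measure (\<nu> \<epsilon>) UNIV \<le> measure \<nu>0 UNIV + 1"
  using order_tendstoD(2)[OF mass_conv, of "measure \<nu>0 UNIV + 1"]
  by (auto elim: eventually_mono)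

lemma weak_conv:
  fixes \<phi> :: "'a \<Rightarrow> real"
  shows "continuous_on UNIV \<phi> \<Longrightarrow> (\<phi> \<longlongrightarrow> 0) at_infinity \<Longrightarrow> ((\<lambda>\<epsilon>. \<integral>x. \<phi> x \<partial>\<nu> \<epsilon>) \<longlongrightarrow> (\<integral>x. \<phi> x \<partial>\<nu>0)) (at_right 0)"
  using conv by (simp add: tight_conv_def weak_star_conv_def)

lemma integral_one_minus_cutoff:
  assumes "fin_borel M"
  shows "(\<integral>x. 1 - cutoff R x \<partial>M) = measure M UNIV - (\<integral>x. cutoff R (x::'a) \<partial>M)"
proof -
  interpret finite_measure M using assms by (simp add: fin_borel_def)
  show ?thesis
    using integrable_bounded[OF assms cutoff_measurable cutoff_bounds(3), of R]
    by (subst Bochner_Integration.integral_diff) (auto simp: space_fin_borel[OF assms])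
qed

text \<open>
  Convergence of the masses turns the weak convergence against \<open>cutoff R\<close> into convergence against
  \<open>1 - cutoff R\<close>: no mass escapes to infinity.
\<close>

lemma tail_small:
  assumes "e > 0"
  obtains R where "(\<integral>x. 1 - cutoff R x \<partial>\<nu>0) < e"
    "\<forall>\<^sub>F \<epsilon> in at_right 0. (\<integral>x. 1 - cutoff R x \<partial>\<nu> \<epsilon>) < e"
proof -
  interpret N: finite_measure \<nu>0 using fin0 by (simp add: fin_borel_def)
  have [measurable_cong]: "sets \<nu>0 = sets borel" using fin0 by (simp add: fin_borel_def)
  have "(\<lambda>n. \<integral>x. 1 - cutoff (real n) x \<partial>\<nu>0) \<longlonglongrightarrow> (\<integral>x. 0 \<partial>\<nu>0)"
  proof (rule integral_dominated_convergence[where w = "\<lambda>_. 1"])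
    show "AE x in \<nu>0. (\<lambda>n. 1 - cutoff (real n) x) \<longlonglongrightarrow> 0"
      using tendsto_diff[OF tendsto_const cutoff_tendsto_1, of 1] by auto
    show "AE x in \<nu>0. norm (1 - cutoff (real n) x) \<le> 1" for n
      by (simp add: cutoff_bounds)
  qed auto
  then have "(\<lambda>n. \<integral>x. 1 - cutoff (real n) x \<partial>\<nu>0) \<longlonglongrightarrow> 0" by simp
  from order_tendstoD(2)[OF this assms] obtain n where
    n: "(\<integral>x. 1 - cutoff (real n) x \<partial>\<nu>0) < e"
    by (auto dest: eventually_happens)
  have "((\<lambda>\<epsilon>. \<integral>x. 1 * cutoff (real n) x \<partial>\<nu> \<epsilon>) \<longlongrightarrow> (\<integral>x. 1 * cutoff (real n) x \<partial>\<nu>0)) (at_right 0)"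
    by (intro weak_conv cutoff_mult_vanishes continuous_intros cutoff_continuous)
  then have "((\<lambda>\<epsilon>. measure (\<nu> \<epsilon>) UNIV - (\<integral>x. cutoff (real n) x \<partial>\<nu> \<epsilon>))
      \<longlongrightarrow> measure \<nu>0 UNIV - (\<integral>x. cutoff (real n) x \<partial>\<nu>0)) (at_right 0)"
    using mass_conv by (intro tendsto_diff) auto
  moreover have "measure \<nu>0 UNIV - (\<integral>x. cutoff (real n) x \<partial>\<nu>0) < e"
    using n integral_one_minus_cutoff[OF fin0] by simp
  ultimately have "\<forall>\<^sub>F \<epsilon> in at_right 0. measure (\<nu> \<epsilon>) UNIV - (\<integral>x. cutoff (real n) x \<partial>\<nu> \<epsilon>) < e"
    by (rule order_tendstoD(2))
  then have "\<forall>\<^sub>F \<epsilon> in at_right 0. (\<integral>x. 1 - cutoff (real n) x \<partial>\<nu> \<epsilon>) < e"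
    using fin by eventually_elim (simp add: integral_one_minus_cutoff)
  with n show thesis by (rule that)
qed

text \<open>
  Split \<open>f\<close> into \<open>f\<close> times a cutoff, which vanishes at infinity, and a remainder controlled by the tails.
\<close>

lemma bounded_conv:
  fixes f :: "'a \<Rightarrow> real"
  assumes cont: "continuous_on UNIV f" and bd: "\<And>x. \<bar>f x\<bar> \<le> B"
  shows "((\<lambda>\<epsilon>. \<integral>x. f x \<partial>\<nu> \<epsilon>) \<longlongrightarrow> (\<integral>x. f x \<partial>\<nu>0)) (at_right 0)"
proof (rule tendstoI)
  fix e :: real assume e: "e > 0"
  have B: "B \<ge> 0" using bd[of 0] by linarith
  have [measurable]: "f \<in> borel_measurable borel"
    using cont by (rule borel_measurable_continuous_onI)
  have e': "e / (3 * (B + 1)) > 0" using e B by simp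
  obtain R where R0: "(\<integral>x. 1 - cutoff R x \<partial>\<nu>0) < e / (3 * (B + 1))"
    and R: "\<forall>\<^sub>F \<epsilon> in at_right 0. (\<integral>x. 1 - cutoff R x \<partial>\<nu> \<epsilon>) < e / (3 * (B + 1))"
    using tail_small[OF e'] by blast
  have split: "\<bar>(\<integral>x. f x \<partial>M) - (\<integral>x. f x * cutoff R x \<partial>M)\<bar> < e / 3"
    if M: "fin_borel M" and t: "(\<integral>x. 1 - cutoff R x \<partial>M) < e / (3 * (B + 1))" for M :: "'a measure"
  proof -
    have i1: "integrable M f" by (rule integrable_bounded[OF M _ bd]) simp
    have i2: "integrable M (\<lambda>x. f x * cutoff R x)"
    proof (rule integrable_bounded[OF M])
      show "\<bar>f x * cutoff R x\<bar> \<le> B * 1" for x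
        unfolding abs_mult using bd cutoff_bounds B by (intro mult_mono) auto
    qed simp
    have i3: "integrable M (\<lambda>x. 1 - cutoff R x)"
      by (rule integrable_bounded[OF M _ cutoff_bounds(4)]) simp
    have "\<bar>(\<integral>x. f x \<partial>M) - (\<integral>x. f x * cutoff R x \<partial>M)\<bar> = \<bar>\<integral>x. f x - f x * cutoff R x \<partial>M\<bar>"
      using i1 i2 by simp
    also have "\<dots> \<le> (\<integral>x. \<bar>f x - f x * cutoff R x\<bar> \<partial>M)" by (rule integral_abs_bound)
    also have "\<dots> \<le> (\<integral>x. B * (1 - cutoff R x) \<partial>M)"
    proof (rule integral_mono)
      show "\<bar>f x - f x * cutoff R x\<bar> \<le> B * (1 - cutoff R x)" for x
      proof -
        have "\<bar>f x - f x * cutoff R x\<bar> = \<bar>f x\<bar> * (1 - cutoff R x)"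
          using cutoff_bounds[of R x] by (subst right_diff_distrib'[symmetric, of "f x" 1, simplified])
            (simp add: abs_mult)
        then show ?thesis using bd[of x] cutoff_bounds[of R x] by (simp add: mult_right_mono)
      qed
    qed (use i1 i2 i3 in auto)
    also have "\<dots> = B * (\<integral>x. 1 - cutoff R x \<partial>M)" by simp
    also have "\<dots> \<le> B * (e / (3 * (B + 1)))" using B t by (intro mult_left_mono) auto
    also have "\<dots> < e / 3" using B e by (simp add: field_simps)
    finally show ?thesis .
  qed
  have "((\<lambda>\<epsilon>. \<integral>x. f x * cutoff R x \<partial>\<nu> \<epsilon>) \<longlongrightarrow> (\<integral>x. f x * cutoff R x \<partial>\<nu>0)) (at_right 0)"
    by (intro weak_conv cutoff_mult_vanishes continuous_intros cutoff_continuous cont)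
  then have "\<forall>\<^sub>F \<epsilon> in at_right 0. dist (\<integral>x. f x * cutoff R x \<partial>\<nu> \<epsilon>) (\<integral>x. f x * cutoff R x \<partial>\<nu>0) < e / 3"
    using e by (intro tendstoD) auto
  then show "\<forall>\<^sub>F \<epsilon> in at_right 0. dist (\<integral>x. f x \<partial>\<nu> \<epsilon>) (\<integral>x. f x \<partial>\<nu>0) < e"
    using R fin
  proof eventually_elim
    case (elim \<epsilon>)
    then show ?case
      using split[OF fin0 R0] split[OF elim(3,2)] unfolding dist_real_def by linarith
  qed
qed

end

text \<open>
  The modulus of continuity of the convolution depends on the measure only through its mass. This is what
  upgrades pointwise to locally uniform convergence below.
\<close>

lemma convolution_equicontinuous:
  fixes h :: "'a::euclidean_space \<Rightarrow> real"
  assumes M: "fin_borel M" and h: "h \<in> borel_measurable borel" "\<And>x. \<bar>h x\<bar> \<le> B"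
    and d: "\<And>u v. dist u v < d \<Longrightarrow> dist (h u) (h v) < e" and xy: "dist x y < d"
  shows "\<bar>(\<integral>z. h (x - z) \<partial>M) - (\<integral>z. h (y - z) \<partial>M)\<bar> \<le> e * measure M UNIV"
proof -
  have [measurable]: "h \<in> borel_measurable borel" by fact
  have int: "integrable M (\<lambda>z. h (x - z))" for x
    by (rule integrable_bounded[OF M _ h(2)]) simp
  have "\<bar>h (x - z) - h (y - z)\<bar> \<le> e" for z
    using d[of "x - z" "y - z"] xy by (simp add: dist_norm)
  then have "\<bar>\<integral>z. h (x - z) - h (y - z) \<partial>M\<bar> \<le> e * measure M UNIV"
    by (intro integral_bounded[OF M]) auto
  then show ?thesis using int by simp
qed

lemma convolution_continuous:
  fixes h :: "'a::euclidean_space \<Rightarrow> real"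
  assumes M: "fin_borel M" and unif: "uniformly_continuous_on UNIV h" and bd: "\<And>x. \<bar>h x\<bar> \<le> B"
  shows "continuous_on UNIV (\<lambda>x. \<integral>z. h (x - z) \<partial>M)"
  unfolding continuous_on_iff
proof (intro ballI allI impI)
  fix x :: 'a and e :: real assume e: "e > 0"
  define e' where "e' = e / (measure M UNIV + 1)"
  have e': "e' > 0" unfolding e'_def using e by (simp add: add_nonneg_pos)
  then obtain d where "d > 0" and d: "\<And>u v. dist u v < d \<Longrightarrow> dist (h u) (h v) < e'"
    using unif unfolding uniformly_continuous_on_def by (metis UNIV_I)
  have "h \<in> borel_measurable borel"
    using unif by (intro borel_measurable_continuous_onI uniformly_continuous_imp_continuous)
  note eq = convolution_equicontinuous[OF M this bd d]
  have "measure M UNIV + 1 > 0" by (simp add: add_nonneg_pos)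
  then have "e' * measure M UNIV < e" unfolding e'_def using e by (simp add: field_simps)
  then show "\<exists>d>0. \<forall>x'\<in>UNIV. dist x' x < d \<longrightarrow> dist (\<integral>z. h (x' - z) \<partial>M) (\<integral>z. h (x - z) \<partial>M) < e"
    using \<open>d > 0\<close> eq unfolding dist_real_def by (intro exI[of _ d]) (auto intro: le_less_trans)
qed

context tight_family
begin

text \<open>
  Pointwise convergence at the finitely many points of a net in the ball, extended to the whole ball by
  equicontinuity of the convolutions.
\<close>

lemma convolution_conv_uniform:
  fixes h :: "'a \<Rightarrow> real" and e :: real
  assumes unif: "uniformly_continuous_on UNIV h" and bd: "\<And>x. \<bar>h x\<bar> \<le> B" and e: "e > 0"
  shows "\<forall>\<^sub>F \<epsilon> in at_right 0. \<forall>x\<in>cball 0 R. \<bar>(\<integral>y. h (x - y) \<partial>\<nu> \<epsilon>) - (\<integral>y. h (x - y) \<partial>\<nu>0)\<bar> \<le> e"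
proof -
  define m where "m = measure \<nu>0 UNIV"
  have m: "m \<ge> 0" by (simp add: m_def)
  \<comment> \<open>Room for three errors: \<open>e'\<close> times the masses \<open>m + 1\<close> and \<open>m\<close>, and \<open>e'\<close> at the point of the net.\<close>
  define e' where "e' = e / (2 * (m + 1) + 1)"
  have e': "e' > 0" unfolding e'_def using e m by simp
  then obtain d where dpos: "d > 0" and d: "\<And>u v. dist u v < d \<Longrightarrow> dist (h u) (h v) < e'"
    using unif unfolding uniformly_continuous_on_def by (metis UNIV_I)
  have hm: "h \<in> borel_measurable borel"
    using unif by (intro borel_measurable_continuous_onI uniformly_continuous_imp_continuous)
  have eq: "\<bar>(\<integral>z. h (x - z) \<partial>M) - (\<integral>z. h (y - z) \<partial>M)\<bar> \<le> e' * measure M UNIV"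
    if "fin_borel M" "dist x y < d" for x y and M :: "'a measure"
    by (rule convolution_equicontinuous[OF that(1) hm bd d that(2)])
  have cover: "cball (0::'a) R \<subseteq> (\<Union>x\<in>cball 0 R. ball x d)"
  proof
    fix x :: 'a assume x: "x \<in> cball 0 R"
    have "x \<in> ball x d" using dpos by (simp only: centre_in_ball)
    then show "x \<in> (\<Union>x\<in>cball 0 R. ball x d)" by (rule UN_I[OF x])
  qed
  obtain T where T: "T \<subseteq> cball 0 R" "finite T" "cball (0::'a) R \<subseteq> (\<Union>x\<in>T. ball x d)"
    using compactE_image[of "cball 0 R" "cball 0 R" "\<lambda>x. ball x d", OF compact_cball open_ball cover]
    by metis
  have "\<forall>x\<in>T. \<forall>\<^sub>F \<epsilon> in at_right 0. dist (\<integral>y. h (x - y) \<partial>\<nu> \<epsilon>) (\<integral>y. h (x - y) \<partial>\<nu>0) < e'"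
  proof
    fix x
    have "continuous_on UNIV h" using unif by (rule uniformly_continuous_imp_continuous)
    then have "continuous_on UNIV (\<lambda>y. h (x - y))"
      by (rule continuous_on_compose2) (auto intro!: continuous_intros)
    from bounded_conv[OF this bd] e'
    show "\<forall>\<^sub>F \<epsilon> in at_right 0. dist (\<integral>y. h (x - y) \<partial>\<nu> \<epsilon>) (\<integral>y. h (x - y) \<partial>\<nu>0) < e'"
      by (rule tendstoD)
  qed
  then have "\<forall>\<^sub>F \<epsilon> in at_right 0. \<forall>x\<in>T. dist (\<integral>y. h (x - y) \<partial>\<nu> \<epsilon>) (\<integral>y. h (x - y) \<partial>\<nu>0) < e'"
    using T(2) by (simp add: eventually_ball_finite_distrib)
  then show ?thesis
    using mass_bound fin
  proof eventually_elim
    case (elim \<epsilon>)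
    show ?case
    proof
      fix x :: 'a assume "x \<in> cball 0 R"
      then obtain t where t: "t \<in> T" "dist t x < d" using T(3) by auto
      have a: "\<bar>(\<integral>y. h (t - y) \<partial>\<nu> \<epsilon>) - (\<integral>y. h (t - y) \<partial>\<nu>0)\<bar> < e'"
        using elim(1) t(1) by (auto simp: dist_real_def)
      have b: "\<bar>(\<integral>z. h (t - z) \<partial>\<nu> \<epsilon>) - (\<integral>z. h (x - z) \<partial>\<nu> \<epsilon>)\<bar> \<le> e' * (m + 1)"
        using eq[OF elim(3) t(2)] mult_left_mono[OF elim(2) less_imp_le[OF e']] by (simp add: m_def)
      have c: "\<bar>(\<integral>z. h (t - z) \<partial>\<nu>0) - (\<integral>z. h (x - z) \<partial>\<nu>0)\<bar> \<le> e' * m"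
        using eq[OF fin0 t(2)] by (simp add: m_def)
      have "e' * (m + 1) + e' * m + e' \<le> e' * (2 * (m + 1) + 1)"
        using e' by (simp add: algebra_simps)
      also have "\<dots> = e" using m by (simp add: e'_def)
      finally show "\<bar>(\<integral>y. h (x - y) \<partial>\<nu> \<epsilon>) - (\<integral>y. h (x - y) \<partial>\<nu>0)\<bar> \<le> e"
        using a b c by linarith
    qed
  qed
qed

text \<open>
  Both factors of the product measure move with \<open>\<epsilon>\<close>. First replace the inner convolution by its limit, at
  a cost that is uniformly small on a ball and bounded outside it, where the mass is small; then only the
  outer measure moves.
\<close>

lemma interaction_conv:
  fixes h :: "'a \<Rightarrow> real"
  assumes unif: "uniformly_continuous_on UNIV h" and bd: "\<And>x. \<bar>h x\<bar> \<le> B"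
  shows "((\<lambda>\<epsilon>. \<integral>x. \<integral>y. h (x - y) \<partial>\<nu> \<epsilon> \<partial>\<nu> \<epsilon>) \<longlongrightarrow> (\<integral>x. \<integral>y. h (x - y) \<partial>\<nu>0 \<partial>\<nu>0)) (at_right 0)"
proof (rule tendstoI)
  fix e :: real assume e: "e > 0"
  define m where "m = measure \<nu>0 UNIV"
  have m: "m \<ge> 0" by (simp add: m_def)
  have B: "B \<ge> 0" using bd[of 0] by linarith
  \<comment> \<open>A bound for the difference of the two convolutions, whose masses are at most \<open>m + 1\<close> and \<open>m\<close>.\<close>
  define c where "c = B * (2 * m + 1)"
  have c: "c \<ge> 0" using B m by (simp add: c_def)
  define e1 where "e1 = e / (3 * (m + 1))"
  define e2 where "e2 = e / (3 * (c + 1))"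
  have e12: "e1 > 0" "e2 > 0" using e m c by (auto simp: e1_def e2_def)
  have hm [measurable]: "h \<in> borel_measurable borel"
    using unif by (intro borel_measurable_continuous_onI uniformly_continuous_imp_continuous)
  let ?\<Phi> = "\<lambda>M x. \<integral>y. h (x - y) \<partial>M"
  have cont: "fin_borel M \<Longrightarrow> continuous_on UNIV (?\<Phi> M)" for M
    by (rule convolution_continuous[OF _ unif bd])
  have meas: "fin_borel M \<Longrightarrow> ?\<Phi> M \<in> borel_measurable borel" for M
    using cont by (rule borel_measurable_continuous_onI)
  have bound: "fin_borel M \<Longrightarrow> \<bar>?\<Phi> M x\<bar> \<le> B * measure M UNIV" for M x
    by (rule integral_bounded[OF _ _ bd], assumption) measurable
  obtain R where R: "\<forall>\<^sub>F \<epsilon> in at_right 0. (\<integral>x. 1 - cutoff R x \<partial>\<nu> \<epsilon>) < e2"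
    using tail_small[OF e12(2)] by blast
  have "\<forall>\<^sub>F \<epsilon> in at_right 0. dist (\<integral>x. ?\<Phi> \<nu>0 x \<partial>\<nu> \<epsilon>) (\<integral>x. ?\<Phi> \<nu>0 x \<partial>\<nu>0) < e / 3"
    using e by (intro tendstoD[OF bounded_conv[OF cont[OF fin0] bound[OF fin0]]]) auto
  then show "\<forall>\<^sub>F \<epsilon> in at_right 0.
      dist (\<integral>x. ?\<Phi> (\<nu> \<epsilon>) x \<partial>\<nu> \<epsilon>) (\<integral>x. ?\<Phi> \<nu>0 x \<partial>\<nu>0) < e"
    using convolution_conv_uniform[OF unif bd e12(1), of "R + 1"] R mass_bound fin
  proof eventually_elim
    case (elim \<epsilon>)
    note f = elim(5)
    have i1: "integrable (\<nu> \<epsilon>) (?\<Phi> M)" if "fin_borel M" for M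
      by (rule integrable_bounded[OF f meas[OF that] bound[OF that]])
    have i3: "integrable (\<nu> \<epsilon>) (\<lambda>x. 1 - cutoff R x)"
      by (rule integrable_bounded[OF f _ cutoff_bounds(4)]) simp
    have i4: "integrable (\<nu> \<epsilon>) (\<lambda>x. e1)"
      by (rule integrable_bounded[OF f, of _ e1]) (use e12 in auto)
    have "\<bar>(\<integral>x. ?\<Phi> (\<nu> \<epsilon>) x \<partial>\<nu> \<epsilon>) - (\<integral>x. ?\<Phi> \<nu>0 x \<partial>\<nu> \<epsilon>)\<bar> = \<bar>\<integral>x. ?\<Phi> (\<nu> \<epsilon>) x - ?\<Phi> \<nu>0 x \<partial>\<nu> \<epsilon>\<bar>"
      using i1[OF f] i1[OF fin0] by simp
    also have "\<dots> \<le> (\<integral>x. \<bar>?\<Phi> (\<nu> \<epsilon>) x - ?\<Phi> \<nu>0 x\<bar> \<partial>\<nu> \<epsilon>)" by (rule integral_abs_bound)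
    also have "\<dots> \<le> (\<integral>x. e1 + c * (1 - cutoff R x) \<partial>\<nu> \<epsilon>)"
    proof (rule integral_mono)
      show "integrable (\<nu> \<epsilon>) (\<lambda>x. \<bar>?\<Phi> (\<nu> \<epsilon>) x - ?\<Phi> \<nu>0 x\<bar>)" using i1[OF f] i1[OF fin0] by simp
      show "integrable (\<nu> \<epsilon>) (\<lambda>x. e1 + c * (1 - cutoff R x))" using i3 i4 by simp
      fix x :: 'a
      show "\<bar>?\<Phi> (\<nu> \<epsilon>) x - ?\<Phi> \<nu>0 x\<bar> \<le> e1 + c * (1 - cutoff R x)"
      proof (cases "norm x \<le> R + 1")
        case True
        then have "\<bar>?\<Phi> (\<nu> \<epsilon>) x - ?\<Phi> \<nu>0 x\<bar> \<le> e1" using elim(2) by auto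
        then show ?thesis using c cutoff_bounds[of R x] by (simp add: add_increasing2)
      next
        case False
        have "B * measure (\<nu> \<epsilon>) UNIV \<le> B * (m + 1)"
          using elim(4) B by (intro mult_left_mono) (auto simp: m_def)
        then have "\<bar>?\<Phi> (\<nu> \<epsilon>) x - ?\<Phi> \<nu>0 x\<bar> \<le> B * (m + 1) + B * m"
          using bound[OF f, of x] bound[OF fin0, of x] unfolding m_def[symmetric] by linarith
        also have "\<dots> = c" by (simp add: c_def algebra_simps)
        finally show ?thesis using False e12 by (simp add: cutoff_outside)
      qed
    qed
    also have "\<dots> = e1 * measure (\<nu> \<epsilon>) UNIV + c * (\<integral>x. 1 - cutoff R x \<partial>\<nu> \<epsilon>)"
      using i3 i4 by (simp add: space_fin_borel[OF f])
    also have "\<dots> \<le> e1 * (m + 1) + c * e2"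
      using elim(3,4) c e12 by (intro add_mono mult_left_mono) (auto simp: m_def)
    also have "\<dots> \<le> e / 3 + e / 3"
    proof (rule add_mono)
      show "e1 * (m + 1) \<le> e / 3" using m e by (simp add: e1_def field_simps)
      show "c * e2 \<le> e / 3" using c e by (simp add: e2_def field_simps)
    qed
    finally show ?case using elim(1) unfolding dist_real_def by linarith
  qed
qed

end

section \<open>Truncated kernels and the lower bound\<close>

text \<open>
  The kernel with its singularity removed. Away from the origin it lies below \<open>|z|\<^sup>-\<^sup>p\<close> and agrees
  with it for \<open>|z| \<ge> r\<close>; at the origin it is \<open>r\<^sup>-\<^sup>p\<close>, whereas \<open>0 powr (-p) = 0\<close>, so comparisons exclude \<open>z = 0\<close>.
\<close>

definition trunc_kernel :: "real \<Rightarrow> real \<Rightarrow> 'a::euclidean_space \<Rightarrow> real" where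
  "trunc_kernel p r z = (max r (norm z)) powr (-p)"

lemma trunc_nonneg: "0 \<le> trunc_kernel p r z" by (simp add: trunc_kernel_def)

lemma trunc_bound:
  assumes "p > 0" "r > 0" shows "\<bar>trunc_kernel p r z\<bar> \<le> r powr (-p)"
  unfolding abs_of_nonneg[OF trunc_nonneg] unfolding trunc_kernel_def
  by (rule powr_mono2') (use assms in auto)

lemma trunc_le: "p > 0 \<Longrightarrow> z \<noteq> 0 \<Longrightarrow> trunc_kernel p r z \<le> norm z powr (-p)"
  unfolding trunc_kernel_def by (rule powr_mono2') auto

lemma trunc_far: "norm z \<ge> r \<Longrightarrow> trunc_kernel p r z = norm z powr (-p)"
  by (simp add: trunc_kernel_def max_def)

lemma trunc_continuous: "r > 0 \<Longrightarrow> continuous_on A (trunc_kernel p r)"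
  unfolding trunc_kernel_def[abs_def] by (intro continuous_intros) auto

lemma trunc_measurable [measurable]: "trunc_kernel p r \<in> borel_measurable borel"
  unfolding trunc_kernel_def[abs_def] by measurable

lemma trunc_vanishes:
  assumes p: "p > 0" shows "((trunc_kernel p r :: 'a::euclidean_space \<Rightarrow> real) \<longlongrightarrow> 0) at_infinity"
proof -
  have "((\<lambda>t::real. t powr (-p)) \<longlongrightarrow> 0) at_top"
    using p by (intro tendsto_neg_powr filterlim_ident) auto
  then have "((\<lambda>z::'a. norm z powr (-p)) \<longlongrightarrow> 0) at_infinity"
    by (rule filterlim_compose) (rule filterlim_norm_at_top)
  moreover have "\<forall>\<^sub>F z::'a in at_infinity. norm z powr (-p) = trunc_kernel p r z"
    unfolding eventually_at_infinity by (intro exI[of _ r]) (simp add: trunc_far)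
  ultimately show ?thesis by (rule Lim_transform_eventually)
qed

lemma trunc_uniformly_continuous:
  "p > 0 \<Longrightarrow> r > 0 \<Longrightarrow> uniformly_continuous_on UNIV (trunc_kernel p r :: 'a::euclidean_space \<Rightarrow> real)"
  by (intro vanishing_uniformly_continuous trunc_continuous trunc_vanishes)

definition empirical :: "real \<Rightarrow> nat \<Rightarrow> (nat \<Rightarrow> 'a::euclidean_space) \<Rightarrow> 'a measure" where
  "empirical s N x = scale_measure (ennreal s) (dirac_sum N x)"

lemma scale_measure_density: "scale_measure c M = density M (\<lambda>_. c)"
  by (rule measure_eqI) (auto simp: emeasure_density_const)

lemma sets_dirac_sum [simp, measurable_cong]: "sets (dirac_sum N x) = sets borel"
  by (simp add: dirac_sum_def)

lemma integral_dirac_sum: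
  fixes f :: "'a::euclidean_space \<Rightarrow> real"
  assumes [measurable]: "f \<in> borel_measurable borel"
  shows "integrable (dirac_sum N x) f" "(\<integral>y. f y \<partial>dirac_sum N x) = (\<Sum>i=1..N. f (x i))"
  unfolding dirac_sum_def
  by (simp_all add: integrable_distr_eq integral_distr integrable_count_space lebesgue_integral_count_space_finite)

lemma integral_scale_measure:
  fixes f :: "'a \<Rightarrow> real"
  assumes [measurable]: "f \<in> borel_measurable M" and "s \<ge> 0"
  shows "(\<integral>y. f y \<partial>scale_measure (ennreal s) M) = s * (\<integral>y. f y \<partial>M)"
  unfolding scale_measure_density using assms by (subst integral_density) auto

lemma integral_empirical:
  fixes f :: "'a::euclidean_space \<Rightarrow> real"
  assumes [measurable]: "f \<in> borel_measurable borel" and "s \<ge> 0"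
  shows "(\<integral>y. f y \<partial>empirical s N x) = s * (\<Sum>i=1..N. f (x i))"
  unfolding empirical_def using assms
  by (subst integral_scale_measure) (auto simp: integral_dirac_sum)

lemma fin_borel_dirac_sum: "fin_borel (dirac_sum N x)"
proof -
  have "emeasure (dirac_sum N x) UNIV < \<infinity>"
    by (subst emeasure_dirac_sum) (auto simp: ennreal_of_nat_eq_real_of_nat)
  moreover have "space (dirac_sum N x) = UNIV" by (simp add: dirac_sum_def)
  ultimately show ?thesis unfolding fin_borel_def by (auto intro!: finite_measureI)
qed

lemma fin_borel_scale: "fin_borel M \<Longrightarrow> fin_borel (scale_measure (ennreal c) M)"
  unfolding fin_borel_def
  by (auto intro!: finite_measureI simp: space_scale_measure ennreal_mult_eq_top_iff finite_measure.emeasure_finite)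

lemma fin_borel_empirical: "fin_borel (empirical s N x)"
  unfolding empirical_def by (intro fin_borel_scale fin_borel_dirac_sum)

lemma measure_empirical: "s \<ge> 0 \<Longrightarrow> measure (empirical s N x) UNIV = s * N"
  using integral_empirical[of "\<lambda>_. 1" s N x] by (simp add: space_fin_borel[OF fin_borel_empirical])

lemma interaction_empirical:
  fixes h :: "'a::euclidean_space \<Rightarrow> real"
  assumes [measurable]: "h \<in> borel_measurable borel" and s: "s \<ge> 0"
  shows "(\<integral>u. \<integral>v. h (u - v) \<partial>empirical s N x \<partial>empirical s N x)
    = s\<^sup>2 * (\<Sum>i=1..N. \<Sum>j=1..N. h (x i - x j))"
proof -
  have "(\<integral>v. h (u - v) \<partial>empirical s N x) = s * (\<Sum>j=1..N. h (u - x j))" for u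
    using s by (intro integral_empirical) auto
  then show ?thesis
    using s by (simp add: integral_empirical sum_distrib_left power2_eq_square mult.assoc)
qed

lemma pair_energy_sum:
  fixes \<sigma> \<epsilon> :: real and x :: "nat \<Rightarrow> 'a::euclidean_space"
  shows "pair_energy \<sigma> \<epsilon> N x
    = - (scale_factor TYPE('a) \<epsilon>)\<^sup>2 * (\<Sum>i=1..N. \<Sum>j\<in>{1..N} - {i}. norm (x i - x j) powr (- (DIM('a) + \<sigma>)))"
proof -
  have "{(i, j). i \<in> {1..N} \<and> j \<in> {1..N} \<and> i \<noteq> j} = (SIGMA i:{1..N}. {1..N} - {i})" by auto
  then have "pair_energy \<sigma> \<epsilon> N x
      = (\<Sum>(i, j)\<in>(SIGMA i:{1..N}. {1..N} - {i}). riesz_kernel \<sigma> (x i) (x j) * (scale_factor TYPE('a) \<epsilon>)\<^sup>2)"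
    by (simp only: pair_energy_def)
  also have "\<dots> = (\<Sum>i=1..N. \<Sum>j\<in>{1..N} - {i}. riesz_kernel \<sigma> (x i) (x j) * (scale_factor TYPE('a) \<epsilon>)\<^sup>2)"
    by (subst sum.Sigma) auto
  finally show ?thesis
    by (simp add: riesz_kernel_powr sum_distrib_left sum_negf mult.commute)
qed

text \<open>
  The bound of \<open>short_range_sum\<close> with the weight \<open>\<epsilon>\<^sup>d \<omega>\<^sub>d / C\<^sup>d\<close> of a point in place of the volume
  \<open>\<epsilon>\<^sup>d \<omega>\<^sub>d\<close> of its ball; it is independent of \<open>\<epsilon>\<close>.
\<close>

definition near_error :: "'a::euclidean_space itself \<Rightarrow> real \<Rightarrow> real \<Rightarrow> real" where
  "near_error _ p r = (3/2) powr p * enn2real (near_mass TYPE('a) p (3/2 * r)) / packing_density TYPE('a)"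

lemma short_range_scaled:
  fixes x :: "nat \<Rightarrow> 'a::euclidean_space"
  assumes e: "\<epsilon> > 0" and p: "p > 0" and sep: "separated \<epsilon> N x" and i: "i \<in> {1..N}"
    and fin: "near_mass TYPE('a) p (3/2 * r) < \<infinity>"
  shows "scale_factor TYPE('a) \<epsilon> * (\<Sum>j\<in>{j\<in>{1..N} - {i}. norm (x i - x j) < r}. norm (x i - x j) powr (-p))
    \<le> near_error TYPE('a) p r"
proof -
  let ?J = "{j\<in>{1..N} - {i}. norm (x i - x j) < r}"
  let ?A = "\<Sum>y\<in>x ` ?J. norm (y - x i) powr (-p)"
  have inj: "inj_on x {1..N}" by (rule separated_inj_on[OF e sep])
  have "(\<Sum>j\<in>?J. norm (x i - x j) powr (-p)) = ?A"
    by (subst sum.reindex[OF inj_on_subset[OF inj]]) (auto simp: norm_minus_commute)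
  moreover have "ennreal (?A * (omega TYPE('a) * \<epsilon> ^ DIM('a)))
      \<le> ennreal ((3/2) powr p) * near_mass TYPE('a) p (3/2 * r)"
  proof (rule short_range_sum[OF e p])
    show "norm (u - v) \<ge> 2 * \<epsilon>" if "u \<in> x ` ?J" "v \<in> x ` ?J" "u \<noteq> v" for u v
    proof -
      from that obtain a b where "u = x a" "v = x b" "a \<in> {1..N}" "b \<in> {1..N}" "a \<noteq> b"
        by blast
      then show ?thesis using sep unfolding separated_def by blast
    qed
    show "norm (u - x i) \<ge> 2 * \<epsilon>" if "u \<in> x ` ?J" for u
      using that sep i unfolding separated_def by auto
    show "norm (u - x i) < r" if "u \<in> x ` ?J" for u
      using that by (auto simp: norm_minus_commute)
  qed simp
  moreover have "ennreal ((3/2) powr p) * near_mass TYPE('a) p (3/2 * r)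
      = ennreal ((3/2) powr p * enn2real (near_mass TYPE('a) p (3/2 * r)))"
    using fin by (simp add: ennreal_mult)
  ultimately have "(\<Sum>j\<in>?J. norm (x i - x j) powr (-p)) * (omega TYPE('a) * \<epsilon> ^ DIM('a))
      \<le> (3/2) powr p * enn2real (near_mass TYPE('a) p (3/2 * r))"
    by (simp add: ennreal_le_iff)
  then show ?thesis
    using packing_density_pos[where ?'a='a]
    unfolding near_error_def scale_factor_def by (simp add: divide_right_mono field_simps)
qed

text \<open>
  The kernel is at most the truncated kernel plus its restriction to pairs at distance less than \<open>r\<close>. The
  sum over the latter is bounded for each \<open>i\<close> separately, and adding the nonnegative diagonal terms of the
  truncated kernel completes the double integral.
\<close>

lemma energy_upper_bound:
  fixes x :: "nat \<Rightarrow> 'a::euclidean_space"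
  assumes e: "\<epsilon> > 0" and p: "p > 0" and sep: "separated \<epsilon> N x"
    and fin: "near_mass TYPE('a) p (3/2 * r) < \<infinity>"
  defines "s \<equiv> scale_factor TYPE('a) \<epsilon>"
  shows "s\<^sup>2 * (\<Sum>i=1..N. \<Sum>j\<in>{1..N} - {i}. norm (x i - x j) powr (-p))
    \<le> (\<integral>u. \<integral>v. trunc_kernel p r (u - v) \<partial>empirical s N x \<partial>empirical s N x)
      + near_error TYPE('a) p r * measure (empirical s N x) UNIV"
proof -
  have s: "s > 0" unfolding s_def by (rule scale_factor_pos[OF e])
  have "s * (\<Sum>j\<in>{1..N} - {i}. norm (x i - x j) powr (-p))
      \<le> s * (\<Sum>j=1..N. trunc_kernel p r (x i - x j)) + near_error TYPE('a) p r" if i: "i \<in> {1..N}" for i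
  proof -
    have "(\<Sum>j\<in>{1..N} - {i}. norm (x i - x j) powr (-p))
        \<le> (\<Sum>j\<in>{1..N} - {i}. trunc_kernel p r (x i - x j)
            + (if norm (x i - x j) < r then norm (x i - x j) powr (-p) else 0))"
      by (intro sum_mono) (auto simp: trunc_nonneg trunc_far)
    also have "\<dots> = (\<Sum>j\<in>{1..N} - {i}. trunc_kernel p r (x i - x j))
        + (\<Sum>j\<in>{j\<in>{1..N} - {i}. norm (x i - x j) < r}. norm (x i - x j) powr (-p))"
      unfolding sum.distrib by (subst sum.inter_filter[symmetric]) auto
    also have "(\<Sum>j\<in>{1..N} - {i}. trunc_kernel p r (x i - x j)) \<le> (\<Sum>j=1..N. trunc_kernel p r (x i - x j))"
      by (intro sum_mono2) (auto simp: trunc_nonneg)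
    finally have "s * (\<Sum>j\<in>{1..N} - {i}. norm (x i - x j) powr (-p))
      \<le> s * ((\<Sum>j=1..N. trunc_kernel p r (x i - x j))
        + (\<Sum>j\<in>{j\<in>{1..N} - {i}. norm (x i - x j) < r}. norm (x i - x j) powr (-p)))"
      using s by (intro mult_left_mono) auto
    then show ?thesis
      using short_range_scaled[OF e p sep i fin] unfolding s_def[symmetric] distrib_left by linarith
  qed
  then have "(\<Sum>i=1..N. s * (\<Sum>j\<in>{1..N} - {i}. norm (x i - x j) powr (-p)))
      \<le> (\<Sum>i=1..N. s * (\<Sum>j=1..N. trunc_kernel p r (x i - x j)) + near_error TYPE('a) p r)"
    by (rule sum_mono)
  then have "s * (\<Sum>i=1..N. s * (\<Sum>j\<in>{1..N} - {i}. norm (x i - x j) powr (-p)))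
      \<le> s * (\<Sum>i=1..N. s * (\<Sum>j=1..N. trunc_kernel p r (x i - x j)) + near_error TYPE('a) p r)"
    using s by (intro mult_left_mono) auto
  then have "s\<^sup>2 * (\<Sum>i=1..N. \<Sum>j\<in>{1..N} - {i}. norm (x i - x j) powr (-p))
      \<le> s\<^sup>2 * (\<Sum>i=1..N. \<Sum>j=1..N. trunc_kernel p r (x i - x j)) + near_error TYPE('a) p r * (s * N)"
    by (simp add: sum_distrib_left[symmetric] sum.distrib power2_eq_square algebra_simps)
  then show ?thesis
    using s by (simp add: interaction_empirical measure_empirical)
qed

lemma bounded_below:
  fixes g :: "'a::euclidean_space \<Rightarrow> real"
  assumes "continuous_on UNIV g" and "\<And>x. norm x \<ge> R \<Longrightarrow> g x \<ge> 0"
  obtains B where "B \<ge> 0" "\<And>x. - g x \<le> B"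
proof -
  have "bounded (g ` cball 0 R)"
    by (intro compact_imp_bounded compact_continuous_image continuous_on_subset[OF assms(1)]) auto
  then obtain B where "\<forall>x\<in>cball 0 R. \<bar>g x\<bar> \<le> B" by (auto simp: bounded_iff)
  then have B: "\<bar>g x\<bar> \<le> B" if "norm x \<le> R" for x using that by simp
  show thesis
  proof (rule that[of "max 0 B"])
    show "- g x \<le> max 0 B" for x
      using B[of x] assms(2)[of x] by (cases "norm x \<le> R") auto
  qed simp
qed

lemma negative_part_finite:
  fixes g :: "'a::euclidean_space \<Rightarrow> real"
  assumes M: "fin_borel M" and "\<And>x. - g x \<le> B"
  shows "(\<integral>\<^sup>+x. ennreal (- g x) \<partial>M) < \<infinity>"
proof -
  interpret finite_measure M using M by (simp add: fin_borel_def)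
  have "(\<integral>\<^sup>+x. ennreal (- g x) \<partial>M) \<le> (\<integral>\<^sup>+x. ennreal B \<partial>M)"
    using assms(2) by (intro nn_integral_mono ennreal_leI)
  also have "\<dots> < \<infinity>"
  proof -
    have "emeasure M (space M) < top" by (rule less_top[THEN iffD1]) simp
    then show ?thesis by (simp add: ennreal_mult_less_top)
  qed
  finally show ?thesis .
qed

lemma enn2ereal_finite: "a < \<infinity> \<Longrightarrow> enn2ereal a \<noteq> \<infinity>"
  by (cases a rule: ennreal_cases) (auto simp: enn2ereal_ennreal)

lemma eintegral_not_MInf:
  assumes "(\<integral>\<^sup>+x. ennreal (- g x) \<partial>M) < \<infinity>"
  shows "eintegral M g \<noteq> -\<infinity>"
proof -
  have "enn2ereal (\<integral>\<^sup>+x. ennreal (- g x) \<partial>M) \<noteq> \<infinity>"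
    using assms by (rule enn2ereal_finite)
  moreover have "0 \<le> enn2ereal (\<integral>\<^sup>+x. ennreal (g x) \<partial>M)" by simp
  ultimately show ?thesis unfolding eintegral_def
    by (cases "enn2ereal (\<integral>\<^sup>+x. ennreal (g x) \<partial>M)"; cases "enn2ereal (\<integral>\<^sup>+x. ennreal (- g x) \<partial>M)") auto
qed

text \<open>
  If \<open>\<mu>\<close> is not admissible, the left-hand side is finite and \<open>F_eps\<close> is infinite; the sum is \<open>\<infinity>\<close> because
  the negative part of \<open>g\<close> has finite integral. Otherwise \<open>g\<close> times the cutoff is at most \<open>g\<close>, as \<open>g\<close> is
  nonnegative where the cutoff differs from 1.
\<close>

lemma T_eps_lower_bound:
  fixes p \<sigma> \<epsilon> r R :: real and g :: "'a::euclidean_space \<Rightarrow> real"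
  assumes e: "\<epsilon> > 0" and \<mu>: "fin_borel \<mu>" and p: "p = DIM('a) + \<sigma>" "p > 0"
    and fin: "near_mass TYPE('a) p (3/2 * r) < \<infinity>"
    and g: "continuous_on UNIV g" and pos: "\<And>x. norm x \<ge> R \<Longrightarrow> g x \<ge> 0"
  defines "\<nu> \<equiv> scale_measure (ennreal (scale_factor TYPE('a) \<epsilon>)) \<mu>"
  shows "ereal ((\<integral>x. g x * cutoff R x \<partial>\<nu>) - (\<integral>x. \<integral>y. trunc_kernel p r (x - y) \<partial>\<nu> \<partial>\<nu>)
      - near_error TYPE('a) p r * measure \<nu> UNIV) \<le> T_eps \<sigma> g \<epsilon> \<mu>"
proof -
  let ?s = "scale_factor TYPE('a) \<epsilon>"
  have s: "?s > 0" by (rule scale_factor_pos[OF e])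
  have gm [measurable]: "g \<in> borel_measurable borel" using g by (rule borel_measurable_continuous_onI)
  obtain B where B: "B \<ge> 0" "\<And>x. - g x \<le> B" using bounded_below[OF g pos] by blast
  show ?thesis
  proof (cases "\<mu> \<in> EM \<epsilon>")
    case False
    have "- (g x * ?s) \<le> B * ?s" for x
      using mult_right_mono[OF B(2), of ?s] s by simp
    then have "eintegral \<mu> (\<lambda>x. g x * ?s) \<noteq> -\<infinity>"
      by (intro eintegral_not_MInf negative_part_finite[OF \<mu>])
    then have "T_eps \<sigma> g \<epsilon> \<mu> = \<infinity>" using False by (simp add: T_eps_def F_eps_def)
    then show ?thesis by simp
  next
    case True
    then obtain N x where x: "\<mu> = dirac_sum N x" "separated \<epsilon> N x" by (auto simp: EM_def)
    have \<nu>: "\<nu> = empirical ?s N x" by (simp add: \<nu>_def empirical_def x)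
    have "T_eps \<sigma> g \<epsilon> \<mu> = ereal (pair_energy \<sigma> \<epsilon> N x) + eintegral \<mu> (\<lambda>x. g x * ?s)"
      unfolding T_eps_def x(1) by (simp add: F_eps_dirac_sum[OF e x(2)])
    also have "eintegral \<mu> (\<lambda>x. g x * ?s) = ereal (\<Sum>i=1..N. g (x i) * ?s)"
      unfolding x(1) by (subst eintegral_eq_integral) (auto simp: integral_dirac_sum sum_distrib_right)
    also have "(\<Sum>i=1..N. g (x i) * ?s) = ?s * (\<Sum>i=1..N. g (x i))"
      by (simp only: sum_distrib_right[symmetric] mult.commute[of ?s])
    finally have T: "T_eps \<sigma> g \<epsilon> \<mu> = ereal (pair_energy \<sigma> \<epsilon> N x + ?s * (\<Sum>i=1..N. g (x i)))"
      by simp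
    have "pair_energy \<sigma> \<epsilon> N x \<ge> - ((\<integral>x. \<integral>y. trunc_kernel p r (x - y) \<partial>\<nu> \<partial>\<nu>) + near_error TYPE('a) p r * measure \<nu> UNIV)"
      using energy_upper_bound[OF e p(2) x(2) fin] unfolding \<nu> pair_energy_sum p(1)[symmetric]
      by simp
    moreover have "(\<integral>x. g x * cutoff R x \<partial>\<nu>) \<le> ?s * (\<Sum>i=1..N. g (x i))"
    proof -
      have "g y * cutoff R y \<le> g y" for y
        using pos[of y] cutoff_bounds[of R y]
        by (cases "norm y \<le> R") (auto simp: cutoff_inside mult_left_le)
      then show ?thesis
        unfolding \<nu> using s by (subst integral_empirical) (auto intro!: mult_left_mono sum_mono)
    qed
    ultimately show ?thesis unfolding T by simp
  qed
qed

text \<open>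
  The truncated kernel exceeds the Riesz kernel only on the diagonal, which is null as there are no atoms.
\<close>

lemma interaction_le_riesz_energy:
  fixes M :: "'a::euclidean_space measure"
  assumes M: "fin_borel M" and atoms: "\<And>x. emeasure M {x} = 0" and p: "p > 0" and r: "r > 0"
    and E: "riesz_energy p M < \<infinity>"
  shows "(\<integral>x. \<integral>y. trunc_kernel p r (x - y) \<partial>M \<partial>M) \<le> enn2real (riesz_energy p M)"
proof -
  interpret finite_measure M using M by (simp add: fin_borel_def)
  have [measurable_cong]: "sets M = sets borel" using M by (simp add: fin_borel_def)
  have i: "integrable M (\<lambda>y. trunc_kernel p r (x - y))" for x
    by (rule integrable_bounded[OF M _ trunc_bound[OF p r]]) measurable
  have "ennreal (\<integral>x. \<integral>y. trunc_kernel p r (x - y) \<partial>M \<partial>M) \<le> (\<integral>\<^sup>+x. ennreal (\<integral>y. trunc_kernel p r (x - y) \<partial>M) \<partial>M)"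
  proof (cases "integrable M (\<lambda>x. \<integral>y. trunc_kernel p r (x - y) \<partial>M)")
    case True
    then show ?thesis
      by (subst nn_integral_eq_integral) (auto intro!: integral_nonneg_AE simp: trunc_nonneg)
  next
    case False
    then show ?thesis by (simp add: not_integrable_integral_eq)
  qed
  also have "\<dots> \<le> riesz_energy p M"
    unfolding riesz_energy_def
  proof (rule nn_integral_mono)
    fix x
    have "ennreal (\<integral>y. trunc_kernel p r (x - y) \<partial>M) = (\<integral>\<^sup>+y. ennreal (trunc_kernel p r (x - y)) \<partial>M)"
      using i by (intro nn_integral_eq_integral[symmetric]) (auto simp: trunc_nonneg)
    also have "\<dots> \<le> (\<integral>\<^sup>+y. ennreal (norm (x - y) powr (-p)) \<partial>M)"
    proof (rule nn_integral_mono_AE)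
      have "AE y in M. y \<noteq> x"
        using atoms[of x] by (intro AE_I[of _ _ "{x}"]) auto
      then show "AE y in M. ennreal (trunc_kernel p r (x - y)) \<le> ennreal (norm (x - y) powr (-p))"
        by eventually_elim (intro ennreal_leI trunc_le p, simp)
    qed
    finally show "ennreal (\<integral>y. trunc_kernel p r (x - y) \<partial>M) \<le> (\<integral>\<^sup>+y. ennreal (norm (x - y) powr (-p)) \<partial>M)" .
  qed
  finally have "enn2real (ennreal (\<integral>x. \<integral>y. trunc_kernel p r (x - y) \<partial>M \<partial>M)) \<le> enn2real (riesz_energy p M)"
    using E by (intro enn2real_mono) auto
  moreover have "0 \<le> (\<integral>x. \<integral>y. trunc_kernel p r (x - y) \<partial>M \<partial>M)"
    by (intro integral_nonneg_AE AE_I2) (simp add: trunc_nonneg)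
  ultimately show ?thesis by simp
qed

lemma cutoff_mono: "R \<le> R' \<Longrightarrow> cutoff R x \<le> cutoff R' x"
  by (auto simp: cutoff_def)

text \<open>
  Monotone convergence for the positive and the negative part separately; the difference of the limits is
  defined because the second one is finite.
\<close>

lemma eintegral_cutoff_limit:
  fixes g :: "'a::euclidean_space \<Rightarrow> real"
  assumes M: "fin_borel M" and g: "continuous_on UNIV g" and neg: "(\<integral>\<^sup>+x. ennreal (- g x) \<partial>M) < \<infinity>"
  shows "(\<lambda>n. ereal (\<integral>x. g x * cutoff (real n) x \<partial>M)) \<longlonglongrightarrow> eintegral M g"
proof -
  have [measurable]: "g \<in> borel_measurable borel" using g by (rule borel_measurable_continuous_onI)
  have [measurable_cong]: "sets M = sets borel" using M by (simp add: fin_borel_def)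
  have mono: "(\<lambda>n. \<integral>\<^sup>+x. ennreal (f x * cutoff (real n) x) \<partial>M) \<longlonglongrightarrow> (\<integral>\<^sup>+x. ennreal (f x) \<partial>M)"
    if [measurable]: "f \<in> borel_measurable borel" for f
  proof (rule nn_integral_LIMSEQ)
    show "incseq (\<lambda>n x. ennreal (f x * cutoff (real n) x))"
    proof (intro incseq_SucI le_funI)
      fix n x
      show "ennreal (f x * cutoff (real n) x) \<le> ennreal (f x * cutoff (real (Suc n)) x)"
      proof (cases "f x \<ge> 0")
        case True
        then show ?thesis by (intro ennreal_leI mult_left_mono cutoff_mono) auto
      next
        case False
        then have "f x * cutoff (real n) x \<le> 0"
          using cutoff_bounds by (intro mult_nonpos_nonneg) auto
        then show ?thesis by (simp add: ennreal_neg)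
      qed
    qed
    show "(\<lambda>n. ennreal (f x * cutoff (real n) x)) \<longlonglongrightarrow> ennreal (f x)" for x
      using tendsto_mult[OF tendsto_const cutoff_tendsto_1, of "f x" x] by (intro tendsto_ennrealI) simp
  qed measurable
  have "ereal (\<integral>x. g x * cutoff (real n) x \<partial>M)
      = enn2ereal (\<integral>\<^sup>+x. ennreal (g x * cutoff (real n) x) \<partial>M) - enn2ereal (\<integral>\<^sup>+x. ennreal (- g x * cutoff (real n) x) \<partial>M)" for n
  proof -
    obtain B where B: "\<And>x. \<bar>g x * cutoff (real n) x\<bar> \<le> B"
      using vanishing_bounded[OF continuous_on_mult[OF g cutoff_continuous] cutoff_mult_vanishes] by blast
    have "integrable M (\<lambda>x. g x * cutoff (real n) x)"
      by (rule integrable_bounded[OF M _ B]) measurable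
    from eintegral_eq_integral[OF this] show ?thesis by (simp add: eintegral_def)
  qed
  moreover have "(\<lambda>n. enn2ereal (\<integral>\<^sup>+x. ennreal (g x * cutoff (real n) x) \<partial>M)
      - enn2ereal (\<integral>\<^sup>+x. ennreal (- g x * cutoff (real n) x) \<partial>M)) \<longlonglongrightarrow> eintegral M g"
    unfolding eintegral_def
  proof (rule tendsto_diff_ereal_general)
    show "(\<lambda>n. enn2ereal (\<integral>\<^sup>+x. ennreal (g x * cutoff (real n) x) \<partial>M)) \<longlonglongrightarrow> enn2ereal (\<integral>\<^sup>+x. ennreal (g x) \<partial>M)"
      using mono[of g] by simp
    show "(\<lambda>n. enn2ereal (\<integral>\<^sup>+x. ennreal (- g x * cutoff (real n) x) \<partial>M)) \<longlonglongrightarrow> enn2ereal (\<integral>\<^sup>+x. ennreal (- g x) \<partial>M)"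
      using mono[of "\<lambda>x. - g x"] by simp
    have "enn2ereal (\<integral>\<^sup>+x. ennreal (- g x) \<partial>M) \<noteq> \<infinity>"
      using neg by (rule enn2ereal_finite)
    moreover have "enn2ereal (\<integral>\<^sup>+x. ennreal (- g x) \<partial>M) \<ge> 0" by simp
    ultimately show "\<not> ((enn2ereal (\<integral>\<^sup>+x. ennreal (g x) \<partial>M) = \<infinity> \<and> enn2ereal (\<integral>\<^sup>+x. ennreal (- g x) \<partial>M) = \<infinity>) \<or>
        (enn2ereal (\<integral>\<^sup>+x. ennreal (g x) \<partial>M) = -\<infinity> \<and> enn2ereal (\<integral>\<^sup>+x. ennreal (- g x) \<partial>M) = -\<infinity>))"
      by auto
  qed
  ultimately show ?thesis by simp
qed

text \<open>
  Membership in \<open>L1_01\<close> bounds the density only almost everywhere, and all notions involved see it only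
  through the measure.
\<close>

lemma clamp_density:
  fixes \<rho> :: "'a::euclidean_space \<Rightarrow> real"
  assumes "\<rho> \<in> L1_01"
  obtains \<rho>' where "integrable lborel \<rho>'" "\<And>x. 0 \<le> \<rho>' x" "\<And>x. \<rho>' x \<le> 1"
    "density_measure \<rho> = density_measure \<rho>'"
proof -
  have int: "integrable lborel \<rho>" and AE: "AE x in lborel. 0 \<le> \<rho> x \<and> \<rho> x \<le> 1"
    using assms by (auto simp: L1_01_def)
  have [measurable]: "\<rho> \<in> borel_measurable borel" using int by simp
  define \<rho>' where "\<rho>' x = max 0 (min 1 (\<rho> x))" for x
  have [measurable]: "\<rho>' \<in> borel_measurable borel" unfolding \<rho>'_def[abs_def] by measurable
  have eq: "AE x in lborel. \<rho> x = \<rho>' x"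
    using AE by eventually_elim (simp add: \<rho>'_def)
  show thesis
  proof (rule that)
    show "integrable lborel \<rho>'" by (rule integrable_cong_AE_imp[OF int _ eq]) simp
    show "density_measure \<rho> = density_measure \<rho>'"
      unfolding density_measure_def by (rule density_cong) (use eq in auto)
  qed (auto simp: \<rho>'_def)
qed

lemma density_le_lebesgue:
  assumes [measurable]: "\<rho> \<in> borel_measurable borel" and "\<And>x. \<rho> x \<le> 1" and "A \<in> sets borel"
  shows "emeasure (density_measure \<rho>) A \<le> emeasure lborel A"
proof -
  have "emeasure (density_measure \<rho>) A = (\<integral>\<^sup>+x. ennreal (\<rho> x) * indicator A x \<partial>lborel)"
    unfolding density_measure_def using assms by (subst emeasure_density) auto
  also have "\<dots> \<le> (\<integral>\<^sup>+x. 1 * indicator A x \<partial>lborel)"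
    using assms(2) by (intro nn_integral_mono mult_right_mono) (auto simp: ennreal_le_1)
  also have "\<dots> = emeasure lborel A" using assms(3) by simp
  finally show ?thesis .
qed

text \<open>
  The data of the limit problem, with \<open>p = d + \<sigma>\<close> the exponent of the kernel and a representative of the
  density that has values in \<open>[0,1]\<close> everywhere.
\<close>

locale limit_density =
  fixes \<rho> :: "'a::euclidean_space \<Rightarrow> real" and g :: "'a \<Rightarrow> real" and \<sigma> p R0 :: real
  assumes int_\<rho>: "integrable lborel \<rho>" and \<rho>_nonneg: "\<And>x. 0 \<le> \<rho> x" and \<rho>_le_1: "\<And>x. \<rho> x \<le> 1"
    and p_def: "p = DIM('a) + \<sigma>" and p_pos: "p > 0" and p_less: "p < DIM('a)"
    and g_cont: "continuous_on UNIV g" and g_pos: "\<And>x. norm x \<ge> R0 \<Longrightarrow> g x \<ge> 0"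
begin

abbreviation "\<nu>0 \<equiv> density_measure \<rho>"
definition "limit_energy = enn2real (riesz_energy p \<nu>0)"

lemma fin_borel_limit: "fin_borel \<nu>0"
  unfolding fin_borel_def using finite_density_measure[OF int_\<rho>] by simp

lemma no_atoms: "emeasure \<nu>0 {x} = 0"
  using density_le_lebesgue[of \<rho> "{x}"] int_\<rho> \<rho>_le_1 by simp

lemma energy_finite: "riesz_energy p \<nu>0 < \<infinity>"
  by (rule riesz_energy_finite[OF p_pos p_less int_\<rho> \<rho>_le_1])

lemma neg_finite: "(\<integral>\<^sup>+x. ennreal (- g x) \<partial>\<nu>0) < \<infinity>"
  using bounded_below[OF g_cont g_pos] negative_part_finite[OF fin_borel_limit] by metis

lemma T_lim_eq: "T_lim \<sigma> g \<nu>0 = ereal (- limit_energy) + eintegral \<nu>0 g"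
proof -
  have "enn2ereal (riesz_energy p \<nu>0) = ereal limit_energy"
    unfolding limit_energy_def using energy_finite by (cases "riesz_energy p \<nu>0" rule: ennreal_cases) (auto simp: enn2ereal_ennreal)
  moreover have "\<forall>A\<in>sets borel. emeasure \<nu>0 A \<le> emeasure lborel A"
    using int_\<rho> by (intro ballI density_le_lebesgue \<rho>_le_1) auto
  moreover have "eintegral (\<nu>0 \<Otimes>\<^sub>M \<nu>0) (\<lambda>(x, y). riesz_kernel \<sigma> x y) = - enn2ereal (riesz_energy p \<nu>0)"
    unfolding p_def using fin_borel_limit by (intro eintegral_riesz) (auto simp: fin_borel_def)
  ultimately show ?thesis unfolding T_lim_def by simp
qed

lemma interaction_le_limit_energy: "r > 0 \<Longrightarrow> (\<integral>x. \<integral>y. trunc_kernel p r (x - y) \<partial>\<nu>0 \<partial>\<nu>0) \<le> limit_energy"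
  unfolding limit_energy_def by (rule interaction_le_riesz_energy[OF fin_borel_limit no_atoms p_pos _ energy_finite])

text \<open>
  The lower bound of \<open>T_eps_lower_bound\<close> converges as \<open>\<epsilon> \<rightarrow> 0\<close> for every truncation radius and every
  cutoff radius. Both are then sent to their limits along one sequence.
\<close>

lemma liminf_inequality:
  assumes \<mu>: "\<And>\<epsilon>. \<epsilon> \<in> {0<..<1} \<Longrightarrow> \<mu> \<epsilon> \<in> Mb"
    and conv: "tight_conv (\<lambda>\<epsilon>. scale_measure (ennreal (scale_factor TYPE('a) \<epsilon>)) (\<mu> \<epsilon>)) \<nu>0"
  shows "T_lim \<sigma> g \<nu>0 \<le> Liminf (at_right 0) (\<lambda>\<epsilon>. T_eps \<sigma> g \<epsilon> (\<mu> \<epsilon>))"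
proof -
  define \<nu> where "\<nu> \<epsilon> = scale_measure (ennreal (scale_factor TYPE('a) \<epsilon>)) (\<mu> \<epsilon>)" for \<epsilon>
  have ev: "\<forall>\<^sub>F \<epsilon>::real in at_right 0. 0 < \<epsilon> \<and> \<epsilon> < 1"
    by (auto simp: eventually_at_right_field intro: exI[of _ 1])
  have fin\<mu>: "fin_borel (\<mu> \<epsilon>)" if "0 < \<epsilon> \<and> \<epsilon> < 1" for \<epsilon>
    using \<mu>[of \<epsilon>] that by (auto simp: Mb_def fin_borel_def)
  interpret tight_family \<nu> \<nu>0
  proof
    show "tight_conv \<nu> \<nu>0" using conv by (simp add: \<nu>_def[abs_def])
    show "\<forall>\<^sub>F \<epsilon> in at_right 0. fin_borel (\<nu> \<epsilon>)"
      using ev by eventually_elim (auto simp: \<nu>_def intro: fin_borel_scale fin\<mu>)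
  qed (rule fin_borel_limit)
  define m where "m = measure \<nu>0 UNIV"
  define c where "c n = (3/2) powr p * enn2real (near_mass TYPE('a) p (1 / real (Suc n))) / packing_density TYPE('a)" for n
  have bound: "ereal ((\<integral>x. g x * cutoff (real n) x \<partial>\<nu>0)) + ereal (- limit_energy - c n * m) \<le> Liminf (at_right 0) (\<lambda>\<epsilon>. T_eps \<sigma> g \<epsilon> (\<mu> \<epsilon>))"
    if n: "real n \<ge> R0" for n
  proof -
    \<comment> \<open>Chosen so that the ball of radius \<open>3r/2\<close> in the short range estimate has radius \<open>1/(n+1)\<close>.\<close>
    define r where "r = 2/3 * (1 / real (Suc n))"
    have "3/2 * (2/3 * t) = t" for t :: real by simp
    then have r: "r > 0" "3/2 * r = 1 / real (Suc n)" by (auto simp only: r_def) simp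
    have near: "near_mass TYPE('a) p (3/2 * r) < \<infinity>"
    proof -
      have "1 / real (Suc n) \<le> 1" by simp
      then have "ball 0 (1 / real (Suc n)) \<subseteq> ball (0::'a) 1" by (rule subset_ball)
      then have "indicator (ball 0 (1 / real (Suc n))) z \<le> (indicator (ball 0 1) z :: ennreal)" for z :: 'a
        by (simp add: indicator_def subset_iff)
      then have "near_mass TYPE('a) p (1 / real (Suc n)) \<le> near_mass TYPE('a) p 1"
        unfolding near_mass_def by (intro nn_integral_mono mult_left_mono) auto
      also have "\<dots> < \<infinity>" by (rule near_mass_finite[OF p_pos p_less])
      finally show ?thesis unfolding r(2) .
    qed
    have c: "near_error TYPE('a) p r = c n" by (simp only: near_error_def c_def r(2))
    let ?a = "\<lambda>M. (\<integral>x. g x * cutoff (real n) x \<partial>M) - (\<integral>x. \<integral>y. trunc_kernel p r (x - y) \<partial>M \<partial>M) - c n * measure M UNIV"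
    have "((\<lambda>\<epsilon>. ?a (\<nu> \<epsilon>)) \<longlongrightarrow> ?a \<nu>0) (at_right 0)"
      by (intro tendsto_diff tendsto_mult tendsto_const mass_conv weak_conv cutoff_mult_vanishes
          continuous_on_mult g_cont cutoff_continuous
          interaction_conv[OF trunc_uniformly_continuous trunc_bound] p_pos r)
    then have "((\<lambda>\<epsilon>. ereal (?a (\<nu> \<epsilon>))) \<longlongrightarrow> ereal (?a \<nu>0)) (at_right 0)" by simp
    then have "Liminf (at_right 0) (\<lambda>\<epsilon>. ereal (?a (\<nu> \<epsilon>))) = ereal (?a \<nu>0)"
      by (intro lim_imp_Liminf) auto
    moreover have "Liminf (at_right 0) (\<lambda>\<epsilon>. ereal (?a (\<nu> \<epsilon>))) \<le> Liminf (at_right 0) (\<lambda>\<epsilon>. T_eps \<sigma> g \<epsilon> (\<mu> \<epsilon>))"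
    proof (rule Liminf_mono)
      show "\<forall>\<^sub>F \<epsilon> in at_right 0. ereal (?a (\<nu> \<epsilon>)) \<le> T_eps \<sigma> g \<epsilon> (\<mu> \<epsilon>)"
        using ev
      proof eventually_elim
        case (elim \<epsilon>)
        have "g x \<ge> 0" if "norm x \<ge> real n" for x using g_pos that n by simp
        from T_eps_lower_bound[OF _ fin\<mu>[OF elim] p_def p_pos near g_cont this] elim
        show ?case by (simp add: \<nu>_def c)
      qed
    qed
    moreover have "(\<integral>x. g x * cutoff (real n) x \<partial>\<nu>0) + (- limit_energy - c n * m) \<le> ?a \<nu>0"
      using interaction_le_limit_energy[OF r(1)] by (simp add: m_def)
    ultimately show ?thesis by (simp add: order_trans[rotated])
  qed
  have "(\<lambda>n. near_mass TYPE('a) p (1 / real (Suc n))) \<longlonglongrightarrow> ennreal 0"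
    using near_mass_tendsto_0[OF p_pos p_less] by simp
  then have "(\<lambda>n. enn2real (near_mass TYPE('a) p (1 / real (Suc n)))) \<longlonglongrightarrow> 0"
    by (rule tendsto_enn2real) simp
  then have "c \<longlonglongrightarrow> (3/2) powr p * 0 / packing_density TYPE('a)"
    unfolding c_def[abs_def] using packing_density_pos[where ?'a='a]
    by (intro tendsto_divide tendsto_mult tendsto_const) auto
  then have "(\<lambda>n. - limit_energy - c n * m) \<longlonglongrightarrow> - limit_energy - 0 * m" by (intro tendsto_intros) simp
  then have "(\<lambda>n. ereal (- limit_energy - c n * m)) \<longlonglongrightarrow> ereal (- limit_energy)" by simp
  then have "(\<lambda>n. ereal ((\<integral>x. g x * cutoff (real n) x \<partial>\<nu>0)) + ereal (- limit_energy - c n * m)) \<longlonglongrightarrow> eintegral \<nu>0 g + ereal (- limit_energy)"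
    by (intro tendsto_add_ereal_general eintegral_cutoff_limit fin_borel_limit g_cont neg_finite) auto
  then have "eintegral \<nu>0 g + ereal (- limit_energy) \<le> Liminf (at_right 0) (\<lambda>\<epsilon>. T_eps \<sigma> g \<epsilon> (\<mu> \<epsilon>))"
  proof (rule LIMSEQ_le_const2)
    obtain N :: nat where "R0 \<le> real N" using real_arch_simple by blast
    then show "\<exists>N. \<forall>n\<ge>N. ereal ((\<integral>x. g x * cutoff (real n) x \<partial>\<nu>0)) + ereal (- limit_energy - c n * m)
        \<le> Liminf (at_right 0) (\<lambda>\<epsilon>. T_eps \<sigma> g \<epsilon> (\<mu> \<epsilon>))"
      by (intro exI[of _ N] allI impI bound) auto
  qed
  then show ?thesis by (simp add: T_lim_eq add.commute)
qed

end

section \<open>Placing packings in the cells of a lattice\<close>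

definition cells :: "real \<Rightarrow> real \<Rightarrow> 'a::euclidean_space set" where
  "cells l R = {z \<in> int_lattice. cell l z \<inter> cball 0 R \<noteq> {}}"

lemma cells_subset:
  fixes l R :: real and z :: "'a::euclidean_space"
  assumes "z \<in> cells l R" "l * DIM('a) \<le> 1" "x \<in> cell l z"
  shows "norm x \<le> R + 1"
proof -
  obtain y where y: "y \<in> cell l z" "norm y \<le> R" using assms(1) by (auto simp: cells_def)
  have "norm (x - y) \<le> 1" using dist_cell[OF assms(3) y(1)] assms(2) by linarith
  then show ?thesis using y(2) norm_triangle_ineq[of "x - y" y] by simp
qed

text \<open>
  These cells are disjoint, have volume \<open>l\<^sup>d\<close>, and lie in the ball of radius \<open>R + 1\<close>, their diameter being at
  most 1.
\<close>

lemma cells_count: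
  fixes l R :: real
  assumes l: "l > 0" "l * DIM('a::euclidean_space) \<le> 1"
  shows "finite (cells l R :: 'a set)"
    and "real (card (cells l R :: 'a set)) * l ^ DIM('a) \<le> measure lborel (cball (0::'a) (R + 1))"
proof -
  have bound: "real (card F) * l ^ DIM('a) \<le> measure lborel (cball (0::'a) (R + 1))"
    if F: "finite F" "F \<subseteq> cells l R" for F :: "'a set"
  proof -
    have "real (card F) * l ^ DIM('a) = (\<Sum>z\<in>F. measure lborel (cell l z))"
      using l by (simp add: measure_cell)
    also have "\<dots> = measure lborel (\<Union>z\<in>F. cell l z)"
    proof (rule measure_finite_Union[symmetric])
      show "disjoint_family_on (cell l) F"
        unfolding disjoint_family_on_def
      proof (intro ballI impI equals0I)
        fix z w x assume "z \<in> F" "w \<in> F" "z \<noteq> w" "x \<in> cell l z \<inter> cell l w"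
        moreover then have "z \<in> int_lattice" "w \<in> int_lattice" using F by (auto simp: cells_def)
        ultimately show False using cell_unique[OF l(1)] by blast
      qed
      show "emeasure lborel (cell l z) \<noteq> \<infinity>" for z :: 'a by (simp add: emeasure_cell[OF l(1)])
    qed (use F in auto)
    also have "\<dots> \<le> measure lborel (cball (0::'a) (R + 1))"
    proof (rule measure_mono_fmeasurable)
      show "(\<Union>z\<in>F. cell l z) \<subseteq> cball 0 (R + 1)"
        using F cells_subset[OF _ l(2)] by auto
      show "cball (0::'a) (R + 1) \<in> fmeasurable lborel"
        by (rule fmeasurableI) (simp, rule emeasure_lborel_cball_finite)
    qed (use F in \<open>auto intro: sets.finite_UN\<close>)
    finally show ?thesis .
  qed
  obtain K :: nat where K: "measure lborel (cball (0::'a) (R + 1)) / l ^ DIM('a) \<le> K"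
    using real_arch_simple by blast
  have "card F \<le> K" if "finite F" "F \<subseteq> cells l R" for F :: "'a set"
  proof -
    have "real (card F) \<le> measure lborel (cball (0::'a) (R + 1)) / l ^ DIM('a)"
      using bound[OF that] l by (simp add: pos_le_divide_eq)
    then show ?thesis using K by linarith
  qed
  then show fin: "finite (cells l R :: 'a set)"
    using finite_if_finite_subsets_card_bdd[of "cells l R" K] by blast
  show "real (card (cells l R :: 'a set)) * l ^ DIM('a) \<le> measure lborel (cball (0::'a) (R + 1))"
    by (rule bound[OF fin]) simp
qed

lemma cells_partition:
  fixes l R :: real and x :: "'a::euclidean_space"
  assumes l: "l > 0" and fin: "finite (cells l R :: 'a set)" and x: "norm x \<le> R"
  shows "(\<Sum>z\<in>cells l R. indicator (cell l z) x) = (1::real)"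
proof -
  obtain w where w: "w \<in> int_lattice" "x \<in> cell l w" using cell_cover[OF l] by blast
  have wc: "w \<in> cells l R" using w x by (auto simp: cells_def)
  have "(\<Sum>z\<in>cells l R. indicator (cell l z) x) = (\<Sum>z\<in>cells l R. if z = w then 1 else (0::real))"
  proof (rule sum.cong)
    fix z :: 'a assume "z \<in> cells l R"
    then have "x \<in> cell l z \<longleftrightarrow> z = w"
      using cell_unique[OF l _ w(1) _ w(2)] w(2) by (auto simp: cells_def)
    then show "indicator (cell l z) x = (if z = w then 1 else (0::real))" by (simp add: indicator_def)
  qed simp
  also have "\<dots> = 1" using fin wc by simp
  finally show ?thesis .
qed

text \<open>
  Two points from different cells: their cell indices differ by at least 1 in some coordinate, which moves
  that coordinate by at least \<open>L\<close>, and the positions inside the cells differ by less than \<open>L - 2\<close>.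
\<close>

lemma tiled_packing_separated:
  fixes Y :: "'a::euclidean_space set"
  assumes Y: "Y \<in> Ad" "Y \<subseteq> cell (L - 2) 0" and L: "L > 2" and e: "\<epsilon> > 0"
    and z: "z \<in> int_lattice" "w \<in> int_lattice" and y: "y \<in> Y" "y' \<in> Y" and ne: "(z, y) \<noteq> (w, y')"
  shows "norm (\<epsilon> *\<^sub>R (L *\<^sub>R z + y) - \<epsilon> *\<^sub>R (L *\<^sub>R w + y')) \<ge> 2 * \<epsilon>"
proof -
  have "norm ((L *\<^sub>R z + y) - (L *\<^sub>R w + y')) \<ge> 2"
  proof (cases "z = w")
    case True
    then show ?thesis using Y(1) y ne by (auto simp: Ad_def)
  next
    case False
    then obtain b where b: "b \<in> Basis" "z \<bullet> b \<noteq> w \<bullet> b" using euclidean_eqI by blast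
    have "z \<bullet> b - w \<bullet> b \<in> \<int>" using z b by (auto simp: int_lattice_def)
    then have "\<bar>z \<bullet> b - w \<bullet> b\<bar> \<ge> 1" using b(2) by (intro Ints_nonzero_abs_ge1) auto
    then have 1: "\<bar>L * (z \<bullet> b - w \<bullet> b)\<bar> \<ge> L" using L by (simp add: abs_mult)
    have "y \<in> cell (L - 2) 0" "y' \<in> cell (L - 2) 0" using y Y(2) by auto
    then have "0 \<le> y \<bullet> b" "y \<bullet> b < L - 2" "0 \<le> y' \<bullet> b" "y' \<bullet> b < L - 2"
      using b(1) by (auto simp: cell_def)
    then have 2: "\<bar>y \<bullet> b - y' \<bullet> b\<bar> \<le> L - 2" by linarith
    have "((L *\<^sub>R z + y) - (L *\<^sub>R w + y')) \<bullet> b = L * (z \<bullet> b - w \<bullet> b) + (y \<bullet> b - y' \<bullet> b)"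
      by (simp add: inner_add_left inner_diff_left algebra_simps)
    then have "\<bar>((L *\<^sub>R z + y) - (L *\<^sub>R w + y')) \<bullet> b\<bar> \<ge> 2" using 1 2 by linarith
    then show ?thesis using Basis_le_norm[OF b(1)] order_trans by blast
  qed
  then have "\<epsilon> * norm ((L *\<^sub>R z + y) - (L *\<^sub>R w + y')) \<ge> \<epsilon> * 2" using e by (intro mult_left_mono) auto
  then show ?thesis using e by (simp add: scaleR_diff_right[symmetric] mult.commute)
qed

lemma tiled_point_in_cell:
  fixes y :: "'a::euclidean_space"
  assumes "y \<in> cell (L - 2) 0" "\<epsilon> > 0"
  shows "\<epsilon> *\<^sub>R (L *\<^sub>R z + y) \<in> cell (L * \<epsilon>) z"
  unfolding cell_def
proof (intro CollectI ballI)
  fix b :: 'a assume b: "b \<in> Basis"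
  then have "0 \<le> y \<bullet> b" "y \<bullet> b < L" using assms(1) by (auto simp: cell_def)
  then have "\<epsilon> * (L * (z \<bullet> b)) \<le> \<epsilon> * (L * (z \<bullet> b) + y \<bullet> b)" "\<epsilon> * (L * (z \<bullet> b) + y \<bullet> b) < \<epsilon> * (L * (z \<bullet> b) + L)"
    using assms(2) by auto
  then show "L * \<epsilon> * (z \<bullet> b) \<le> \<epsilon> *\<^sub>R (L *\<^sub>R z + y) \<bullet> b \<and> \<epsilon> *\<^sub>R (L *\<^sub>R z + y) \<bullet> b < L * \<epsilon> * (z \<bullet> b + 1)"
    by (simp add: inner_add_left algebra_simps)
qed

text \<open>
  A cell of volume \<open>A\<close> should receive mass \<open>a\<close> in points of mass \<open>s\<close>, but only \<open>m\<close> positions are available.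
  The deficit comes from rounding, which costs less than \<open>s\<close>, or from a lack of positions, which costs at
  most \<open>A - s m\<close>.
\<close>

lemma rounded_count:
  fixes s a A \<delta> :: real and m :: nat
  assumes s: "s > 0" and a: "0 \<le> a" "a \<le> A" and "s \<le> \<delta> * A" and "(1 - \<delta>) * A \<le> s * m"
  defines "n \<equiv> min m (nat \<lfloor>a / s\<rfloor>)"
  shows "s * n \<le> a" "a - s * n \<le> \<delta> * A"
proof -
  have fl: "real (nat \<lfloor>a / s\<rfloor>) \<le> a / s" "a / s < real (nat \<lfloor>a / s\<rfloor>) + 1"
    using a s by (auto simp: of_nat_nat)
  have "real n \<le> a / s" using fl unfolding n_def by linarith
  then show "s * n \<le> a" using s by (simp add: pos_le_divide_eq mult.commute)
  show "a - s * n \<le> \<delta> * A"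
  proof (cases "nat \<lfloor>a / s\<rfloor> \<le> m")
    case True
    then have "a / s < real n + 1" using fl by (simp add: n_def)
    then have "a < (real n + 1) * s" using s by (simp add: pos_divide_less_eq)
    then show ?thesis using assms(4) by (simp add: algebra_simps)
  next
    case False
    then have "n = m" by (simp add: n_def)
    then show ?thesis using assms(5) a by (simp add: algebra_simps)
  qed
qed

text \<open>
  Replace \<open>\<phi>\<close> by its value at the reference point \<open>c\<close>, both in the sum and in the integral; each replacement
  costs the oscillation times the mass of the cell, and what remains is \<open>\<phi> c\<close> times the difference of the
  masses.
\<close>

lemma cell_error:
  fixes \<phi> \<rho> :: "'a::euclidean_space \<Rightarrow> real" and q :: "'b \<Rightarrow> 'a" and s B k \<eta> :: real
  assumes int: "integrable lborel (\<lambda>x. indicator A x * \<rho> x)" "integrable lborel (\<lambda>x. indicator A x * (\<phi> x * \<rho> x))"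
    and \<rho>: "\<And>x. 0 \<le> \<rho> x" and A: "c \<in> A" "\<And>y. y \<in> S \<Longrightarrow> q y \<in> A"
    and osc: "\<And>x y. x \<in> A \<Longrightarrow> y \<in> A \<Longrightarrow> \<bar>\<phi> x - \<phi> y\<bar> \<le> \<eta>" and B: "\<bar>\<phi> c\<bar> \<le> B"
    and s: "s \<ge> 0" "s * card S \<le> (\<integral>x. indicator A x * \<rho> x \<partial>lborel)"
      "(\<integral>x. indicator A x * \<rho> x \<partial>lborel) - s * card S \<le> k"
  shows "\<bar>s * (\<Sum>y\<in>S. \<phi> (q y)) - (\<integral>x. indicator A x * (\<phi> x * \<rho> x) \<partial>lborel)\<bar>
    \<le> B * k + 2 * \<eta> * (\<integral>x. indicator A x * \<rho> x \<partial>lborel)"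
proof -
  let ?a = "\<integral>x. indicator A x * \<rho> x \<partial>lborel"
  have \<eta>: "\<eta> \<ge> 0" using osc[OF A(1) A(1)] by simp
  have "\<bar>s * (\<Sum>y\<in>S. \<phi> (q y)) - s * (card S * \<phi> c)\<bar> = s * \<bar>\<Sum>y\<in>S. \<phi> (q y) - \<phi> c\<bar>"
    using s by (simp add: sum_subtractf right_diff_distrib[symmetric] abs_mult)
  also have "\<dots> \<le> s * (\<Sum>y\<in>S. \<bar>\<phi> (q y) - \<phi> c\<bar>)"
    using s by (intro mult_left_mono sum_abs) auto
  also have "\<dots> \<le> s * (\<Sum>y\<in>S. \<eta>)"
    using s osc A by (intro mult_left_mono sum_mono) auto
  also have "\<dots> \<le> \<eta> * ?a" using mult_left_mono[OF s(2) \<eta>] by (simp add: mult_ac)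
  finally have 1: "\<bar>s * (\<Sum>y\<in>S. \<phi> (q y)) - s * (card S * \<phi> c)\<bar> \<le> \<eta> * ?a" .
  have "\<bar>\<phi> c * (s * card S - ?a)\<bar> = \<bar>\<phi> c\<bar> * (?a - s * card S)"
    using s(2) by (simp add: abs_mult)
  also have "\<dots> \<le> B * k" using B s by (intro mult_mono) auto
  finally have 2: "\<bar>\<phi> c * (s * card S - ?a)\<bar> \<le> B * k" .
  have "\<bar>\<phi> c * ?a - (\<integral>x. indicator A x * (\<phi> x * \<rho> x) \<partial>lborel)\<bar>
      = \<bar>\<integral>x. \<phi> c * (indicator A x * \<rho> x) - indicator A x * (\<phi> x * \<rho> x) \<partial>lborel\<bar>"
    using int by simp
  also have "\<dots> \<le> (\<integral>x. \<bar>\<phi> c * (indicator A x * \<rho> x) - indicator A x * (\<phi> x * \<rho> x)\<bar> \<partial>lborel)"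
    by (rule integral_abs_bound)
  also have "\<dots> \<le> (\<integral>x. \<eta> * (indicator A x * \<rho> x) \<partial>lborel)"
  proof (rule integral_mono)
    fix x
    show "\<bar>\<phi> c * (indicator A x * \<rho> x) - indicator A x * (\<phi> x * \<rho> x)\<bar> \<le> \<eta> * (indicator A x * \<rho> x)"
    proof (cases "x \<in> A")
      case True
      have "\<bar>\<phi> c * \<rho> x - \<phi> x * \<rho> x\<bar> = \<bar>\<phi> c - \<phi> x\<bar> * \<rho> x"
        using \<rho>[of x] by (simp add: left_diff_distrib[symmetric] abs_mult)
      then show ?thesis using True osc[OF A(1) True] \<rho>[of x] by (simp add: mult_right_mono)
    qed simp
  qed (use int in auto)
  also have "\<dots> = \<eta> * ?a" by simp
  finally have 3: "\<bar>\<phi> c * ?a - (\<integral>x. indicator A x * (\<phi> x * \<rho> x) \<partial>lborel)\<bar> \<le> \<eta> * ?a" .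
  have "\<phi> c * (s * card S - ?a) = s * (card S * \<phi> c) - \<phi> c * ?a" by (simp add: algebra_simps)
  then show ?thesis using 1 2 3 by linarith
qed

text \<open>
  Sums over the points, with weight \<open>s\<close>, reproduce integrals against \<open>\<rho>\<close> up to an error that is linear in
  the size \<open>B\<close> of the test function and in its oscillation \<open>\<eta>\<close> at scale \<open>h\<close>. Quantifying over all test functions at once
  lets a single configuration serve for the functions vanishing at infinity, for the total mass, and for \<open>g\<close>.
\<close>

definition approximates ::
  "('a::euclidean_space \<Rightarrow> real) \<Rightarrow> real \<Rightarrow> real \<Rightarrow> real \<Rightarrow> real \<Rightarrow> nat \<Rightarrow> (nat \<Rightarrow> 'a) \<Rightarrow> bool" where
  "approximates \<rho> R \<delta> h s N x \<longleftrightarrow>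
     (\<forall>\<phi> B \<eta>. \<phi> \<in> borel_measurable borel \<longrightarrow> (\<forall>u. norm u \<le> R + 1 \<longrightarrow> \<bar>\<phi> u\<bar> \<le> B) \<longrightarrow>
        (\<forall>u v. norm u \<le> R + 1 \<longrightarrow> norm v \<le> R + 1 \<longrightarrow> norm (u - v) \<le> h \<longrightarrow> \<bar>\<phi> u - \<phi> v\<bar> \<le> \<eta>) \<longrightarrow>
        \<bar>s * (\<Sum>i=1..N. \<phi> (x i)) - (\<integral>u. \<phi> u * \<rho> u \<partial>lborel)\<bar> \<le> B * \<delta> + 2 * \<eta> * (\<integral>u. \<rho> u \<partial>lborel))"

text \<open>
  The hypotheses on \<open>s\<close> say that a point weighs little compared with a cell of side \<open>L \<epsilon>\<close>, and that the
  packing \<open>Y\<close>, shrunk into the cell, has almost the mass of Lebesgue measure. As \<open>\<rho> \<le> 1\<close>, each cell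
  can then receive its share of \<open>\<rho>\<close> up to a small fraction of its volume, and the volumes of the cells
  involved add up to at most that of a ball.
\<close>

lemma recovery_at_scale:
  fixes \<rho> :: "'a::euclidean_space \<Rightarrow> real" and \<epsilon> L :: real
  defines "s \<equiv> scale_factor TYPE('a) \<epsilon>" and "l \<equiv> L * \<epsilon>"
  assumes int: "integrable lborel \<rho>" and \<rho>: "\<And>x. 0 \<le> \<rho> x" "\<And>x. \<rho> x \<le> 1"
    and supp: "\<And>x. norm x > R \<Longrightarrow> \<rho> x = 0" and R: "R \<ge> 0" and \<delta>: "\<delta> > 0" 
    and Y: "finite Y" "Y \<in> Ad" "Y \<subseteq> cell (L - 2) (0::'a)" and L: "L > 2"
    and e: "\<epsilon> > 0" and l: "l * DIM('a) \<le> 1" "l * DIM('a) \<le> h"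
    and s1: "s \<le> \<delta> * l ^ DIM('a)" and s2: "(1 - \<delta>) * l ^ DIM('a) \<le> s * card Y"
  shows "\<exists>N x. separated \<epsilon> N x \<and> approximates \<rho> R (\<delta> * measure lborel (cball (0::'a) (R + 1))) h s N x"
proof -
  have s: "s > 0" unfolding s_def by (rule scale_factor_pos[OF e])
  have lpos: "l > 0" unfolding l_def using L e by simp
  let ?J = "cells l R :: 'a set"
  note J = cells_count[OF lpos l(1), of R]
  have [measurable]: "\<rho> \<in> borel_measurable borel" using int by simp
  define a where "a z = (\<integral>x. indicator (cell l z) x * \<rho> x \<partial>lborel)" for z :: 'a
  have inta: "integrable lborel (\<lambda>x. indicator (cell l z) x * \<rho> x)" for z :: 'a
    by (rule Bochner_Integration.integrable_bound[OF int]) (auto simp: indicator_def)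
  have a0: "0 \<le> a z" for z
    unfolding a_def by (intro integral_nonneg_AE AE_I2) (simp add: \<rho>)
  have a1: "a z \<le> l ^ DIM('a)" for z
  proof -
    have "a z \<le> (\<integral>x. indicator (cell l z) x \<partial>lborel)"
      unfolding a_def
    proof (rule integral_mono[OF inta])
      show "integrable lborel (indicator (cell l z) :: 'a \<Rightarrow> real)"
        using emeasure_cell[OF lpos, of z] by (intro integrable_real_indicator) auto
      show "indicator (cell l z) x * \<rho> x \<le> indicator (cell l z) x" for x
        using \<rho>(2)[of x] by (simp add: indicator_def)
    qed
    also have "\<dots> = l ^ DIM('a)" by (simp add: measure_cell[OF lpos])
    finally show ?thesis .
  qed
  define n where "n z = min (card Y) (nat \<lfloor>a z / s\<rfloor>)" for z
  have n: "s * n z \<le> a z" "a z - s * n z \<le> \<delta> * l ^ DIM('a)" for z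
    unfolding n_def using rounded_count[OF s a0 a1 s1 s2] by auto
  have "\<forall>z. \<exists>T. T \<subseteq> Y \<and> card T = n z"
    using Y(1) by (metis n_def min.cobounded1 obtain_subset_with_card_n)
  then obtain S where S: "\<And>z. S z \<subseteq> Y" "\<And>z. card (S z) = n z" by metis
  have finS: "finite (S z)" for z using S(1) Y(1) by (rule finite_subset)
  define D where "D = (SIGMA z:?J. S z)"
  define q :: "'a \<times> 'a \<Rightarrow> 'a" where "q = (\<lambda>(z, y). \<epsilon> *\<^sub>R (L *\<^sub>R z + y))"
  have finD: "finite D" unfolding D_def using J(1) finS by auto
  obtain b where b: "bij_betw b {1..card D} D" using ex_bij_betw_nat_finite_1[OF finD] by blast
  define x where "x = q \<circ> b"
  have sep: "separated \<epsilon> (card D) x"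
    unfolding separated_def
  proof (intro ballI impI)
    fix i j assume ij: "i \<in> {1..card D}" "j \<in> {1..card D}" "i \<noteq> j"
    obtain z y where zy: "b i = (z, y)" by (cases "b i")
    obtain w v where wv: "b j = (w, v)" by (cases "b j")
    have inD: "(z, y) \<in> D" "(w, v) \<in> D"
      using bij_betwE[OF b] ij(1,2) unfolding zy[symmetric] wv[symmetric] by blast+
    have "(z, y) \<noteq> (w, v)"
      using inj_onD[OF bij_betw_imp_inj_on[OF b] _ ij(1,2)] ij(3) zy wv by metis
    moreover have "z \<in> int_lattice" "w \<in> int_lattice"
      using inD by (simp_all add: D_def cells_def)
    moreover have "y \<in> Y" "v \<in> Y"
      using inD S(1)[of z] S(1)[of w] unfolding D_def by blast+
    ultimately have "z \<in> int_lattice" "w \<in> int_lattice" "y \<in> Y" "v \<in> Y" "(z, y) \<noteq> (w, v)"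
      by simp_all
    from tiled_packing_separated[OF Y(2,3) L e this]
    show "2 * \<epsilon> \<le> norm (x i - x j)" by (simp add: x_def q_def zy wv)
  qed
  have "approximates \<rho> R (\<delta> * measure lborel (cball (0::'a) (R + 1))) h s (card D) x"
    unfolding approximates_def
  proof (intro allI impI)
    fix \<phi> :: "'a \<Rightarrow> real" and B \<eta>
    assume [measurable]: "\<phi> \<in> borel_measurable borel"
      and B: "\<forall>u. norm u \<le> R + 1 \<longrightarrow> \<bar>\<phi> u\<bar> \<le> B"
      and osc: "\<forall>u v. norm u \<le> R + 1 \<longrightarrow> norm v \<le> R + 1 \<longrightarrow> norm (u - v) \<le> h \<longrightarrow> \<bar>\<phi> u - \<phi> v\<bar> \<le> \<eta>"
    have B0: "B \<ge> 0"
    proof -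
      have "\<bar>\<phi> 0\<bar> \<le> B" using B R by simp
      then show ?thesis by linarith
    qed
    let ?P = "\<lambda>z x. indicator (cell l z) x * (\<phi> x * \<rho> x) :: real"
    have bd: "\<bar>\<phi> u * \<rho> u\<bar> \<le> B * \<rho> u" for u
    proof (cases "norm u \<le> R")
      case True
      then have "\<bar>\<phi> u\<bar> \<le> B" using B by simp
      then show ?thesis using \<rho>[of u] by (simp add: abs_mult mult_right_mono)
    qed (simp add: supp)
    have intP: "integrable lborel (?P z)" for z :: 'a
    proof (rule Bochner_Integration.integrable_bound[of _ "\<lambda>u. B * \<rho> u"])
      show "AE u in lborel. norm (?P z u) \<le> norm (B * \<rho> u)"
      proof (rule AE_I2)
        fix u
        have "\<bar>?P z u\<bar> \<le> \<bar>\<phi> u * \<rho> u\<bar>" by (simp add: indicator_def)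
        also have "\<dots> \<le> B * \<rho> u" by (rule bd)
        finally show "norm (?P z u) \<le> norm (B * \<rho> u)" by simp
      qed
    qed (use int in auto)
    have split: "(\<Sum>z\<in>?J. indicator (cell l z) u * f) = f" if "norm u > R \<Longrightarrow> f = 0" for u :: 'a and f :: real
    proof (cases "norm u \<le> R")
      case True
      then show ?thesis
        unfolding sum_distrib_right[symmetric] using cells_partition[OF lpos J(1) True] by simp
    next
      case False
      then have "f = 0" using that by simp
      then show ?thesis by simp
    qed
    have sumP: "(\<integral>u. \<phi> u * \<rho> u \<partial>lborel) = (\<Sum>z\<in>?J. \<integral>u. ?P z u \<partial>lborel)"
    proof -
      have "(\<integral>u. \<phi> u * \<rho> u \<partial>lborel) = (\<integral>u. (\<Sum>z\<in>?J. ?P z u) \<partial>lborel)"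
        by (intro Bochner_Integration.integral_cong refl split[symmetric]) (simp add: supp)
      also have "\<dots> = (\<Sum>z\<in>?J. \<integral>u. ?P z u \<partial>lborel)"
        by (rule Bochner_Integration.integral_sum) (rule intP)
      finally show ?thesis .
    qed
    have suma: "(\<integral>u. \<rho> u \<partial>lborel) = (\<Sum>z\<in>?J. a z)"
    proof -
      have "(\<integral>u. \<rho> u \<partial>lborel) = (\<integral>u. (\<Sum>z\<in>?J. indicator (cell l z) u * \<rho> u) \<partial>lborel)"
        by (intro Bochner_Integration.integral_cong refl split[symmetric]) (simp add: supp)
      also have "\<dots> = (\<Sum>z\<in>?J. a z)"
        unfolding a_def by (rule Bochner_Integration.integral_sum) (rule inta)
      finally show ?thesis .
    qed
    have "(\<Sum>i=1..card D. \<phi> (x i)) = (\<Sum>d\<in>D. \<phi> (q d))"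
      unfolding x_def comp_def by (rule sum.reindex_bij_betw[OF b])
    also have "\<dots> = (\<Sum>z\<in>?J. \<Sum>y\<in>S z. \<phi> (q (z, y)))"
      unfolding D_def using J(1) finS by (subst sum.Sigma) auto
    finally have sumx: "(\<Sum>i=1..card D. \<phi> (x i)) = (\<Sum>z\<in>?J. \<Sum>y\<in>S z. \<phi> (q (z, y)))" .
    have "\<bar>s * (\<Sum>i=1..card D. \<phi> (x i)) - (\<integral>u. \<phi> u * \<rho> u \<partial>lborel)\<bar>
        = \<bar>\<Sum>z\<in>?J. s * (\<Sum>y\<in>S z. \<phi> (q (z, y))) - (\<integral>u. ?P z u \<partial>lborel)\<bar>"
      unfolding sumx sumP sum_subtractf sum_distrib_left ..
    also have "\<dots> \<le> (\<Sum>z\<in>?J. \<bar>s * (\<Sum>y\<in>S z. \<phi> (q (z, y))) - (\<integral>u. ?P z u \<partial>lborel)\<bar>)"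
      by (rule sum_abs)
    also have "\<dots> \<le> (\<Sum>z\<in>?J. B * (\<delta> * l ^ DIM('a)) + 2 * \<eta> * a z)"
    proof (rule sum_mono)
      fix z :: 'a assume z: "z \<in> ?J"
      show "\<bar>s * (\<Sum>y\<in>S z. \<phi> (q (z, y))) - (\<integral>u. ?P z u \<partial>lborel)\<bar> \<le> B * (\<delta> * l ^ DIM('a)) + 2 * \<eta> * a z"
        unfolding a_def
      proof (rule cell_error[where c = "l *\<^sub>R z"])
        show c: "l *\<^sub>R z \<in> cell l z" using lpos by (simp add: cell_def algebra_simps)
        show "q (z, y) \<in> cell l z" if "y \<in> S z" for y
          using tiled_point_in_cell[of y L \<epsilon> z] that S(1) Y(3) e by (auto simp: q_def l_def)
        show "\<bar>\<phi> u - \<phi> v\<bar> \<le> \<eta>" if uv: "u \<in> cell l z" "v \<in> cell l z" for u v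
          using osc cells_subset[OF z l(1)] uv dist_cell[OF uv] l(2) by (meson order_trans)
        show "\<bar>\<phi> (l *\<^sub>R z)\<bar> \<le> B" using B cells_subset[OF z l(1) c] by blast
      qed (use s n[of z] inta intP \<rho> in \<open>simp_all add: S(2) a_def\<close>)
    qed
    also have "\<dots> = B * (\<delta> * (real (card ?J) * l ^ DIM('a))) + 2 * \<eta> * (\<integral>u. \<rho> u \<partial>lborel)"
      by (simp add: sum.distrib suma sum_distrib_left)
    also have "\<dots> \<le> B * (\<delta> * measure lborel (cball (0::'a) (R + 1))) + 2 * \<eta> * (\<integral>u. \<rho> u \<partial>lborel)"
      using J(2) B0 \<delta> by (intro add_right_mono mult_left_mono) auto
    finally show "\<bar>s * (\<Sum>i=1..card D. \<phi> (x i)) - (\<integral>u. \<phi> u * \<rho> u \<partial>lborel)\<bar>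
        \<le> B * (\<delta> * measure lborel (cball (0::'a) (R + 1))) + 2 * \<eta> * (\<integral>u. \<rho> u \<partial>lborel)" .
  qed
  with sep show ?thesis by blast
qed

text \<open>
  The side \<open>L\<close> of the packing is fixed by \<open>\<delta>\<close>; then \<open>\<epsilon>\<close> is taken so small that the cells of side \<open>L \<epsilon>\<close>
  have diameter below \<open>h\<close> and 1.
\<close>

lemma recovery_configurations:
  fixes \<rho> :: "'a::euclidean_space \<Rightarrow> real" and R \<delta> h :: real
  assumes int: "integrable lborel \<rho>" and \<rho>: "\<And>x. 0 \<le> \<rho> x" "\<And>x. \<rho> x \<le> 1"
    and supp: "\<And>x. norm x > R \<Longrightarrow> \<rho> x = 0" and R: "R \<ge> 0" and \<delta>: "\<delta> > 0" and h: "h > 0"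
  shows "\<forall>\<^sub>F \<epsilon> in at_right 0. \<exists>N x. separated \<epsilon> N x \<and> approximates \<rho> R \<delta> h (scale_factor TYPE('a) \<epsilon>) N x"
proof -
  define V where "V = measure lborel (cball (0::'a) (R + 1))"
  have V: "V > 0" unfolding V_def using R by (simp add: content_cball_pos)
  define C where "C = packing_density TYPE('a)"
  have C: "C > 0" unfolding C_def by (rule packing_density_pos)
  \<comment> \<open>The total error is \<open>\<delta>'\<close> times the volume of the cells, which is at most \<open>V\<close>.\<close>
  define \<delta>' where "\<delta>' = \<delta> / V"
  have \<delta>': "\<delta>' > 0" using \<delta> V by (simp add: \<delta>'_def)
  have w: "omega TYPE('a) > 0" by (rule omega_pos)
  obtain L and Y :: "'a set" where L: "L > max 1 (omega TYPE('a) / (C * \<delta>'))" "L > 2"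
    and Y: "finite Y" "Y \<in> Ad" "Y \<subseteq> cell (L - 2) 0"
    and cY: "real (card Y) * omega TYPE('a) \<ge> (1 - \<delta>') * C * L ^ DIM('a)"
    using dense_packing[OF \<delta>', where ?'a = 'a] unfolding C_def by blast
  \<comment> \<open>This says that one point weighs at most the fraction \<open>\<delta>'\<close> of a cell.\<close>
  have wL: "omega TYPE('a) / C \<le> \<delta>' * L ^ DIM('a)"
  proof -
    have "omega TYPE('a) / (C * \<delta>') \<le> L" using L by simp
    also have "\<dots> \<le> L ^ DIM('a)" using L by (intro self_le_power) auto
    finally show ?thesis using C \<delta>' by (simp add: field_simps)
  qed
  define e0 where "e0 = min 1 h / (L * DIM('a))"
  have e0: "e0 > 0" using h L by (simp add: e0_def)
  have "\<forall>\<^sub>F \<epsilon>::real in at_right 0. 0 < \<epsilon> \<and> \<epsilon> < e0"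
    using e0 by (auto simp: eventually_at_right_field)
  then show ?thesis
  proof eventually_elim
    case (elim \<epsilon>)
    let ?s = "scale_factor TYPE('a) \<epsilon>"
    have "L * \<epsilon> * DIM('a) < min 1 h"
      using elim L by (simp add: e0_def pos_less_divide_eq mult_ac)
    then have l: "L * \<epsilon> * DIM('a) \<le> 1" "L * \<epsilon> * DIM('a) \<le> h" by auto
    have seq: "?s = omega TYPE('a) / C * \<epsilon> ^ DIM('a)" by (simp add: scale_factor_def C_def)
    have s1: "?s \<le> \<delta>' * (L * \<epsilon>) ^ DIM('a)"
      unfolding seq power_mult_distrib using mult_right_mono[OF wL, of "\<epsilon> ^ DIM('a)"] elim
      by (simp add: mult_ac)
    have "(1 - \<delta>') * L ^ DIM('a) \<le> omega TYPE('a) / C * card Y"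
      using cY C by (simp add: field_simps)
    then have s2: "(1 - \<delta>') * (L * \<epsilon>) ^ DIM('a) \<le> ?s * card Y"
      unfolding seq power_mult_distrib using mult_right_mono[of _ _ "\<epsilon> ^ DIM('a)"] elim
      by (fastforce simp: mult_ac)
    have "\<delta>' * V = \<delta>" using V by (simp add: \<delta>'_def)
    then show ?case
      using recovery_at_scale[OF int \<rho> supp R \<delta>' Y L(2) conjunct1[OF elim] l s1 s2]
      by (simp add: V_def)
  qed
qed

section \<open>The diagonal sequence and the upper bound\<close>

lemma eventually_at_right_0_iff:
  "eventually P (at_right (0::real)) \<longleftrightarrow> (\<exists>e>0. \<forall>\<epsilon>. 0 < \<epsilon> \<and> \<epsilon> < e \<longrightarrow> P \<epsilon>)"
  by (auto simp: eventually_at_right_field)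

text \<open>
  Take for \<open>k \<epsilon>\<close> the largest \<open>n \<le> 1/\<epsilon>\<close> for which \<open>\<epsilon>\<close> lies in the range where \<open>P n\<close> is known; the
  bound \<open>1/\<epsilon>\<close> serves only to make a largest one exist.
\<close>

lemma diagonal_choice:
  fixes P :: "nat \<Rightarrow> real \<Rightarrow> bool"
  assumes "\<And>n. eventually (P n) (at_right 0)"
  obtains k where "filterlim k at_top (at_right 0)" "\<forall>\<^sub>F \<epsilon> in at_right 0. P (k \<epsilon>) \<epsilon>"
proof -
  have "\<forall>n. \<exists>e>0. \<forall>\<epsilon>. 0 < \<epsilon> \<and> \<epsilon> < e \<longrightarrow> P n \<epsilon>"
    using assms unfolding eventually_at_right_0_iff by blast
  then obtain e where e: "\<And>n. e n > 0" "\<And>n \<epsilon>. 0 < \<epsilon> \<Longrightarrow> \<epsilon> < e n \<Longrightarrow> P n \<epsilon>" by metis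
  define A where "A \<epsilon> = {n::nat. real n \<le> 1 / \<epsilon> \<and> \<epsilon> < e n}" for \<epsilon>
  have fin: "finite (A \<epsilon>)" for \<epsilon>
  proof -
    have "A \<epsilon> \<subseteq> {..nat \<lfloor>1 / \<epsilon>\<rfloor>}" by (auto simp: A_def le_nat_floor)
    then show ?thesis by (rule finite_subset) simp
  qed
  define k where "k \<epsilon> = Max (A \<epsilon>)" for \<epsilon>
  have lim: "filterlim k at_top (at_right 0)"
    unfolding filterlim_at_top
  proof
    fix Z :: nat
    show "\<forall>\<^sub>F \<epsilon> in at_right 0. Z \<le> k \<epsilon>"
      unfolding eventually_at_right_0_iff
    proof (intro exI conjI allI impI)
      show "0 < min (e Z) (1 / (real Z + 1))" using e by simp
      fix \<epsilon> assume \<epsilon>: "0 < \<epsilon> \<and> \<epsilon> < min (e Z) (1 / (real Z + 1))"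
      then have "\<epsilon> * (real Z + 1) < 1" by (simp add: pos_less_divide_eq)
      then have "real Z * \<epsilon> \<le> 1" using \<epsilon> by (simp add: algebra_simps)
      then have "Z \<in> A \<epsilon>" using \<epsilon> by (simp add: A_def pos_le_divide_eq)
      then show "Z \<le> k \<epsilon>" unfolding k_def by (rule Max_ge[OF fin])
    qed
  qed
  have "P (k \<epsilon>) \<epsilon>" if \<epsilon>: "0 < \<epsilon>" "\<epsilon> < e 0" for \<epsilon>
  proof -
    have "A \<epsilon> \<noteq> {}" using \<epsilon> by (auto simp: A_def intro!: exI[of _ 0])
    then have "k \<epsilon> \<in> A \<epsilon>" unfolding k_def by (rule Max_in[OF fin])
    then show ?thesis using \<epsilon> e(2) by (simp add: A_def)
  qed
  then have "\<forall>\<^sub>F \<epsilon> in at_right 0. P (k \<epsilon>) \<epsilon>"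
    unfolding eventually_at_right_0_iff using e(1) by blast
  with lim show thesis by (rule that)
qed

text \<open>
  Distinct points are off the diagonal, where the kernel dominates its truncation. The double integral of
  the truncated kernel also counts the diagonal, with value \<open>r\<^sup>-\<^sup>p\<close> at each of the \<open>N\<close> points.
\<close>

lemma energy_lower_bound:
  fixes x :: "nat \<Rightarrow> 'a::euclidean_space" and p r \<epsilon> s :: real
  assumes e: "\<epsilon> > 0" and p: "p > 0" and sep: "separated \<epsilon> N x" and r: "r > 0" and s: "s \<ge> 0"
  shows "s\<^sup>2 * (\<Sum>i=1..N. \<Sum>j\<in>{1..N} - {i}. norm (x i - x j) powr (-p))
    \<ge> (\<integral>u. \<integral>v. trunc_kernel p r (u - v) \<partial>empirical s N x \<partial>empirical s N x)
      - s * r powr (-p) * measure (empirical s N x) UNIV"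
proof -
  have inj: "inj_on x {1..N}" by (rule separated_inj_on[OF e sep])
  have "(\<Sum>i=1..N. (\<Sum>j=1..N. trunc_kernel p r (x i - x j)) - r powr (-p))
      \<le> (\<Sum>i=1..N. \<Sum>j\<in>{1..N} - {i}. norm (x i - x j) powr (-p))"
  proof (rule sum_mono)
    fix i assume i: "i \<in> {1..N}"
    have "(\<Sum>j=1..N. trunc_kernel p r (x i - x j)) = trunc_kernel p r (x i - x i) + (\<Sum>j\<in>{1..N} - {i}. trunc_kernel p r (x i - x j))"
      using i by (intro sum.remove) auto
    moreover have "trunc_kernel p r (x i - x i) = r powr (-p)" using r by (simp add: trunc_kernel_def)
    moreover have "(\<Sum>j\<in>{1..N} - {i}. trunc_kernel p r (x i - x j)) \<le> (\<Sum>j\<in>{1..N} - {i}. norm (x i - x j) powr (-p))"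
    proof (intro sum_mono trunc_le p)
      fix j assume "j \<in> {1..N} - {i}"
      then show "x i - x j \<noteq> 0" using inj_onD[OF inj, of i j] i by auto
    qed
    ultimately show "(\<Sum>j=1..N. trunc_kernel p r (x i - x j)) - r powr (-p)
        \<le> (\<Sum>j\<in>{1..N} - {i}. norm (x i - x j) powr (-p))" by linarith
  qed
  then have "s\<^sup>2 * (\<Sum>i=1..N. (\<Sum>j=1..N. trunc_kernel p r (x i - x j)) - r powr (-p))
      \<le> s\<^sup>2 * (\<Sum>i=1..N. \<Sum>j\<in>{1..N} - {i}. norm (x i - x j) powr (-p))"
    by (intro mult_left_mono) auto
  then show ?thesis
    using s by (simp add: interaction_empirical measure_empirical sum_subtractf power2_eq_square algebra_simps)
qed

text \<open>
  Fatou's lemma, applied to both integrals. The truncated kernels converge to the kernel off the diagonal,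
  and on the diagonal the kernel has value 0.
\<close>

lemma riesz_energy_le:
  fixes M :: "'a::euclidean_space measure" and p A :: real
  assumes M: "fin_borel M" and p: "p > 0"
    and A: "\<And>n. (\<integral>x. \<integral>y. trunc_kernel p (1 / real (Suc n)) (x - y) \<partial>M \<partial>M) \<le> A"
  shows "enn2real (riesz_energy p M) \<le> A"
proof -
  interpret finite_measure M using M by (simp add: fin_borel_def)
  have [measurable_cong]: "sets M = sets borel" using M by (simp add: fin_borel_def)
  let ?r = "\<lambda>n. 1 / real (Suc n)"
  have pos: "?r n > 0" for n by simp
  have inner: "ennreal (\<integral>y. trunc_kernel p (?r n) (x - y) \<partial>M) = (\<integral>\<^sup>+y. ennreal (trunc_kernel p (?r n) (x - y)) \<partial>M)" for x n
  proof (rule nn_integral_eq_integral[symmetric])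
    show "integrable M (\<lambda>y. trunc_kernel p (?r n) (x - y))"
      by (rule integrable_bounded[OF M _ trunc_bound[OF p pos]]) measurable
  qed (simp add: trunc_nonneg)
  have outer: "ennreal (\<integral>x. \<integral>y. trunc_kernel p (?r n) (x - y) \<partial>M \<partial>M)
      = (\<integral>\<^sup>+x. \<integral>\<^sup>+y. ennreal (trunc_kernel p (?r n) (x - y)) \<partial>M \<partial>M)" for n
    unfolding inner[symmetric]
  proof (rule nn_integral_eq_integral[symmetric])
    have "continuous_on UNIV (\<lambda>x::'a. \<integral>y. trunc_kernel p (?r n) (x - y) \<partial>M)"
      by (rule convolution_continuous[OF M trunc_uniformly_continuous[OF p pos] trunc_bound[OF p pos]])
    then have c: "(\<lambda>x::'a. \<integral>y. trunc_kernel p (?r n) (x - y) \<partial>M) \<in> borel_measurable borel"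
      by (rule borel_measurable_continuous_onI)
    show "integrable M (\<lambda>x. \<integral>y. trunc_kernel p (?r n) (x - y) \<partial>M)"
      by (rule integrable_bounded[OF M c integral_bounded[OF M _ trunc_bound[OF p pos]]]) measurable
  qed (intro AE_I2 integral_nonneg_AE, simp add: trunc_nonneg)
  have pt: "ennreal (norm (x - y) powr (-p)) \<le> liminf (\<lambda>n. ennreal (trunc_kernel p (?r n) (x - y)))" for x y :: 'a
  proof (cases "x = y")
    case False
    have "(\<lambda>n. ?r n) \<longlonglongrightarrow> 0" by real_asymp
    then have "\<forall>\<^sub>F n in sequentially. ?r n < norm (x - y)"
      by (rule order_tendstoD) (use False in simp)
    then have "\<forall>\<^sub>F n in sequentially. ennreal (norm (x - y) powr (-p)) \<le> ennreal (trunc_kernel p (?r n) (x - y))"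
      by eventually_elim (simp add: trunc_far)
    then show ?thesis by (rule Liminf_bounded)
  qed simp
  have "riesz_energy p M \<le> (\<integral>\<^sup>+x. \<integral>\<^sup>+y. liminf (\<lambda>n. ennreal (trunc_kernel p (?r n) (x - y))) \<partial>M \<partial>M)"
    unfolding riesz_energy_def by (intro nn_integral_mono pt)
  also have "\<dots> \<le> (\<integral>\<^sup>+x. liminf (\<lambda>n. \<integral>\<^sup>+y. ennreal (trunc_kernel p (?r n) (x - y)) \<partial>M) \<partial>M)"
    by (intro nn_integral_mono nn_integral_liminf) measurable
  also have "\<dots> \<le> liminf (\<lambda>n. \<integral>\<^sup>+x. \<integral>\<^sup>+y. ennreal (trunc_kernel p (?r n) (x - y)) \<partial>M \<partial>M)"
    by (intro nn_integral_liminf) measurable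
  also have "\<dots> = liminf (\<lambda>n. ennreal (\<integral>x. \<integral>y. trunc_kernel p (?r n) (x - y) \<partial>M \<partial>M))"
    by (simp only: outer)
  also have "\<dots> \<le> liminf (\<lambda>n::nat. ennreal A)"
    by (intro Liminf_mono always_eventually allI ennreal_leI A)
  also have "\<dots> = ennreal A" by (simp add: Liminf_const)
  finally have "enn2real (riesz_energy p M) \<le> enn2real (ennreal A)"
    by (intro enn2real_mono) auto
  moreover have "0 \<le> (\<integral>x. \<integral>y. trunc_kernel p (?r 0) (x - y) \<partial>M \<partial>M)"
    by (intro integral_nonneg_AE AE_I2) (simp add: trunc_nonneg)
  then have "0 \<le> A" using A[of 0] by linarith
  ultimately show ?thesis by simp
qed

lemma integral_density_measure:
  fixes \<rho> \<phi> :: "'a::euclidean_space \<Rightarrow> real"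
  assumes "integrable lborel \<rho>" "\<And>x. 0 \<le> \<rho> x" "\<phi> \<in> borel_measurable borel"
  shows "(\<integral>x. \<phi> x \<partial>density_measure \<rho>) = (\<integral>x. \<phi> x * \<rho> x \<partial>lborel)"
    "integrable (density_measure \<rho>) \<phi> \<longleftrightarrow> integrable lborel (\<lambda>x. \<phi> x * \<rho> x)"
proof -
  have [measurable]: "\<rho> \<in> borel_measurable borel" using assms(1) by simp
  show "(\<integral>x. \<phi> x \<partial>density_measure \<rho>) = (\<integral>x. \<phi> x * \<rho> x \<partial>lborel)"
    unfolding density_measure_def using assms
    by (subst integral_density) (auto simp: mult.commute)
  show "integrable (density_measure \<rho>) \<phi> \<longleftrightarrow> integrable lborel (\<lambda>x. \<phi> x * \<rho> x)"
    unfolding density_measure_def using assms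
    by (subst integrable_density) (auto simp: mult.commute)
qed

context limit_density
begin

definition "\<rho>_cut n x = indicator (cball 0 (real n)) x * \<rho> x"

lemma \<rho>_cut_props:
  "integrable lborel (\<rho>_cut n)" "0 \<le> \<rho>_cut n x" "\<rho>_cut n x \<le> 1" "norm x > real n \<Longrightarrow> \<rho>_cut n x = 0"
  "(\<integral>x. \<rho>_cut n x \<partial>lborel) \<le> (\<integral>x. \<rho> x \<partial>lborel)"
proof -
  have [measurable]: "\<rho> \<in> borel_measurable borel" using int_\<rho> by simp
  have [measurable]: "cball (0::'a) (real n) \<in> sets borel" by simp
  show int: "integrable lborel (\<rho>_cut n)"
    unfolding \<rho>_cut_def by (rule Bochner_Integration.integrable_bound[OF int_\<rho>]) (auto simp: indicator_def)
  show "0 \<le> \<rho>_cut n x" "\<rho>_cut n x \<le> 1" "norm x > real n \<Longrightarrow> \<rho>_cut n x = 0"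
    using \<rho>_nonneg[of x] \<rho>_le_1[of x] by (auto simp: \<rho>_cut_def indicator_def)
  show "(\<integral>x. \<rho>_cut n x \<partial>lborel) \<le> (\<integral>x. \<rho> x \<partial>lborel)"
    using \<rho>_nonneg by (intro integral_mono int int_\<rho>) (auto simp: \<rho>_cut_def indicator_def)
qed

lemma \<rho>_cut_tendsto:
  assumes int: "integrable lborel (\<lambda>x. \<phi> x * \<rho> x)" and [measurable]: "\<phi> \<in> borel_measurable borel"
  shows "(\<lambda>n. \<integral>x. \<phi> x * \<rho>_cut n x \<partial>lborel) \<longlonglongrightarrow> (\<integral>x. \<phi> x * \<rho> x \<partial>lborel)"
proof (rule integral_dominated_convergence[where w = "\<lambda>x. \<bar>\<phi> x * \<rho> x\<bar>"])
  have [measurable]: "\<rho> \<in> borel_measurable borel" using int_\<rho> by simp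
  show "(\<lambda>x. \<phi> x * \<rho> x) \<in> borel_measurable lborel" by measurable
  show "(\<lambda>x. \<phi> x * \<rho>_cut n x) \<in> borel_measurable lborel" for n
    using \<rho>_cut_props(1)[of n] by measurable
  show "integrable lborel (\<lambda>x. \<bar>\<phi> x * \<rho> x\<bar>)" using int by simp
  show "AE x in lborel. (\<lambda>n. \<phi> x * \<rho>_cut n x) \<longlonglongrightarrow> \<phi> x * \<rho> x"
  proof (intro AE_I2 tendsto_eventually)
    fix x :: 'a
    obtain N :: nat where "norm x \<le> real N" using real_arch_simple by blast
    then show "\<forall>\<^sub>F n in sequentially. \<phi> x * \<rho>_cut n x = \<phi> x * \<rho> x"
      by (intro eventually_sequentiallyI[of N]) (simp add: \<rho>_cut_def indicator_def)
  qed
  show "AE x in lborel. norm (\<phi> x * \<rho>_cut n x) \<le> \<bar>\<phi> x * \<rho> x\<bar>" for n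
    by (simp add: \<rho>_cut_def indicator_def)
qed

definition "mass = (\<integral>x. \<rho> x \<partial>lborel)"

lemma mass_nonneg: "0 \<le> mass"
  unfolding mass_def by (intro integral_nonneg_AE AE_I2 \<rho>_nonneg)

text \<open>
  Diagonal sequence over the truncations of \<open>\<rho>\<close> to the balls of radius \<open>n\<close>. The accuracy at stage \<open>n\<close> is
  adapted to the size and the oscillation of \<open>g\<close> on the ball of radius \<open>n + 1\<close>, so that the error for \<open>g\<close>
  vanishes no matter how fast \<open>g\<close> grows; the truncation keeps points away from regions where \<open>g\<close> is
  large and \<open>\<rho>\<close> is merely small.
\<close>

lemma recovery_sequence:
  obtains N x where
    "\<forall>\<^sub>F \<epsilon> in at_right 0. separated \<epsilon> (N \<epsilon>) (x \<epsilon> :: nat \<Rightarrow> 'a)"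
    "\<forall>\<phi> B. uniformly_continuous_on UNIV \<phi> \<longrightarrow> (\<forall>u. \<bar>\<phi> u\<bar> \<le> B) \<longrightarrow>
      ((\<lambda>\<epsilon>. scale_factor TYPE('a) \<epsilon> * (\<Sum>i=1..N \<epsilon>. \<phi> (x \<epsilon> i))) \<longlongrightarrow> (\<integral>u. \<phi> u * \<rho> u \<partial>lborel)) (at_right 0)"
    "integrable lborel (\<lambda>u. g u * \<rho> u) \<longrightarrow>
      ((\<lambda>\<epsilon>. scale_factor TYPE('a) \<epsilon> * (\<Sum>i=1..N \<epsilon>. g (x \<epsilon> i))) \<longlongrightarrow> (\<integral>u. g u * \<rho> u \<partial>lborel)) (at_right 0)"
proof -
  let ?s = "scale_factor TYPE('a)"
  have gm: "g \<in> borel_measurable borel" using g_cont by (rule borel_measurable_continuous_onI)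
  have "\<exists>G h. G \<ge> 0 \<and> h > 0 \<and> h \<le> 1 / real (Suc n) \<and> (\<forall>u. norm u \<le> real n + 1 \<longrightarrow> \<bar>g u\<bar> \<le> G) \<and>
      (\<forall>u v. norm u \<le> real n + 1 \<longrightarrow> norm v \<le> real n + 1 \<longrightarrow> norm (u - v) \<le> h \<longrightarrow> \<bar>g u - g v\<bar> \<le> 1 / real (Suc n))" for n
  proof -
    let ?K = "cball (0::'a) (real n + 1)"
    have "bounded (g ` ?K)"
      by (intro compact_imp_bounded compact_continuous_image continuous_on_subset[OF g_cont]) auto
    then obtain G where G: "\<forall>u\<in>?K. \<bar>g u\<bar> \<le> G" by (auto simp: bounded_iff)
    have "0 \<in> ?K" by simp
    then have "\<bar>g 0\<bar> \<le> G" using G by blast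
    then have G0: "G \<ge> 0" by linarith
    have "uniformly_continuous_on ?K g"
      by (intro compact_uniformly_continuous continuous_on_subset[OF g_cont]) auto
    moreover have "1 / real (Suc n) > 0" by simp
    ultimately obtain d where d: "d > 0" "\<And>u v. u \<in> ?K \<Longrightarrow> v \<in> ?K \<Longrightarrow> dist v u < d \<Longrightarrow> dist (g v) (g u) < 1 / real (Suc n)"
      unfolding uniformly_continuous_on_def by metis
    define h where "h = min (d / 2) (1 / real (Suc n))"
    have h: "h > 0" "h \<le> 1 / real (Suc n)" "h < d" using d(1) by (auto simp: h_def)
    have "\<bar>g u - g v\<bar> \<le> 1 / real (Suc n)" if "norm u \<le> real n + 1" "norm v \<le> real n + 1" "norm (u - v) \<le> h" for u v
      using d(2)[of v u] that h(3) by (simp add: dist_norm dist_real_def)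
    then show ?thesis using G G0 h by (intro exI[of _ G] exI[of _ h]) auto
  qed
  then obtain G h where G: "\<And>n. G n \<ge> (0::real)" and h: "\<And>n. h n > (0::real)" "\<And>n. h n \<le> 1 / real (Suc n)"
    and Gb: "\<And>n u. norm u \<le> real n + 1 \<Longrightarrow> \<bar>g u\<bar> \<le> G n"
    and osc: "\<And>n u v. norm u \<le> real n + 1 \<Longrightarrow> norm v \<le> real n + 1 \<Longrightarrow> norm (u - v) \<le> h n \<Longrightarrow> \<bar>g u - g v\<bar> \<le> 1 / real (Suc n)"
    by metis
  \<comment> \<open>Small enough for the bound \<open>G n\<close> of \<open>g\<close>, and also for test functions with a bound independent of \<open>n\<close>.\<close>
  define \<delta> where "\<delta> n = 1 / (real (Suc n) * (G n + 1))" for n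
  have \<delta>: "\<delta> n > 0" "\<delta> n \<le> 1 / real (Suc n)" "G n * \<delta> n \<le> 1 / real (Suc n)" for n
    using G[of n] by (auto simp: \<delta>_def divide_simps)
  let ?P = "\<lambda>n \<epsilon>. \<exists>N x. separated \<epsilon> N (x :: nat \<Rightarrow> 'a) \<and> approximates (\<rho>_cut n) (real n) (\<delta> n) (h n) (?s \<epsilon>) N x"
  have "eventually (?P n) (at_right 0)" for n
    by (rule recovery_configurations) (use \<rho>_cut_props \<delta> h in auto)
  then obtain k where k: "filterlim k at_top (at_right 0)" and Pk: "\<forall>\<^sub>F \<epsilon> in at_right 0. ?P (k \<epsilon>) \<epsilon>"
    by (rule diagonal_choice)
  let ?Q = "\<lambda>\<epsilon> N x. separated \<epsilon> N (x :: nat \<Rightarrow> 'a) \<and>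
      approximates (\<rho>_cut (k \<epsilon>)) (real (k \<epsilon>)) (\<delta> (k \<epsilon>)) (h (k \<epsilon>)) (?s \<epsilon>) N x"
  have "\<exists>Nx. \<forall>\<epsilon>. (\<exists>N x. ?Q \<epsilon> N x) \<longrightarrow> ?Q \<epsilon> (fst (Nx \<epsilon>)) (snd (Nx \<epsilon>))"
  proof (rule choice, rule allI)
    fix \<epsilon>
    show "\<exists>Nx. (\<exists>N x. ?Q \<epsilon> N x) \<longrightarrow> ?Q \<epsilon> (fst Nx) (snd Nx)"
    proof (cases "\<exists>N x. ?Q \<epsilon> N x")
      case True
      then obtain N x where "?Q \<epsilon> N x" by blast
      then show ?thesis by (intro exI[of _ "(N, x)"]) simp
    qed simp
  qed
  then obtain Nx where Nx0: "\<And>\<epsilon>. (\<exists>N x. ?Q \<epsilon> N x) \<Longrightarrow> ?Q \<epsilon> (fst (Nx \<epsilon>)) (snd (Nx \<epsilon>))"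
    by blast
  define N where "N \<epsilon> = fst (Nx \<epsilon>)" for \<epsilon>
  define x where "x \<epsilon> = snd (Nx \<epsilon>)" for \<epsilon>
  have Nx: "?Q \<epsilon> (N \<epsilon>) (x \<epsilon>)" if "?P (k \<epsilon>) \<epsilon>" for \<epsilon>
    unfolding N_def x_def using that by (rule Nx0)
  have sep: "\<forall>\<^sub>F \<epsilon> in at_right 0. separated \<epsilon> (N \<epsilon>) (x \<epsilon>)"
    using Pk by eventually_elim (use Nx in blast)
  have approx: "\<forall>\<^sub>F \<epsilon> in at_right 0. approximates (\<rho>_cut (k \<epsilon>)) (real (k \<epsilon>)) (\<delta> (k \<epsilon>)) (h (k \<epsilon>)) (?s \<epsilon>) (N \<epsilon>) (x \<epsilon>)"
    using Pk by eventually_elim (use Nx in blast)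
  have inv0: "((\<lambda>\<epsilon>. 1 / real (Suc (k \<epsilon>))) \<longlongrightarrow> 0) (at_right 0)"
  proof (rule filterlim_compose[OF _ k])
    show "(\<lambda>n. 1 / real (Suc n)) \<longlonglongrightarrow> 0" by real_asymp
  qed
  have conclude: "((\<lambda>\<epsilon>. ?s \<epsilon> * (\<Sum>i=1..N \<epsilon>. \<phi> (x \<epsilon> i))) \<longlongrightarrow> (\<integral>u. \<phi> u * \<rho> u \<partial>lborel)) (at_right 0)"
    if int: "integrable lborel (\<lambda>u. \<phi> u * \<rho> u)" and meas: "\<phi> \<in> borel_measurable borel"
      and err: "\<And>e. e > 0 \<Longrightarrow> \<forall>\<^sub>F \<epsilon> in at_right 0.
        \<bar>?s \<epsilon> * (\<Sum>i=1..N \<epsilon>. \<phi> (x \<epsilon> i)) - (\<integral>u. \<phi> u * \<rho>_cut (k \<epsilon>) u \<partial>lborel)\<bar> < e" for \<phi>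
  proof (rule tendstoI)
    fix e :: real assume e: "e > 0"
    have "((\<lambda>\<epsilon>. \<integral>u. \<phi> u * \<rho>_cut (k \<epsilon>) u \<partial>lborel) \<longlongrightarrow> (\<integral>u. \<phi> u * \<rho> u \<partial>lborel)) (at_right 0)"
      by (rule filterlim_compose[OF \<rho>_cut_tendsto[OF int meas] k])
    then have "\<forall>\<^sub>F \<epsilon> in at_right 0. dist (\<integral>u. \<phi> u * \<rho>_cut (k \<epsilon>) u \<partial>lborel) (\<integral>u. \<phi> u * \<rho> u \<partial>lborel) < e / 2"
      using e by (intro tendstoD) auto
    moreover have "e / 2 > 0" using e by simp
    note err[OF this]
    ultimately show "\<forall>\<^sub>F \<epsilon> in at_right 0. dist (?s \<epsilon> * (\<Sum>i=1..N \<epsilon>. \<phi> (x \<epsilon> i))) (\<integral>u. \<phi> u * \<rho> u \<partial>lborel) < e"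
      by eventually_elim (unfold dist_real_def, linarith)
  qed
  show thesis
  proof (rule that[OF sep]; intro allI impI)
    fix \<phi> :: "'a \<Rightarrow> real" and B
    assume unif: "uniformly_continuous_on UNIV \<phi>" and "\<forall>u. \<bar>\<phi> u\<bar> \<le> B"
    then have B: "\<bar>\<phi> u\<bar> \<le> B" for u by blast
    have meas [measurable]: "\<phi> \<in> borel_measurable borel"
      using unif by (intro borel_measurable_continuous_onI uniformly_continuous_imp_continuous)
    have B0: "B \<ge> 0" using B[of 0] by linarith
    show "((\<lambda>\<epsilon>. ?s \<epsilon> * (\<Sum>i=1..N \<epsilon>. \<phi> (x \<epsilon> i))) \<longlongrightarrow> (\<integral>u. \<phi> u * \<rho> u \<partial>lborel)) (at_right 0)"
    proof (rule conclude[OF _ meas])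
      have "integrable (density_measure \<rho>) \<phi>"
        by (rule integrable_bounded[OF fin_borel_limit meas B])
      then show "integrable lborel (\<lambda>u. \<phi> u * \<rho> u)"
        using integral_density_measure(2)[OF int_\<rho> \<rho>_nonneg meas] by simp
      fix e :: real assume e: "e > 0"
      \<comment> \<open>Room for \<open>e'\<close> from the size of \<open>\<phi>\<close> and for \<open>2 e'\<close> times the mass from its oscillation.\<close>
      define e' where "e' = e / (2 * (mass + 1) + 1)"
      have e': "e' > 0" unfolding e'_def using e mass_nonneg by simp
      then obtain d where d: "d > 0" "\<And>u v. dist u v < d \<Longrightarrow> dist (\<phi> u) (\<phi> v) < e'"
        using unif unfolding uniformly_continuous_on_def by (metis UNIV_I)
      have "\<forall>\<^sub>F \<epsilon> in at_right 0. 1 / real (Suc (k \<epsilon>)) < d"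
        using inv0 d(1) by (rule order_tendstoD)
      moreover have "\<forall>\<^sub>F \<epsilon> in at_right 0. B * (1 / real (Suc (k \<epsilon>))) < e'"
        using tendsto_mult[OF tendsto_const inv0, of B] e' by (intro order_tendstoD) auto
      ultimately show "\<forall>\<^sub>F \<epsilon> in at_right 0.
          \<bar>?s \<epsilon> * (\<Sum>i=1..N \<epsilon>. \<phi> (x \<epsilon> i)) - (\<integral>u. \<phi> u * \<rho>_cut (k \<epsilon>) u \<partial>lborel)\<bar> < e"
        using approx
      proof eventually_elim
        case (elim \<epsilon>)
        have "\<bar>\<phi> u - \<phi> v\<bar> \<le> e'" if "norm (u - v) \<le> h (k \<epsilon>)" for u v
          using d(2)[of u v] that h(2)[of "k \<epsilon>"] elim(1) by (simp add: dist_norm)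
        then have "\<bar>?s \<epsilon> * (\<Sum>i=1..N \<epsilon>. \<phi> (x \<epsilon> i)) - (\<integral>u. \<phi> u * \<rho>_cut (k \<epsilon>) u \<partial>lborel)\<bar>
            \<le> B * \<delta> (k \<epsilon>) + 2 * e' * (\<integral>u. \<rho>_cut (k \<epsilon>) u \<partial>lborel)"
          using elim(3)[unfolded approximates_def, rule_format, of \<phi> B e'] B meas by blast
        also have "\<dots> \<le> B * (1 / real (Suc (k \<epsilon>))) + 2 * e' * mass"
          using \<delta>(2)[of "k \<epsilon>"] \<rho>_cut_props(5)[of "k \<epsilon>"] e' B0
          by (intro add_mono mult_left_mono) (auto simp: mass_def)
        also have "\<dots> < e' + 2 * e' * mass" using elim(2) by simp
        also have "\<dots> \<le> e' * (2 * (mass + 1) + 1)" using e' by (simp add: algebra_simps)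
        also have "\<dots> = e" using mass_nonneg by (simp add: e'_def)
        finally show ?case .
      qed
    qed
  next
    assume int: "integrable lborel (\<lambda>u. g u * \<rho> u)"
    show "((\<lambda>\<epsilon>. ?s \<epsilon> * (\<Sum>i=1..N \<epsilon>. g (x \<epsilon> i))) \<longlongrightarrow> (\<integral>u. g u * \<rho> u \<partial>lborel)) (at_right 0)"
    proof (rule conclude[OF int gm])
      fix e :: real assume e: "e > 0"
      have "((\<lambda>\<epsilon>. (1 + 2 * mass) * (1 / real (Suc (k \<epsilon>)))) \<longlongrightarrow> (1 + 2 * mass) * 0) (at_right 0)"
        by (intro tendsto_mult tendsto_const inv0)
      then have "\<forall>\<^sub>F \<epsilon> in at_right 0. (1 + 2 * mass) * (1 / real (Suc (k \<epsilon>))) < e"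
        using e by (intro order_tendstoD) auto
      then show "\<forall>\<^sub>F \<epsilon> in at_right 0.
          \<bar>?s \<epsilon> * (\<Sum>i=1..N \<epsilon>. g (x \<epsilon> i)) - (\<integral>u. g u * \<rho>_cut (k \<epsilon>) u \<partial>lborel)\<bar> < e"
        using approx
      proof eventually_elim
        case (elim \<epsilon>)
        have "\<bar>?s \<epsilon> * (\<Sum>i=1..N \<epsilon>. g (x \<epsilon> i)) - (\<integral>u. g u * \<rho>_cut (k \<epsilon>) u \<partial>lborel)\<bar>
            \<le> G (k \<epsilon>) * \<delta> (k \<epsilon>) + 2 * (1 / real (Suc (k \<epsilon>))) * (\<integral>u. \<rho>_cut (k \<epsilon>) u \<partial>lborel)"
          using elim(2)[unfolded approximates_def, rule_format, of g "G (k \<epsilon>)" "1 / real (Suc (k \<epsilon>))"] Gb osc gm by blast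
        also have "\<dots> \<le> 1 / real (Suc (k \<epsilon>)) + 2 * (1 / real (Suc (k \<epsilon>))) * mass"
          using \<delta>(3)[of "k \<epsilon>"] \<rho>_cut_props(5)[of "k \<epsilon>"]
          by (intro add_mono mult_left_mono) (auto simp: mass_def)
        also have "\<dots> = (1 + 2 * mass) * (1 / real (Suc (k \<epsilon>)))" by (simp only: ring_distribs mult_1 mult_1_right mult_ac)
        finally show ?case using elim(1) by linarith
      qed
    qed
  qed
qed

lemma scale_factor_tendsto_0: "((\<lambda>\<epsilon>. scale_factor TYPE('a) \<epsilon>) \<longlongrightarrow> 0) (at_right 0)"
proof -
  have "((\<lambda>\<epsilon>::real. \<epsilon>) \<longlongrightarrow> 0) (at_right 0)" by (rule tendsto_ident_at)
  then have "((\<lambda>\<epsilon>. \<epsilon> ^ DIM('a) * omega TYPE('a) / packing_density TYPE('a))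
      \<longlongrightarrow> 0 ^ DIM('a) * omega TYPE('a) / packing_density TYPE('a)) (at_right 0)"
    using packing_density_pos[where ?'a = 'a]
    by (intro tendsto_divide tendsto_mult tendsto_power tendsto_const) auto
  then show ?thesis by (simp add: scale_factor_def[abs_def] zero_power)
qed

text \<open>
  If \<open>g\<close> is not integrable against \<open>\<rho>\<close>, its integral is \<open>\<infinity>\<close> and so is the limit energy. Otherwise the
  potential energies converge, and the interaction energies are bounded through the truncated kernels.
\<close>

lemma limsup_inequality:
  obtains \<mu> :: "real \<Rightarrow> 'a measure" where "\<And>\<epsilon>. \<mu> \<epsilon> \<in> Mb"
    "tight_conv (\<lambda>\<epsilon>. scale_measure (ennreal (scale_factor TYPE('a) \<epsilon>)) (\<mu> \<epsilon>)) \<nu>0"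
    "Limsup (at_right 0) (\<lambda>\<epsilon>. T_eps \<sigma> g \<epsilon> (\<mu> \<epsilon>)) \<le> T_lim \<sigma> g \<nu>0"
proof -
  let ?s = "scale_factor TYPE('a)"
  obtain N x where sep: "\<forall>\<^sub>F \<epsilon> in at_right 0. separated \<epsilon> (N \<epsilon>) (x \<epsilon> :: nat \<Rightarrow> 'a)"
    and stat: "\<forall>\<phi> B. uniformly_continuous_on UNIV \<phi> \<longrightarrow> (\<forall>u. \<bar>\<phi> u\<bar> \<le> B) \<longrightarrow>
      ((\<lambda>\<epsilon>. ?s \<epsilon> * (\<Sum>i=1..N \<epsilon>. \<phi> (x \<epsilon> i))) \<longlongrightarrow> (\<integral>u. \<phi> u * \<rho> u \<partial>lborel)) (at_right 0)"
    and gstat: "integrable lborel (\<lambda>u. g u * \<rho> u) \<longrightarrow>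
      ((\<lambda>\<epsilon>. ?s \<epsilon> * (\<Sum>i=1..N \<epsilon>. g (x \<epsilon> i))) \<longlongrightarrow> (\<integral>u. g u * \<rho> u \<partial>lborel)) (at_right 0)"
    by (rule recovery_sequence) (rule that)
  define \<mu> where "\<mu> \<epsilon> = dirac_sum (N \<epsilon>) (x \<epsilon>)" for \<epsilon>
  define \<nu> where "\<nu> \<epsilon> = empirical (?s \<epsilon>) (N \<epsilon>) (x \<epsilon>)" for \<epsilon>
  have \<nu>\<mu>: "scale_measure (ennreal (?s \<epsilon>)) (\<mu> \<epsilon>) = \<nu> \<epsilon>" for \<epsilon>
    by (simp add: \<nu>_def \<mu>_def empirical_def)
  have ev: "\<forall>\<^sub>F \<epsilon>::real in at_right 0. 0 < \<epsilon>" by (rule eventually_at_right_less)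
  have s_nonneg: "\<forall>\<^sub>F \<epsilon> in at_right 0. ?s \<epsilon> \<ge> 0"
    using ev by eventually_elim (simp add: scale_factor_pos less_imp_le)
  have lin: "((\<lambda>\<epsilon>. \<integral>u. \<phi> u \<partial>\<nu> \<epsilon>) \<longlongrightarrow> (\<integral>u. \<phi> u \<partial>\<nu>0)) (at_right 0)"
    if unif: "uniformly_continuous_on UNIV \<phi>" and B: "\<And>u. \<bar>\<phi> u\<bar> \<le> B" for \<phi> :: "'a \<Rightarrow> real" and B
  proof -
    have meas: "\<phi> \<in> borel_measurable borel"
      using unif by (intro borel_measurable_continuous_onI uniformly_continuous_imp_continuous)
    have "\<forall>\<^sub>F \<epsilon> in at_right 0. ?s \<epsilon> * (\<Sum>i=1..N \<epsilon>. \<phi> (x \<epsilon> i)) = (\<integral>u. \<phi> u \<partial>\<nu> \<epsilon>)"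
      using s_nonneg by eventually_elim (simp add: \<nu>_def integral_empirical[OF meas])
    moreover have "(\<integral>u. \<phi> u \<partial>\<nu>0) = (\<integral>u. \<phi> u * \<rho> u \<partial>lborel)"
      by (rule integral_density_measure(1)[OF int_\<rho> \<rho>_nonneg meas])
    ultimately show ?thesis
      using Lim_transform_eventually[OF stat[rule_format, OF unif B]] by simp
  qed
  have tight: "tight_conv \<nu> \<nu>0"
    unfolding tight_conv_def weak_star_conv_def
  proof (intro conjI allI impI)
    fix \<phi> :: "'a \<Rightarrow> real" assume \<phi>: "continuous_on UNIV \<phi>" "(\<phi> \<longlongrightarrow> 0) at_infinity"
    obtain B where "\<And>u. \<bar>\<phi> u\<bar> \<le> B" using vanishing_bounded[OF \<phi>] by blast
    then show "((\<lambda>\<epsilon>. \<integral>u. \<phi> u \<partial>\<nu> \<epsilon>) \<longlongrightarrow> (\<integral>u. \<phi> u \<partial>\<nu>0)) (at_right 0)"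
      by (rule lin[OF vanishing_uniformly_continuous[OF \<phi>]])
  next
    have "((\<lambda>\<epsilon>. \<integral>u. (1::real) \<partial>\<nu> \<epsilon>) \<longlongrightarrow> (\<integral>u. 1 \<partial>\<nu>0)) (at_right 0)"
      by (rule lin[of _ 1]) (auto simp: uniformly_continuous_on_const)
    moreover have "space (\<nu> \<epsilon>) = UNIV" for \<epsilon>
      unfolding \<nu>_def by (rule space_fin_borel[OF fin_borel_empirical])
    ultimately show "((\<lambda>\<epsilon>. measure (\<nu> \<epsilon>) UNIV) \<longlongrightarrow> measure \<nu>0 UNIV) (at_right 0)"
      by simp
  qed
  interpret tight_family \<nu> \<nu>0
    by unfold_locales (use tight fin_borel_limit in \<open>auto simp: \<nu>_def fin_borel_empirical\<close>)
  have gm: "g \<in> borel_measurable borel" using g_cont by (rule borel_measurable_continuous_onI)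
  have "Limsup (at_right 0) (\<lambda>\<epsilon>. T_eps \<sigma> g \<epsilon> (\<mu> \<epsilon>)) \<le> T_lim \<sigma> g \<nu>0" (is "?L \<le> _")
  proof (cases "integrable \<nu>0 g")
    case False
    have "(\<integral>\<^sup>+x. ennreal (g x) \<partial>\<nu>0) = \<infinity>"
      using False neg_finite gm unfolding real_integrable_def
      by (auto simp: less_top[symmetric] cong: measurable_cong_sets)
    then have "eintegral \<nu>0 g = \<infinity>"
      using enn2ereal_finite[OF neg_finite] unfolding eintegral_def by simp
    then show ?thesis by (simp add: T_lim_eq)
  next
    case True
    define Ig where "Ig = (\<integral>u. g u * \<rho> u \<partial>lborel)"
    have "integrable lborel (\<lambda>u. g u * \<rho> u)"
      using True integral_density_measure(2)[OF int_\<rho> \<rho>_nonneg gm] by simp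
    note glim = gstat[rule_format, OF this, folded Ig_def]
    have T: "T_lim \<sigma> g \<nu>0 = ereal (Ig - limit_energy)"
      unfolding T_lim_eq eintegral_eq_integral[OF True] Ig_def
      by (simp add: integral_density_measure(1)[OF int_\<rho> \<rho>_nonneg gm])
    let ?I = "\<lambda>r M. \<integral>u. \<integral>v. trunc_kernel p r (u - v) \<partial>M \<partial>M"
    have bound: "?L \<le> ereal (Ig - ?I r \<nu>0)" if r: "r > 0" for r
    proof -
      let ?b = "\<lambda>\<epsilon>. ?s \<epsilon> * (\<Sum>i=1..N \<epsilon>. g (x \<epsilon> i)) - ?I r (\<nu> \<epsilon>) + ?s \<epsilon> * r powr (-p) * measure (\<nu> \<epsilon>) UNIV"
      have "(?b \<longlongrightarrow> Ig - ?I r \<nu>0 + 0 * r powr (-p) * measure \<nu>0 UNIV) (at_right 0)"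
        by (intro tendsto_add tendsto_diff tendsto_mult tendsto_const glim mass_conv scale_factor_tendsto_0
            interaction_conv[OF trunc_uniformly_continuous trunc_bound] p_pos r)
      then have "((\<lambda>\<epsilon>. ereal (?b \<epsilon>)) \<longlongrightarrow> ereal (Ig - ?I r \<nu>0)) (at_right 0)" by simp
      then have "Limsup (at_right 0) (\<lambda>\<epsilon>. ereal (?b \<epsilon>)) = ereal (Ig - ?I r \<nu>0)"
        by (intro lim_imp_Limsup) auto
      moreover have "?L \<le> Limsup (at_right 0) (\<lambda>\<epsilon>. ereal (?b \<epsilon>))"
      proof (rule Limsup_mono)
        show "\<forall>\<^sub>F \<epsilon> in at_right 0. T_eps \<sigma> g \<epsilon> (\<mu> \<epsilon>) \<le> ereal (?b \<epsilon>)"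
          using sep ev s_nonneg
        proof eventually_elim
          case (elim \<epsilon>)
          have "T_eps \<sigma> g \<epsilon> (\<mu> \<epsilon>) = ereal (pair_energy \<sigma> \<epsilon> (N \<epsilon>) (x \<epsilon>)) + eintegral (\<mu> \<epsilon>) (\<lambda>u. g u * ?s \<epsilon>)"
            unfolding T_eps_def \<mu>_def by (simp add: F_eps_dirac_sum[OF elim(2,1)])
          also have "eintegral (\<mu> \<epsilon>) (\<lambda>u. g u * ?s \<epsilon>) = ereal (?s \<epsilon> * (\<Sum>i=1..N \<epsilon>. g (x \<epsilon> i)))"
          proof -
            have m: "(\<lambda>u. g u * ?s \<epsilon>) \<in> borel_measurable borel" using gm by measurable
            have "(\<Sum>i=1..N \<epsilon>. g (x \<epsilon> i) * ?s \<epsilon>) = ?s \<epsilon> * (\<Sum>i=1..N \<epsilon>. g (x \<epsilon> i))"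
              by (simp only: sum_distrib_right[symmetric] mult.commute[of "?s \<epsilon>"])
            then show ?thesis
              unfolding \<mu>_def eintegral_eq_integral[OF integral_dirac_sum(1)[OF m]] integral_dirac_sum(2)[OF m] by simp
          qed
          finally have "T_eps \<sigma> g \<epsilon> (\<mu> \<epsilon>) = ereal (pair_energy \<sigma> \<epsilon> (N \<epsilon>) (x \<epsilon>) + ?s \<epsilon> * (\<Sum>i=1..N \<epsilon>. g (x \<epsilon> i)))"
            by simp
          moreover have "pair_energy \<sigma> \<epsilon> (N \<epsilon>) (x \<epsilon>) \<le> - ?I r (\<nu> \<epsilon>) + ?s \<epsilon> * r powr (-p) * measure (\<nu> \<epsilon>) UNIV"
            using energy_lower_bound[OF elim(2) p_pos elim(1) r elim(3)]
            unfolding \<nu>_def pair_energy_sum p_def[symmetric] by linarith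
          ultimately show ?case by simp
        qed
      qed
      ultimately show ?thesis by simp
    qed
    show ?thesis
    proof (cases ?L)
      case (real l)
      have "?I (1 / real (Suc n)) \<nu>0 \<le> Ig - l" for n
        using bound[of "1 / real (Suc n)"] unfolding real by simp
      then have "limit_energy \<le> Ig - l"
        unfolding limit_energy_def by (rule riesz_energy_le[OF fin_borel_limit p_pos])
      then show ?thesis unfolding real T by simp
    next
      case PInf
      then show ?thesis using bound[of 1] by simp
    next
      case MInf
      then show ?thesis by simp
    qed
  qed
  moreover have "\<mu> \<epsilon> \<in> Mb" for \<epsilon>
    using fin_borel_dirac_sum unfolding \<mu>_def Mb_def fin_borel_def by auto
  ultimately show thesis
    using that[of \<mu>] tight by (simp add: \<nu>\<mu>)
qed

end

theorem theorem3p4: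
  fixes \<sigma> :: real and g :: "'a::euclidean_space \<Rightarrow> real"
  assumes "- real DIM('a) < \<sigma>" and "\<sigma> < 0"
    and "continuous_on UNIV g"
    and "\<exists>R. \<forall>x. norm x \<ge> R \<longrightarrow> g x \<ge> 0"
  shows
    "(\<forall>\<rho>\<in>L1_01. \<forall>\<mu> :: real \<Rightarrow> 'a measure.
        (\<forall>\<epsilon>\<in>{0<..<1}. \<mu> \<epsilon> \<in> Mb) \<longrightarrow>
        tight_conv (\<lambda>\<epsilon>. scale_measure (ennreal (scale_factor TYPE('a) \<epsilon>)) (\<mu> \<epsilon>)) (density_measure \<rho>) \<longrightarrow>
        T_lim \<sigma> g (density_measure \<rho>) \<le> Liminf (at_right 0) (\<lambda>\<epsilon>. T_eps \<sigma> g \<epsilon> (\<mu> \<epsilon>)))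
     \<and>
     (\<forall>\<rho>\<in>L1_01. \<exists>\<mu> :: real \<Rightarrow> 'a measure.
        (\<forall>\<epsilon>\<in>{0<..<1}. \<mu> \<epsilon> \<in> Mb) \<and>
        tight_conv (\<lambda>\<epsilon>. scale_measure (ennreal (scale_factor TYPE('a) \<epsilon>)) (\<mu> \<epsilon>)) (density_measure \<rho>) \<and>
        T_lim \<sigma> g (density_measure \<rho>) \<ge> Limsup (at_right 0) (\<lambda>\<epsilon>. T_eps \<sigma> g \<epsilon> (\<mu> \<epsilon>)))"
proof -
  obtain R where R: "\<And>x. norm x \<ge> R \<Longrightarrow> g x \<ge> 0" using assms(4) by blast
  have limit: "\<exists>\<rho>'. density_measure \<rho> = density_measure \<rho>' \<and> limit_density \<rho>' g \<sigma> (DIM('a) + \<sigma>) R"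
    if "\<rho> \<in> L1_01" for \<rho> :: "'a \<Rightarrow> real"
  proof -
    obtain \<rho>' where \<rho>': "integrable lborel \<rho>'" "\<And>x. 0 \<le> \<rho>' x" "\<And>x. \<rho>' x \<le> 1"
      "density_measure \<rho> = density_measure \<rho>'"
      using clamp_density[OF \<open>\<rho> \<in> L1_01\<close>] by blast
    have "limit_density \<rho>' g \<sigma> (DIM('a) + \<sigma>) R"
      by unfold_locales (use \<rho>' assms R in auto)
    with \<rho>'(4) show ?thesis by blast
  qed
  show ?thesis
  proof (intro conjI ballI allI impI)
    fix \<rho> :: "'a \<Rightarrow> real" and \<mu> :: "real \<Rightarrow> 'a measure"
    assume \<rho>: "\<rho> \<in> L1_01" and \<mu>: "\<forall>\<epsilon>\<in>{0<..<1}. \<mu> \<epsilon> \<in> Mb"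
      and conv: "tight_conv (\<lambda>\<epsilon>. scale_measure (ennreal (scale_factor TYPE('a) \<epsilon>)) (\<mu> \<epsilon>)) (density_measure \<rho>)"
    from limit[OF \<rho>] obtain \<rho>' where eq: "density_measure \<rho> = density_measure \<rho>'"
      and l: "limit_density \<rho>' g \<sigma> (DIM('a) + \<sigma>) R" by blast
    show "T_lim \<sigma> g (density_measure \<rho>) \<le> Liminf (at_right 0) (\<lambda>\<epsilon>. T_eps \<sigma> g \<epsilon> (\<mu> \<epsilon>))"
      using limit_density.liminf_inequality[OF l _ conv[unfolded eq]] \<mu> unfolding eq by blast
  next
    fix \<rho> :: "'a \<Rightarrow> real" assume \<rho>: "\<rho> \<in> L1_01"
    from limit[OF \<rho>] obtain \<rho>' where eq: "density_measure \<rho> = density_measure \<rho>'"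
      and l: "limit_density \<rho>' g \<sigma> (DIM('a) + \<sigma>) R" by blast
    show "\<exists>\<mu> :: real \<Rightarrow> 'a measure. (\<forall>\<epsilon>\<in>{0<..<1}. \<mu> \<epsilon> \<in> Mb) \<and>
        tight_conv (\<lambda>\<epsilon>. scale_measure (ennreal (scale_factor TYPE('a) \<epsilon>)) (\<mu> \<epsilon>)) (density_measure \<rho>) \<and>
        T_lim \<sigma> g (density_measure \<rho>) \<ge> Limsup (at_right 0) (\<lambda>\<epsilon>. T_eps \<sigma> g \<epsilon> (\<mu> \<epsilon>))"
      using limit_density.limsup_inequality[OF l] unfolding eq by metis
  qed
qed

end
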